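(* Let $S$ be a generic smooth surface in real $3$-space and let $H$ be a hyperbolic disc of $S$, i.e. a connected component of the hyperbolic domain that is an open disc bounded by a closed parabolic curve. Then the sum of the indices of the godrons lying on the parabolic curve bounding $H$ equals $2$. In particular, this parabolic curve contains a positive even number of godrons.
   Context: The ambient space is $\mathbb{R}^3$ or $\mathbb{RP}^3$; generic means in general position, in the usual sense of singularity theory. The elliptic domain of $S$ is the open set of points at which no real tangent line has more than $2$-point contact with $S$. The hyperbolic domain is the open set of points at which exactly two tangent lines (the asymptotic lines, with directions called asymptotic directions) have more than $2$-point contact with $S$. The parabolic curve is the smooth curve, separating these domains, of points with a unique (double) asymptotic line. A godron is a parabolic point at which the unique asymptotic direction is tangent to the parabolic curve. A godron has index $+1$ (is positive) if, at the neighbouring parabolic points, the half-asymptotic lines directed to the hyperbolic domain point towards the godron; it has index $-1$ (is negative) if they point away from the godron. Equivalently: let $\mathcal{A}\subset PT^*S$ be the surface formed by the asymptotic directions, regarded as contact elements of $S$ (it doubly covers the hyperbolic domain, with a fold over the parabolic curve); intersecting the tangent planes of $\mathcal{A}$ with the contact planes of $PT^*S$ gives a direction field on $\mathcal{A}$ whose singular points lie exactly over the godrons, and the index of a godron is the index of this direction field at the corresponding singular point. *)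

theory Defs
  imports "HOL-Analysis.Analysis"
begin

section \<open>Smooth maps\<close>

definition dderiv :: "'a \<Rightarrow> ('a::real_normed_vector \<Rightarrow> 'b::real_normed_vector) \<Rightarrow> 'a \<Rightarrow> 'b" where
  "dderiv v f x = frechet_derivative f (at x) v"

text \<open>Only meant for open \<open>U\<close>.\<close>

fun C_diff_on :: "nat \<Rightarrow> 'a::real_normed_vector set \<Rightarrow> ('a \<Rightarrow> 'b::real_normed_vector) \<Rightarrow> bool" where
  "C_diff_on 0 U f \<longleftrightarrow> continuous_on U f"
| "C_diff_on (Suc k) U f \<longleftrightarrow>
     (\<forall>x\<in>U. f differentiable (at x)) \<and> (\<forall>v. C_diff_on k U (dderiv v f))"

definition smooth_on :: "'a::real_normed_vector set \<Rightarrow> ('a \<Rightarrow> 'b::real_normed_vector) \<Rightarrow> bool" where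
  "smooth_on U f \<longleftrightarrow> (\<forall>k. C_diff_on k U f)"

section \<open>The ambient spaces and their affine coordinate systems\<close>

typedef rp3 = "{span {x} | x :: real^4. x \<noteq> 0}"
proof -
  have "axis 1 1 \<noteq> (0 :: real^4)" by (simp add: axis_eq_0_iff)
  then show ?thesis by blast
qed

definition proj :: "real^4 \<Rightarrow> rp3" where
  "proj x = Abs_rp3 (span {x})"

text \<open>The quotient topology from \<open>real^4 - {0}\<close>.\<close>

instantiation rp3 :: topological_space
begin

definition open_rp3 :: "rp3 set \<Rightarrow> bool" where
  "open_rp3 W \<longleftrightarrow> open {x. x \<noteq> 0 \<and> proj x \<in> W}"

instance
proof
  have "{x :: real^4. x \<noteq> 0 \<and> proj x \<in> UNIV} = - {0}" by auto
  then show "open (UNIV :: rp3 set)" by (simp add: open_rp3_def open_Compl)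
next
  fix S T :: "rp3 set"
  assume "open S" "open T"
  moreover have "{x. x \<noteq> 0 \<and> proj x \<in> S \<inter> T} =
      {x. x \<noteq> 0 \<and> proj x \<in> S} \<inter> {x. x \<noteq> 0 \<and> proj x \<in> T}" by auto
  ultimately show "open (S \<inter> T)" by (simp add: open_rp3_def open_Int)
next
  fix K :: "rp3 set set"
  assume "\<forall>S\<in>K. open S"
  moreover have "{x. x \<noteq> 0 \<and> proj x \<in> \<Union>K} = (\<Union>S\<in>K. {x. x \<noteq> 0 \<and> proj x \<in> S})" by auto
  ultimately show "open (\<Union>K)" by (simp add: open_rp3_def open_UN)
qed

end

type_synonym plane = "real^2"
type_synonym space = "plane \<times> real"

text \<open>
  Coordinate systems are maps from \<open>space\<close> (horizontal plane and vertical axis) into the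
  ambient space. They send straight lines to straight lines, so contact with straight lines may be
  computed in any of them. The definitions below take the set \<open>A\<close> of
  coordinate systems of the ambient space as a parameter; it is one of the following two sets.
\<close>

definition R3_coords :: "(space \<Rightarrow> real^3) set" where
  "R3_coords = {\<lambda>y. L y + b | L b. linear L \<and> bij L}"

definition RP3_coords :: "(space \<Rightarrow> rp3) set" where
  "RP3_coords = {\<lambda>y. proj (L (y, 1)) | L :: space \<times> real \<Rightarrow> real^4. linear L \<and> bij L}"

section \<open>Smooth surfaces\<close>

text \<open>
  In the coordinate system \<open>c\<close> the part of \<open>S\<close> inside the open box \<open>U \<times> I\<close> is the
  graph of the smooth function \<open>h\<close> (Monge form).
\<close>

definition monge ::
  "(space \<Rightarrow> 'a) set \<Rightarrow> 'a set \<Rightarrow> (space \<Rightarrow> 'a) \<Rightarrow> plane set \<Rightarrow> real set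
    \<Rightarrow> (plane \<Rightarrow> real) \<Rightarrow> bool" where
  "monge A S c U I h \<longleftrightarrow> c \<in> A \<and> open U \<and> open I \<and> smooth_on U h \<and> h ` U \<subseteq> I \<and>
     S \<inter> c ` (U \<times> I) = (\<lambda>x. c (x, h x)) ` U"

text \<open>The points of \<open>S\<close> that have a Monge form in which \<open>P h x\<close> holds at the corresponding \<open>x\<close>.\<close>

definition points_where ::
  "(space \<Rightarrow> 'a) set \<Rightarrow> 'a set \<Rightarrow> ((plane \<Rightarrow> real) \<Rightarrow> plane \<Rightarrow> bool) \<Rightarrow> 'a set" where
  "points_where A S P = {c (x, h x) | c U I h x. monge A S c U I h \<and> x \<in> U \<and> P h x}"

definition smooth_surface :: "(space \<Rightarrow> 'a) set \<Rightarrow> 'a set \<Rightarrow> bool" where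
  "smooth_surface A S \<longleftrightarrow> S = points_where A S (\<lambda>h x. True)"

section \<open>Contact with lines\<close>

text \<open>
  The graph of \<open>h\<close> is the zero set of \<open>\<lambda>y. snd y - h (fst y)\<close>. The line through \<open>(x, h x)\<close>
  with direction \<open>v\<close> has at least \<open>k\<close>-point contact with the graph if this function, restricted to
  the line, vanishes to order at least \<open>k\<close>. For \<open>v \<noteq> 0\<close>, tangency is the case \<open>k = 2\<close>.
\<close>

definition contact_ge :: "nat \<Rightarrow> (plane \<Rightarrow> real) \<Rightarrow> plane \<Rightarrow> space \<Rightarrow> bool" where
  "contact_ge k h x v \<longleftrightarrow>
     (\<forall>j<k. (deriv ^^ j) (\<lambda>t. (h x + t * snd v) - h (x + t *\<^sub>R fst v)) 0 = 0)"

definition asymptotic :: "(plane \<Rightarrow> real) \<Rightarrow> plane \<Rightarrow> space \<Rightarrow> bool" where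
  "asymptotic h x v \<longleftrightarrow> v \<noteq> 0 \<and> contact_ge 3 h x v"

definition asymptotic_lines :: "(plane \<Rightarrow> real) \<Rightarrow> plane \<Rightarrow> space set set" where
  "asymptotic_lines h x = {span {v} | v. asymptotic h x v}"

definition hyperbolic_at :: "(plane \<Rightarrow> real) \<Rightarrow> plane \<Rightarrow> bool" where
  "hyperbolic_at h x \<longleftrightarrow> card (asymptotic_lines h x) = 2"

definition parabolic_at :: "(plane \<Rightarrow> real) \<Rightarrow> plane \<Rightarrow> bool" where
  "parabolic_at h x \<longleftrightarrow> card (asymptotic_lines h x) = 1"

definition hyperbolic_domain :: "(space \<Rightarrow> 'a) set \<Rightarrow> 'a set \<Rightarrow> 'a set" where
  "hyperbolic_domain A S = points_where A S hyperbolic_at"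

definition parabolic_curve :: "(space \<Rightarrow> 'a) set \<Rightarrow> 'a set \<Rightarrow> 'a set" where
  "parabolic_curve A S = points_where A S parabolic_at"

section \<open>Godrons and their indices\<close>

definition godron_at :: "(plane \<Rightarrow> real) \<Rightarrow> plane \<Rightarrow> bool" where
  "godron_at h x \<longleftrightarrow> parabolic_at h x \<and>
     (\<exists>v \<gamma>. asymptotic h x v \<and> \<gamma> 0 = x \<and> (\<gamma> has_vector_derivative fst v) (at (0::real)) \<and>
       (\<forall>\<^sub>F s in nhds 0. parabolic_at h (\<gamma> s)))"

text \<open>
  The half-line spanned by \<open>v\<close> is directed to the hyperbolic domain: its vertical projection to the
  graph starts inside the hyperbolic domain. At the parabolic points near a godron of a generic
  surface the asymptotic line is transverse to the parabolic curve, so that exactly one of its two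
  halves qualifies, whatever the coordinate system.
\<close>

definition directed_to_hyperbolic :: "(plane \<Rightarrow> real) \<Rightarrow> plane \<Rightarrow> space \<Rightarrow> bool" where
  "directed_to_hyperbolic h x v \<longleftrightarrow> (\<forall>\<^sub>F t in at_right 0. hyperbolic_at h (x + t *\<^sub>R fst v))"

text \<open>
  Pointing towards (away from) the godron at \<open>g\<close> means making an acute (obtuse) angle with
  the vector leading to it. Since the asymptotic line at the godron is tangent to the parabolic
  curve, this angle tends to \<open>0\<close> or to \<open>pi\<close> as the parabolic point \<open>x\<close> approaches \<open>g\<close>, so the
  choice of Euclidean metric is immaterial.
\<close>

definition positive_godron_at :: "(plane \<Rightarrow> real) \<Rightarrow> plane \<Rightarrow> bool" where
  "positive_godron_at h g \<longleftrightarrow> godron_at h g \<and>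
     (\<forall>\<^sub>F x in at g within {x. parabolic_at h x}.
        \<forall>v. asymptotic h x v \<and> directed_to_hyperbolic h x v \<longrightarrow> v \<bullet> ((g, h g) - (x, h x)) > 0)"

definition negative_godron_at :: "(plane \<Rightarrow> real) \<Rightarrow> plane \<Rightarrow> bool" where
  "negative_godron_at h g \<longleftrightarrow> godron_at h g \<and>
     (\<forall>\<^sub>F x in at g within {x. parabolic_at h x}.
        \<forall>v. asymptotic h x v \<and> directed_to_hyperbolic h x v \<longrightarrow> v \<bullet> ((g, h g) - (x, h x)) < 0)"

definition godrons :: "(space \<Rightarrow> 'a) set \<Rightarrow> 'a set \<Rightarrow> 'a set" where
  "godrons A S = points_where A S godron_at"

text \<open>The value \<open>0\<close> is a dummy: on generic surfaces every godron is positive or negative.\<close>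

definition godron_index :: "(space \<Rightarrow> 'a) set \<Rightarrow> 'a set \<Rightarrow> 'a \<Rightarrow> int" where
  "godron_index A S p =
     (if p \<in> points_where A S positive_godron_at then 1
      else if p \<in> points_where A S negative_godron_at then -1
      else 0)"

section \<open>General position\<close>

definition hessian :: "(plane \<Rightarrow> real) \<Rightarrow> plane \<Rightarrow> real^2^2" where
  "hessian h x = (\<chi> i j. dderiv (axis i 1) (dderiv (axis j 1) h) x)"

text \<open>The rows of the adjugate of the Hessian. Where the Hessian has rank 1 they lie in its kernel,
  the asymptotic direction, and at least one of them is nonzero.\<close>

definition kernel_field :: "2 \<Rightarrow> (plane \<Rightarrow> real) \<Rightarrow> plane \<Rightarrow> real^2" where
  "kernel_field i h x = (let Q = hessian h x in
     if i = 1 then vector [Q $ 2 $ 2, - Q $ 1 $ 2] else vector [- Q $ 2 $ 1, Q $ 1 $ 1])"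

definition cubic_form :: "(plane \<Rightarrow> real) \<Rightarrow> plane \<Rightarrow> plane \<Rightarrow> real" where
  "cubic_form h x w = (dderiv w ^^ 3) h x"

definition regular_zero :: "('a::real_normed_vector \<Rightarrow> 'b::real_normed_vector) \<Rightarrow> 'a \<Rightarrow> bool" where
  "regular_zero F x \<longleftrightarrow> (F x = 0 \<longrightarrow> surj (frechet_derivative F (at x)))"

text \<open>
  Transversality of the jet extension of \<open>h\<close> to the strata of parabolic jets:
  the 2-jets with zero Hessian (codimension 3, hence avoided), the 2-jets with Hessian of
  rank 1 (codimension 1, given by the vanishing of the Hessian determinant), and the 3-jets with
  Hessian of rank 1 whose cubic form vanishes on the kernel of the Hessian (codimension 2). The
  latter is the godron stratum: where the Hessian \<open>Q\<close> has rank 1 and kernel spanned by \<open>w\<close>, the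
  derivative of \<open>det Q\<close> along \<open>w\<close> is a nonzero multiple of the cubic form at \<open>w\<close>. In
  the normal form \<open>y^2 / 2 - x^2 * y + r * x^4 / 2\<close> of a godron the last condition says \<open>r \<noteq> 1\<close>,
  i.e. that the contact with the tangent plane is of type \<open>A_3\<close>.
\<close>

definition generic_at :: "(plane \<Rightarrow> real) \<Rightarrow> plane \<Rightarrow> bool" where
  "generic_at h x \<longleftrightarrow>
     hessian h x \<noteq> 0 \<and>
     regular_zero (\<lambda>x. det (hessian h x)) x \<and>
     (\<forall>i. kernel_field i h x \<noteq> 0 \<longrightarrow>
        regular_zero (\<lambda>x. (det (hessian h x), cubic_form h x (kernel_field i h x))) x)"

definition generic_surface :: "(space \<Rightarrow> 'a) set \<Rightarrow> 'a set \<Rightarrow> bool" where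
  "generic_surface A S \<longleftrightarrow> smooth_surface A S \<and>
     (\<forall>c U I h. monge A S c U I h \<longrightarrow> (\<forall>x\<in>U. generic_at h x))"

section \<open>Hyperbolic discs\<close>

text \<open>A diffeomorphism from the open set \<open>V\<close> of the plane onto an open subset of \<open>S\<close>.\<close>

definition smooth_parametrization ::
  "(space \<Rightarrow> 'a) set \<Rightarrow> 'a set \<Rightarrow> plane set \<Rightarrow> (plane \<Rightarrow> 'a) \<Rightarrow> bool" where
  "smooth_parametrization A S V X \<longleftrightarrow> open V \<and> inj_on X V \<and>
     (\<forall>z\<in>V. \<exists>c U I h W \<phi>. monge A S c U I h \<and> open W \<and> z \<in> W \<and> W \<subseteq> V \<and>
        smooth_on W \<phi> \<and> \<phi> ` W \<subseteq> U \<and> bij (frechet_derivative \<phi> (at z)) \<and>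
        (\<forall>y\<in>W. X y = c (\<phi> y, h (\<phi> y))))"

definition boundary_in :: "'a::topological_space set \<Rightarrow> 'a set \<Rightarrow> 'a set" where
  "boundary_in S H = S \<inter> closure H - H"

text \<open>
  Discs are understood in the smooth category: \<open>H\<close> together with its boundary in \<open>S\<close> is
  diffeomorphic to the closed unit disc, smoothness on the closed disc meaning, as usual, smoothness
  on a neighbourhood of it.
\<close>

definition hyperbolic_disc ::
  "(space \<Rightarrow> 'a::topological_space) set \<Rightarrow> 'a set \<Rightarrow> 'a set \<Rightarrow> bool" where
  "hyperbolic_disc A S H \<longleftrightarrow>
     H \<in> components (hyperbolic_domain A S) \<and>
     boundary_in S H \<subseteq> parabolic_curve A S \<and>
     (\<exists>V X. smooth_parametrization A S V X \<and> cball 0 1 \<subseteq> V \<and>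
        X ` ball 0 1 = H \<and> X ` sphere 0 1 = boundary_in S H)"

end

theory Submission
  imports Defs
begin

text \<open>
  The asymptotic lines are the null lines of the Hessian of a Monge form; up to a nonzero factor, this quadratic
  form does not depend on the chart. On the closed disc it is indefinite inside and of rank 1 on the boundary,
  and since the disc is contractible one of the two null directions can be followed continuously over the whole
  closed disc, ending in the kernel direction on the boundary. This nowhere vanishing vector field has winding number
  \<open>0\<close> along the boundary circle, hence makes one negative full turn relative to the tangent of the
  circle. The godrons are the points where it is tangent to the circle. By general position the angle to the
  tangent crosses \<open>0\<close> modulo \<open>pi\<close> there, and the index is \<open>1\<close> or \<open>- 1\<close> according to the sense of
  the crossing, so that each half turn contributes \<open>1\<close> to the sum.
\<close>

section \<open>Derivatives and the Hessian\<close>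

text \<open>All predicates on points of the surface ask for some Monge form, so a godron might a
  priori be positive in one chart and negative in another. The predicates are never carried from
  chart to chart: only the Hessian up to a factor is. Everything else is computed, in an arbitrary
  chart, from one function \<open>f\<close> on the parameter circle, so that all charts agree.

  The asymptotic angle comes from a logarithm and an arccosine and is known only to be continuous.
  Its crossings are therefore described by signs on the two sides, and general position enters
  through a differentiable function, the cubic form at the kernel field, which along the boundary is
  \<open>sin (pi * f s)\<close> times a nonvanishing continuous factor.

  As the angle is a single-valued real function on the disc, it is periodic along the circle; the
  total change of \<open>f\<close> stems from the rotation of the frame alone. The definitions of
  the signs of a godron look at all nearby parabolic points, also outside the disc, so these must be
  shown to lie on the boundary curve.\<close>

lemma smooth_on_dderiv: "smooth_on U f \<Longrightarrow> smooth_on U (dderiv v f)"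
  unfolding smooth_on_def by (metis C_diff_on.simps(2))

lemma smooth_on_differentiable: "smooth_on U f \<Longrightarrow> x \<in> U \<Longrightarrow> f differentiable (at x)"
  unfolding smooth_on_def by (metis C_diff_on.simps(2))

lemma smooth_on_continuous: "smooth_on U f \<Longrightarrow> continuous_on U f"
  unfolding smooth_on_def by (metis C_diff_on.simps(1))

lemma has_derivative_dderiv:
  "f differentiable (at x) \<Longrightarrow> (f has_derivative (\<lambda>v. dderiv v f x)) (at x)"
  unfolding dderiv_def using frechet_derivative_works by blast

lemma dderiv_eqI: "(f has_derivative f') (at x) \<Longrightarrow> dderiv v f x = f' v"
  unfolding dderiv_def using frechet_derivative_at by metis

lemma linear_dderiv: "f differentiable (at x) \<Longrightarrow> linear (\<lambda>v. dderiv v f x)"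
  unfolding dderiv_def using linear_frechet_derivative by blast

lemma smooth_on_has_derivative:
  "smooth_on U f \<Longrightarrow> x \<in> U \<Longrightarrow> (f has_derivative (\<lambda>v. dderiv v f x)) (at x)"
  by (simp add: has_derivative_dderiv smooth_on_differentiable)

lemma dderiv_cong_open:
  assumes "open U" "x \<in> U" "\<And>y. y \<in> U \<Longrightarrow> f y = g y"
  shows "dderiv v f x = dderiv v g x"
proof -
  have "(f has_derivative f') (at x) \<longleftrightarrow> (g has_derivative f') (at x)" for f'
    using assms has_derivative_transform_within_open[of _ f' x UNIV U] by metis
  then show ?thesis unfolding dderiv_def frechet_derivative_def by simp
qed

lemma deriv_along_line:
  assumes "f differentiable (at (x + t *\<^sub>R w))"
  shows "((\<lambda>t. f (x + t *\<^sub>R w)) has_real_derivative dderiv w f (x + t *\<^sub>R w)) (at t)"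
proof -
  have 1: "((\<lambda>t. x + t *\<^sub>R w) has_derivative (\<lambda>s. s *\<^sub>R w)) (at t)"
    by (auto intro!: derivative_eq_intros)
  have "((\<lambda>t. f (x + t *\<^sub>R w)) has_derivative (\<lambda>s. dderiv (s *\<^sub>R w) f (x + t *\<^sub>R w))) (at t)"
    using has_derivative_compose[OF 1 has_derivative_dderiv[OF assms]] by simp
  then show ?thesis
    unfolding has_field_derivative_def
    by (rule has_derivative_eq_rhs) (auto simp: linear_scale[OF linear_dderiv[OF assms]] fun_eq_iff)
qed

section \<open>Symmetry of second derivatives\<close>

lemma double_difference_mean_value:
  fixes f :: "'a::real_normed_vector \<Rightarrow> real"
  assumes f: "smooth_on U f" and s: "0 < s"
    and U: "\<And>a b. 0 \<le> a \<Longrightarrow> a \<le> s \<Longrightarrow> 0 \<le> b \<Longrightarrow> b \<le> s \<Longrightarrow> x + a *\<^sub>R v + b *\<^sub>R w \<in> U"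
  obtains a b where "0 < a" "a < s" "0 < b" "b < s"
    "f (x + s *\<^sub>R v + s *\<^sub>R w) - f (x + s *\<^sub>R v) - f (x + s *\<^sub>R w) + f x
      = s\<^sup>2 * dderiv w (dderiv v f) (x + a *\<^sub>R v + b *\<^sub>R w)"
proof -
  \<comment> \<open>The increment in direction \<open>w\<close> as a function of the displacement
    along \<open>v\<close>. After the mean value theorem along \<open>v\<close>, a second one is
    applied along \<open>w\<close> to \<open>dderiv v f\<close>.\<close>
  define g where "g a = f ((x + s *\<^sub>R w) + a *\<^sub>R v) - f (x + a *\<^sub>R v)" for a
  have "\<exists>a>0. a < s \<and> g s - g 0 = (s - 0) *
      (dderiv v f ((x + s *\<^sub>R w) + a *\<^sub>R v) - dderiv v f (x + a *\<^sub>R v))"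
  proof (rule MVT2)
    fix a assume a: "0 \<le> a" "a \<le> s"
    have "x + s *\<^sub>R w + a *\<^sub>R v \<in> U" "x + a *\<^sub>R v \<in> U"
      using U[of a s] U[of a 0] a s by (auto simp: algebra_simps)
    then show "(g has_real_derivative (dderiv v f ((x + s *\<^sub>R w) + a *\<^sub>R v) - dderiv v f (x + a *\<^sub>R v))) (at a)"
      unfolding g_def
      by (intro DERIV_diff deriv_along_line smooth_on_differentiable[OF f]) auto
  qed (use s in auto)
  then obtain a where a: "0 < a" "a < s" and g: "g s - g 0 = s *
      (dderiv v f ((x + s *\<^sub>R w) + a *\<^sub>R v) - dderiv v f (x + a *\<^sub>R v))" by auto
  define k where "k b = dderiv v f ((x + a *\<^sub>R v) + b *\<^sub>R w)" for b
  have "\<exists>b>0. b < s \<and> k s - k 0 = (s - 0) * dderiv w (dderiv v f) ((x + a *\<^sub>R v) + b *\<^sub>R w)"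
  proof (rule MVT2)
    fix b assume "0 \<le> b" "b \<le> s"
    then have "x + a *\<^sub>R v + b *\<^sub>R w \<in> U" using U[of a b] a by auto
    then show "(k has_real_derivative dderiv w (dderiv v f) ((x + a *\<^sub>R v) + b *\<^sub>R w)) (at b)"
      unfolding k_def
      by (intro deriv_along_line smooth_on_differentiable[OF smooth_on_dderiv[OF f]]) auto
  qed (use s in auto)
  then obtain b where b: "0 < b" "b < s" and k: "k s - k 0 = s * dderiv w (dderiv v f) ((x + a *\<^sub>R v) + b *\<^sub>R w)"
    by auto
  have "g s - g 0 = s * (k s - k 0)" unfolding g k_def by (simp add: algebra_simps)
  then have "g s - g 0 = s\<^sup>2 * dderiv w (dderiv v f) (x + a *\<^sub>R v + b *\<^sub>R w)"
    unfolding k by (simp add: power2_eq_square algebra_simps)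
  moreover have "g s - g 0 = f (x + s *\<^sub>R v + s *\<^sub>R w) - f (x + s *\<^sub>R v) - f (x + s *\<^sub>R w) + f x"
    by (simp add: g_def algebra_simps)
  ultimately show thesis using that a b by metis
qed

text \<open>The double difference over a small parallelogram does not depend on the order of
  \<open>v\<close> and \<open>w\<close>, and divided by \<open>s\<^sup>2\<close> it is a nearby
  value of either mixed derivative. By continuity these agree at \<open>x\<close>.\<close>

lemma dderiv_commute:
  fixes f :: "'a::real_normed_vector \<Rightarrow> real"
  assumes U: "open U" and f: "smooth_on U f" and x: "x \<in> U"
  shows "dderiv v (dderiv w f) x = dderiv w (dderiv v f) x"
proof (rule ccontr)
  assume ne: "dderiv v (dderiv w f) x \<noteq> dderiv w (dderiv v f) x"
  define e where "e = \<bar>dderiv v (dderiv w f) x - dderiv w (dderiv v f) x\<bar> / 2"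
  have e: "e > 0" using ne by (simp add: e_def)
  have cont: "continuous_on U (dderiv a (dderiv b f))" for a b
    by (intro smooth_on_continuous smooth_on_dderiv f)
  have near: "\<forall>\<^sub>F y in nhds x. y \<in> U \<and> dist (dderiv v (dderiv w f) y) (dderiv v (dderiv w f) x) < e
      \<and> dist (dderiv w (dderiv v f) y) (dderiv w (dderiv v f) x) < e"
    using cont[of v w] cont[of w v] U x e
    by (intro eventually_conj eventually_nhds_in_open tendstoD)
       (auto simp: continuous_on_eq_continuous_at isCont_def tendsto_at_iff_tendsto_nhds)
  then obtain d where d: "d > 0" and dP: "\<And>y. dist y x < d \<Longrightarrow> y \<in> U
      \<and> dist (dderiv v (dderiv w f) y) (dderiv v (dderiv w f) x) < e
      \<and> dist (dderiv w (dderiv v f) y) (dderiv w (dderiv v f) x) < e"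
    by (auto simp: eventually_nhds_metric)
  \<comment> \<open>The whole parallelogram with sides \<open>s *\<^sub>R v\<close> and
    \<open>s *\<^sub>R w\<close> stays within \<open>d / 2\<close> of \<open>x\<close>; the summand
    1 keeps the denominator positive if both vectors vanish.\<close>
  define s where "s = d / (2 * (norm v + norm w + 1))"
  have pos: "norm v + norm w + 1 > 0" using norm_ge_zero[of v] norm_ge_zero[of w] by linarith
  have s: "s > 0" using d pos by (simp add: s_def)
  have close: "dist (x + a *\<^sub>R v + b *\<^sub>R w) x < d" if "0 \<le> a" "a \<le> s" "0 \<le> b" "b \<le> s" for a b
  proof -
    have "dist (x + a *\<^sub>R v + b *\<^sub>R w) x = norm (a *\<^sub>R v + b *\<^sub>R w)" by (simp add: dist_norm)
    also have "\<dots> \<le> a * norm v + b * norm w" using norm_triangle_ineq[of "a *\<^sub>R v" "b *\<^sub>R w"] that by simp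
    also have "\<dots> \<le> s * norm v + s * norm w" using that by (intro add_mono mult_right_mono) auto
    also have "\<dots> \<le> s * (norm v + norm w + 1)" using s by (simp add: algebra_simps)
    also have "\<dots> = d / 2"
      using pos by (metis s_def mult.commute nonzero_mult_div_cancel_right times_divide_eq_left mult_divide_mult_cancel_right less_irrefl)
    finally show ?thesis using d by linarith
  qed
  obtain a b where ab: "0 < a" "a < s" "0 < b" "b < s" and 1:
    "f (x + s *\<^sub>R v + s *\<^sub>R w) - f (x + s *\<^sub>R v) - f (x + s *\<^sub>R w) + f x
      = s\<^sup>2 * dderiv w (dderiv v f) (x + a *\<^sub>R v + b *\<^sub>R w)"
    by (rule double_difference_mean_value[OF f s, of x v w]) (use dP close in auto)
  have close': "dist (x + a *\<^sub>R w + b *\<^sub>R v) x < d" if "0 \<le> a" "a \<le> s" "0 \<le> b" "b \<le> s" for a b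
    using close[of b a] that by (simp add: algebra_simps)
  obtain a' b' where ab': "0 < a'" "a' < s" "0 < b'" "b' < s" and 2:
    "f (x + s *\<^sub>R w + s *\<^sub>R v) - f (x + s *\<^sub>R w) - f (x + s *\<^sub>R v) + f x
      = s\<^sup>2 * dderiv v (dderiv w f) (x + a' *\<^sub>R w + b' *\<^sub>R v)"
    by (rule double_difference_mean_value[OF f s, of x w v]) (use dP close' in auto)
  have "s\<^sup>2 * dderiv w (dderiv v f) (x + a *\<^sub>R v + b *\<^sub>R w) = s\<^sup>2 * dderiv v (dderiv w f) (x + a' *\<^sub>R w + b' *\<^sub>R v)"
    using 1 2 unfolding add.assoc add.commute[of "s *\<^sub>R w" "s *\<^sub>R v"] by linarith
  then have "dderiv w (dderiv v f) (x + a *\<^sub>R v + b *\<^sub>R w) = dderiv v (dderiv w f) (x + a' *\<^sub>R w + b' *\<^sub>R v)"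
    using s by simp
  moreover have "\<bar>dderiv w (dderiv v f) (x + a *\<^sub>R v + b *\<^sub>R w) - dderiv w (dderiv v f) x\<bar> < e"
    using dP[OF close[of a b]] ab by (simp add: dist_real_def)
  moreover have "\<bar>dderiv v (dderiv w f) (x + a' *\<^sub>R w + b' *\<^sub>R v) - dderiv v (dderiv w f) x\<bar> < e"
    using dP[OF close'[of a' b']] ab' by (simp add: dist_real_def)
  ultimately have "\<bar>dderiv v (dderiv w f) x - dderiv w (dderiv v f) x\<bar> < 2 * e" by linarith
  then show False unfolding e_def by simp
qed

section \<open>The Hessian and asymptotic directions\<close>

lemma plane_expand: "(w::plane) = w $ 1 *\<^sub>R axis 1 1 + w $ 2 *\<^sub>R axis 2 1"
  by (simp add: vec_eq_iff forall_2 axis_def)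

lemma dderiv_expand:
  fixes f :: "plane \<Rightarrow> 'b::real_normed_vector"
  assumes "f differentiable (at x)"
  shows "dderiv w f x = w $ 1 *\<^sub>R dderiv (axis 1 1) f x + w $ 2 *\<^sub>R dderiv (axis 2 1) f x"
proof -
  note L = linear_dderiv[OF assms]
  have "dderiv w f x = dderiv (w $ 1 *\<^sub>R axis 1 1 + w $ 2 *\<^sub>R axis 2 1) f x"
    using plane_expand by metis
  then show ?thesis by (simp add: linear_add[OF L] linear_scale[OF L])
qed

definition bil :: "real^2^2 \<Rightarrow> plane \<Rightarrow> plane \<Rightarrow> real" where
  "bil Q v w = v $ 1 * w $ 1 * Q $ 1 $ 1 + v $ 1 * w $ 2 * Q $ 1 $ 2
     + v $ 2 * w $ 1 * Q $ 2 $ 1 + v $ 2 * w $ 2 * Q $ 2 $ 2"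

lemma hessian_nth: "hessian h x $ i $ j = dderiv (axis i 1) (dderiv (axis j 1) h) x"
  by (simp add: hessian_def)

lemma hessian_symmetric:
  assumes "open U" "smooth_on U h" "x \<in> U"
  shows "hessian h x $ 2 $ 1 = hessian h x $ 1 $ 2"
  unfolding hessian_nth using dderiv_commute[OF assms] .

lemma det_hessian:
  assumes "open U" "smooth_on U h" "x \<in> U"
  shows "det (hessian h x) = hessian h x $ 1 $ 1 * hessian h x $ 2 $ 2 - (hessian h x $ 1 $ 2)\<^sup>2"
  unfolding det_2 hessian_symmetric[OF assms] by (simp add: power2_eq_square)

lemma dderiv_dderiv_hessian:
  assumes U: "open U" and h: "smooth_on U h" and x: "x \<in> U"
  shows "dderiv v (dderiv w h) x = bil (hessian h x) v w"
proof -
  have 1: "dderiv w h y = w $ 1 *\<^sub>R dderiv (axis 1 1) h y + w $ 2 *\<^sub>R dderiv (axis 2 1) h y" if "y \<in> U" for y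
    using dderiv_expand smooth_on_differentiable[OF h that] .
  note D = smooth_on_has_derivative[OF smooth_on_dderiv[OF h] x]
  have "dderiv v (dderiv w h) x =
      dderiv v (\<lambda>y. w $ 1 *\<^sub>R dderiv (axis 1 1) h y + w $ 2 *\<^sub>R dderiv (axis 2 1) h y) x"
    using dderiv_cong_open[OF U x 1] .
  also have "\<dots> = w $ 1 *\<^sub>R dderiv v (dderiv (axis 1 1) h) x + w $ 2 *\<^sub>R dderiv v (dderiv (axis 2 1) h) x"
    by (rule dderiv_eqI[of _ "\<lambda>v. w $ 1 *\<^sub>R dderiv v (dderiv (axis 1 1) h) x + w $ 2 *\<^sub>R dderiv v (dderiv (axis 2 1) h) x"])
       (intro derivative_intros D)
  finally show ?thesis
    by (simp add: dderiv_expand[OF smooth_on_differentiable[OF smooth_on_dderiv[OF h] x], of v]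
        hessian_nth bil_def algebra_simps)
qed

lemma hessian_nth_has_derivative:
  assumes h: "smooth_on U h" and x: "x \<in> U"
  shows "((\<lambda>x. hessian h x $ i $ j) has_derivative (\<lambda>v. dderiv v (\<lambda>x. hessian h x $ i $ j) x)) (at x)"
  using smooth_on_has_derivative[OF smooth_on_dderiv[OF smooth_on_dderiv[OF h]] x] by (simp add: hessian_nth)

lemma hessian_nth_smooth: "smooth_on U h \<Longrightarrow> smooth_on U (\<lambda>x. hessian h x $ i $ j)"
  by (simp add: hessian_nth smooth_on_dderiv)

text \<open>Of the three conditions the one of order 0 is automatic, the first derivative expresses
  tangency and the second one is the Hessian on the horizontal part. The first derivative has to be
  known on a neighbourhood of 0 in order to be differentiated again.\<close>

lemma contact_ge_3_iff:
  assumes U: "open U" and h: "smooth_on U h" and x: "x \<in> U"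
  shows "contact_ge 3 h x v \<longleftrightarrow> snd v = dderiv (fst v) h x \<and> bil (hessian h x) (fst v) (fst v) = 0"
proof -
  define g where "g t = (h x + t * snd v) - h (x + t *\<^sub>R fst v)" for t
  have "\<forall>\<^sub>F t in nhds 0. x + t *\<^sub>R fst v \<in> U"
  proof (rule topological_tendstoD)
    show "((\<lambda>t. x + t *\<^sub>R fst v) \<longlongrightarrow> x + 0 *\<^sub>R fst v) (nhds 0)"
      by (intro tendsto_intros filterlim_ident)
  qed (use U x in auto)
  then obtain T where T: "open T" "0 \<in> T" "\<And>t. t \<in> T \<Longrightarrow> x + t *\<^sub>R fst v \<in> U"
    unfolding eventually_nhds by blast
  have d1: "deriv g t = snd v - dderiv (fst v) h (x + t *\<^sub>R fst v)" if "t \<in> T" for t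
  proof (rule DERIV_imp_deriv)
    show "(g has_real_derivative snd v - dderiv (fst v) h (x + t *\<^sub>R fst v)) (at t)"
      unfolding g_def
      by (intro DERIV_diff deriv_along_line smooth_on_differentiable[OF h] T that)
         (auto intro!: derivative_eq_intros)
  qed
  have "((\<lambda>t. snd v - dderiv (fst v) h (x + t *\<^sub>R fst v)) has_real_derivative
      0 - dderiv (fst v) (dderiv (fst v) h) (x + 0 *\<^sub>R fst v)) (at 0)"
    by (rule DERIV_diff DERIV_const deriv_along_line smooth_on_differentiable[OF smooth_on_dderiv[OF h]] T)+
  then have "(deriv g has_real_derivative 0 - dderiv (fst v) (dderiv (fst v) h) (x + 0 *\<^sub>R fst v)) (at 0)"
    by (rule has_field_derivative_transform_within_open[OF _ T(1,2)]) (simp add: d1)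
  then have d2: "deriv (deriv g) 0 = - bil (hessian h x) (fst v) (fst v)"
    by (simp add: DERIV_imp_deriv dderiv_dderiv_hessian[OF U h x])
  have "contact_ge 3 h x v \<longleftrightarrow> (\<forall>j<3. (deriv ^^ j) g 0 = 0)"
    unfolding contact_ge_def g_def ..
  also have "\<dots> \<longleftrightarrow> g 0 = 0 \<and> deriv g 0 = 0 \<and> deriv (deriv g) 0 = 0"
    by (auto simp: numeral_eq_Suc less_Suc_eq all_conj_distrib)
  finally show ?thesis using d1[OF T(2)] d2 by (auto simp: g_def)
qed

text \<open>A tangent vector is determined by its horizontal part, so it is nonzero exactly if that
  part is.\<close>

lemma asymptotic_iff:
  assumes "open U" "smooth_on U h" "x \<in> U"
  shows "asymptotic h x v \<longleftrightarrow>
    fst v \<noteq> 0 \<and> snd v = dderiv (fst v) h x \<and> bil (hessian h x) (fst v) (fst v) = 0"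
proof -
  have "dderiv 0 h x = 0"
    by (rule linear_0[OF linear_dderiv[OF smooth_on_differentiable[OF assms(2,3)]]])
  then show ?thesis unfolding asymptotic_def contact_ge_3_iff[OF assms]
    by (cases v) (auto simp: zero_prod_def)
qed

section \<open>Counting crossings of the integers\<close>

text \<open>A condition on signs, because no derivative of \<open>f\<close> is available:
  \<open>f s - f t\<close> has the sign of \<open>s - t\<close> on both sides of
  \<open>t\<close>.\<close>

definition upcrossing :: "(real \<Rightarrow> real) \<Rightarrow> real \<Rightarrow> bool" where
  "upcrossing f t \<longleftrightarrow> (\<forall>\<^sub>F s in at t. (f s - f t) * (s - t) > 0)"

definition downcrossing :: "(real \<Rightarrow> real) \<Rightarrow> real \<Rightarrow> bool" where
  "downcrossing f t \<longleftrightarrow> (\<forall>\<^sub>F s in at t. (f s - f t) * (s - t) < 0)"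

text \<open>Meant for points that are crossed in one sense or the other; there, not being an
  upcrossing means being a downcrossing.\<close>

definition crossing_sign :: "(real \<Rightarrow> real) \<Rightarrow> real \<Rightarrow> int" where
  "crossing_sign f t = (if upcrossing f t then 1 else -1)"

lemma not_up_and_downcrossing: "\<not> (upcrossing f t \<and> downcrossing f t)"
proof
  assume "upcrossing f t \<and> downcrossing f t"
  then have "\<forall>\<^sub>F s in at t. (f s - f t) * (s - t) > 0 \<and> (f s - f t) * (s - t) < 0"
    unfolding upcrossing_def downcrossing_def by (simp add: eventually_conj_iff)
  then have "\<forall>\<^sub>F s in at t. False" by (rule eventually_mono) linarith
  then show False by simp
qed

text \<open>The floor of \<open>f\<close> just to the left of \<open>t\<close>, provided that every integer value is crossed.\<close>

definition left_floor :: "(real \<Rightarrow> real) \<Rightarrow> real \<Rightarrow> int" where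
  "left_floor f t = (if f t \<in> \<int> \<and> upcrossing f t then \<lfloor>f t\<rfloor> - 1 else \<lfloor>f t\<rfloor>)"

lemma floor_eq_not_Ints:
  fixes y :: real
  assumes "of_int n < y" "y < of_int n + 1"
  shows "\<lfloor>y\<rfloor> = n \<and> y \<notin> \<int>"
proof -
  have "\<lfloor>y\<rfloor> = n" using assms by linarith
  moreover have "y \<notin> \<int>"
  proof
    assume "y \<in> \<int>"
    then obtain k where "y = of_int k" by (auto elim: Ints_cases)
    then have "of_int n < (of_int k :: real)" "(of_int k :: real) < of_int (n + 1)" using assms by auto
    then show False unfolding of_int_less_iff by simp
  qed
  ultimately show ?thesis by simp
qed

text \<open>An integer value \<open>n\<close> crossed upwards has floor \<open>n - 1\<close> before
  and \<open>n\<close> after the crossing; crossed downwards, \<open>n\<close> before and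
  \<open>n - 1\<close> after. So the jump is the crossing sign, although the floor at the crossing
  itself is \<open>n\<close> in both cases.\<close>

lemma left_floor_locally:
  fixes f :: "real \<Rightarrow> real"
  assumes cont: "isCont f x"
    and cross: "f x \<in> \<int> \<Longrightarrow> upcrossing f x \<or> downcrossing f x"
  obtains d where "d > 0"
    "\<And>t. \<bar>t - x\<bar> < d \<Longrightarrow> t \<noteq> x \<Longrightarrow> f t \<notin> \<int>"
    "\<And>t. \<bar>t - x\<bar> < d \<Longrightarrow> t < x \<Longrightarrow> \<lfloor>f t\<rfloor> = left_floor f x"
    "\<And>t. \<bar>t - x\<bar> < d \<Longrightarrow> x < t \<Longrightarrow>
       \<lfloor>f t\<rfloor> = left_floor f x + (if f x \<in> \<int> then crossing_sign f x else 0)"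
proof (cases "f x \<in> \<int>")
  case False
  have lim: "(f \<longlongrightarrow> f x) (nhds x)"
    using cont by (simp add: isCont_def tendsto_at_iff_tendsto_nhds)
  define n where "n = \<lfloor>f x\<rfloor>"
  have n: "of_int n < f x" "f x < of_int n + 1"
  proof -
    have "f x \<noteq> of_int n" using False by auto
    then show "of_int n < f x" "f x < of_int n + 1" unfolding n_def by linarith+
  qed
  have "\<forall>\<^sub>F t in nhds x. of_int n < f t \<and> f t < of_int n + 1"
    using n order_tendstoD[OF lim] by (intro eventually_conj) auto
  then obtain d where d: "d > 0" "\<And>t. dist t x < d \<Longrightarrow> of_int n < f t \<and> f t < of_int n + 1"
    by (auto simp: eventually_nhds_metric)
  have *: "\<lfloor>f t\<rfloor> = n \<and> f t \<notin> \<int>" if "\<bar>t - x\<bar> < d" for t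
  proof -
    show ?thesis by (rule floor_eq_not_Ints) (use d that in \<open>auto simp: dist_real_def\<close>)
  qed
  have "left_floor f x = n" using False by (simp add: left_floor_def n_def)
  then show thesis using that[OF d(1)] * False by auto
next
  case True
  have lim: "(f \<longlongrightarrow> f x) (nhds x)"
    using cont by (simp add: isCont_def tendsto_at_iff_tendsto_nhds)
  obtain n where n: "f x = of_int n" using True by (auto elim: Ints_cases)
  have "\<forall>\<^sub>F t in nhds x. of_int n - 1 < f t \<and> f t < of_int n + 1"
    using n order_tendstoD[OF lim] by (intro eventually_conj) auto
  then have near: "\<forall>\<^sub>F t in at x. of_int n - 1 < f t \<and> f t < of_int n + 1"
    by (auto simp: eventually_at_filter elim: eventually_mono)
  consider "upcrossing f x" | "downcrossing f x" "\<not> upcrossing f x"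
    using cross True not_up_and_downcrossing by blast
  then show thesis
  proof cases
    case 1
    have "\<forall>\<^sub>F t in at x. (f t - f x) * (t - x) > 0 \<and> of_int n - 1 < f t \<and> f t < of_int n + 1"
      using 1 near unfolding upcrossing_def by (rule eventually_conj)
    then obtain d where d: "d > 0" "\<And>t. t \<noteq> x \<Longrightarrow> dist t x < d \<Longrightarrow>
        (f t - f x) * (t - x) > 0 \<and> of_int n - 1 < f t \<and> f t < of_int n + 1"
      by (auto simp: eventually_at)
    have l: "\<lfloor>f t\<rfloor> = n - 1 \<and> f t \<notin> \<int>" if "\<bar>t - x\<bar> < d" "t < x" for t
    proof -
      have 0: "(f t - f x) * (t - x) > 0" and 2: "of_int n - 1 < f t"
        using d(2)[of t] that by (auto simp: dist_real_def)
      have 3: "f t < of_int n" using 0 that n by (simp add: zero_less_mult_iff)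
      show ?thesis by (rule floor_eq_not_Ints) (use 2 3 in auto)
    qed
    have r: "\<lfloor>f t\<rfloor> = n \<and> f t \<notin> \<int>" if "\<bar>t - x\<bar> < d" "x < t" for t
    proof -
      have 0: "(f t - f x) * (t - x) > 0" and 2: "f t < of_int n + 1"
        using d(2)[of t] that by (auto simp: dist_real_def)
      have 3: "f t > of_int n" using 0 that n by (simp add: zero_less_mult_iff)
      show ?thesis by (rule floor_eq_not_Ints) (use 2 3 in auto)
    qed
    have v: "left_floor f x = n - 1" "crossing_sign f x = 1"
      using True 1 n by (simp_all add: left_floor_def crossing_sign_def)
    show thesis
    proof (rule that[OF d(1)])
      show "f t \<notin> \<int>" if "\<bar>t - x\<bar> < d" "t \<noteq> x" for t
        using l[OF that(1)] r[OF that(1)] that(2) by linarith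
      show "\<lfloor>f t\<rfloor> = left_floor f x" if "\<bar>t - x\<bar> < d" "t < x" for t
        using l[OF that] v by simp
      show "\<lfloor>f t\<rfloor> = left_floor f x + (if f x \<in> \<int> then crossing_sign f x else 0)"
        if "\<bar>t - x\<bar> < d" "x < t" for t
        using r[OF that] v True by simp
    qed
  next
    case 2
    have "\<forall>\<^sub>F t in at x. (f t - f x) * (t - x) < 0 \<and> of_int n - 1 < f t \<and> f t < of_int n + 1"
      using 2(1) near unfolding downcrossing_def by (rule eventually_conj)
    then obtain d where d: "d > 0" "\<And>t. t \<noteq> x \<Longrightarrow> dist t x < d \<Longrightarrow>
        (f t - f x) * (t - x) < 0 \<and> of_int n - 1 < f t \<and> f t < of_int n + 1"
      by (auto simp: eventually_at)
    have l: "\<lfloor>f t\<rfloor> = n \<and> f t \<notin> \<int>" if "\<bar>t - x\<bar> < d" "t < x" for t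
    proof -
      have 0: "(f t - f x) * (t - x) < 0" and 2: "f t < of_int n + 1"
        using d(2)[of t] that by (auto simp: dist_real_def)
      have 3: "f t > of_int n" using 0 that n by (simp add: mult_less_0_iff)
      show ?thesis by (rule floor_eq_not_Ints) (use 2 3 in auto)
    qed
    have r: "\<lfloor>f t\<rfloor> = n - 1 \<and> f t \<notin> \<int>" if "\<bar>t - x\<bar> < d" "x < t" for t
    proof -
      have 0: "(f t - f x) * (t - x) < 0" and 2: "of_int n - 1 < f t"
        using d(2)[of t] that by (auto simp: dist_real_def)
      have 3: "f t < of_int n" using 0 that n by (simp add: mult_less_0_iff)
      show ?thesis by (rule floor_eq_not_Ints) (use 2 3 in auto)
    qed
    have v: "left_floor f x = n" "crossing_sign f x = -1"
      using True 2 n by (simp_all add: left_floor_def crossing_sign_def)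
    show thesis
    proof (rule that[OF d(1)])
      show "f t \<notin> \<int>" if "\<bar>t - x\<bar> < d" "t \<noteq> x" for t
        using l[OF that(1)] r[OF that(1)] that(2) by linarith
      show "\<lfloor>f t\<rfloor> = left_floor f x" if "\<bar>t - x\<bar> < d" "t < x" for t
        using l[OF that] v by simp
      show "\<lfloor>f t\<rfloor> = left_floor f x + (if f x \<in> \<int> then crossing_sign f x else 0)"
        if "\<bar>t - x\<bar> < d" "x < t" for t
        using r[OF that] v True by simp
    qed
  qed
qed

text \<open>Both sides are additive over adjacent intervals: the intervals are half-open, and
  \<open>left_floor\<close> looks to the left of either end point. By bisection it then suffices to
  treat short intervals around a given point, where at most one crossing occurs.\<close>

lemma sum_crossing_signs:
  fixes f :: "real \<Rightarrow> real"
  assumes ab: "a \<le> b"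
    and cont: "\<And>x. isCont f x"
    and cross: "\<And>x. f x \<in> \<int> \<Longrightarrow> upcrossing f x \<or> downcrossing f x"
  shows "finite {t \<in> {a..<b}. f t \<in> \<int>}"
    and "(\<Sum>t \<in> {t \<in> {a..<b}. f t \<in> \<int>}. crossing_sign f t) = left_floor f b - left_floor f a"
proof -
  define Z where "Z a b = {t \<in> {a..<b}. f t \<in> \<int>}" for a b
  define P where "P a b \<longleftrightarrow> (a \<le> b \<longrightarrow> finite (Z a b) \<and> sum (crossing_sign f) (Z a b) = left_floor f b - left_floor f a)"
    for a b
  have "P a b" using ab
  proof (induction rule: Bolzano)
    case (trans a b c)
    have "Z a c = Z a b \<union> Z b c" "Z a b \<inter> Z b c = {}" using trans by (auto simp: Z_def)
    then show ?case using trans by (auto simp: P_def sum.union_disjoint)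
  next
    case (local x)
    obtain d where d: "d > 0"
      "\<And>t. \<bar>t - x\<bar> < d \<Longrightarrow> t \<noteq> x \<Longrightarrow> f t \<notin> \<int>"
      "\<And>t. \<bar>t - x\<bar> < d \<Longrightarrow> t < x \<Longrightarrow> \<lfloor>f t\<rfloor> = left_floor f x"
      "\<And>t. \<bar>t - x\<bar> < d \<Longrightarrow> x < t \<Longrightarrow>
         \<lfloor>f t\<rfloor> = left_floor f x + (if f x \<in> \<int> then crossing_sign f x else 0)"
      using left_floor_locally[OF cont cross] by metis
    have lf: "left_floor f t = \<lfloor>f t\<rfloor>" if "f t \<notin> \<int>" for t using that by (simp add: left_floor_def)
    have "P a b" if ab: "a \<le> x \<and> x \<le> b \<and> b - a < d" for a b
    proof -
      have near: "\<bar>t - x\<bar> < d" if "t \<in> {a..b}" for t using ab that by auto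
      \<comment> \<open>If \<open>x = b\<close>, the crossing at \<open>x\<close> belongs to the
        next interval, in accordance with \<open>left_floor f b\<close>, which still shows the floor
        before it.\<close>
      have Z: "Z a b = (if x < b \<and> f x \<in> \<int> then {x} else {})"
        using near d(2) ab by (auto simp: Z_def) (metis atLeastAtMost_iff less_imp_le)+
      have a: "left_floor f a = left_floor f x"
      proof (cases "a = x")
        case False
        then have "a < x" using ab by simp
        then show ?thesis using d(2,3)[of a] near[of a] ab lf[of a] by auto
      qed simp
      have b: "left_floor f b = left_floor f x + (if x < b \<and> f x \<in> \<int> then crossing_sign f x else 0)"
      proof (cases "b = x")
        case False
        then have "x < b" using ab by simp
        then show ?thesis using d(2,4)[of b] near[of b] ab lf[of b] by auto
      qed simp
      show ?thesis unfolding P_def Z a b by simp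
    qed
    then show ?case using d(1) by blast
  qed
  then show "finite {t \<in> {a..<b}. f t \<in> \<int>}"
    "(\<Sum>t \<in> {t \<in> {a..<b}. f t \<in> \<int>}. crossing_sign f t) = left_floor f b - left_floor f a"
    using ab by (auto simp: P_def Z_def)
qed

text \<open>Makes the sum of the crossing signs over one period equal to \<open>k\<close>, whether
  or not the period starts at a crossing.\<close>

lemma left_floor_shift:
  assumes shift: "\<And>t. f (t + p) = f t + of_int k"
  shows "left_floor f (t + p) = left_floor f t + k"
proof -
  have "(f (s + (t + p)) - f (t + p)) * ((s + (t + p)) - (t + p)) = (f (s + t) - f t) * ((s + t) - t)" for s
    using shift[of "s + t"] shift[of t] by (simp add: add.assoc)
  then have "upcrossing f (t + p) \<longleftrightarrow> upcrossing f t"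
    unfolding upcrossing_def at_to_0[of "t + p"] at_to_0[of t] eventually_filtermap by (simp only:)
  moreover have "f (t + p) \<in> \<int> \<longleftrightarrow> f t \<in> \<int>"
    unfolding shift by (metis Ints_add Ints_diff Ints_of_int add_diff_cancel_right')
  ultimately show ?thesis by (simp add: left_floor_def shift)
qed

lemma parity_of_sum_of_signs:
  fixes g :: "'a \<Rightarrow> int"
  assumes "finite G" "\<And>p. p \<in> G \<Longrightarrow> g p = 1 \<or> g p = -1"
  shows "even (sum g G) \<longleftrightarrow> even (card G)"
  using assms
proof (induction G rule: finite_induct)
  case (insert x F)
  have "g x = 1 \<or> g x = -1" using insert.prems by blast
  then have "odd (g x)" by (elim disjE) simp_all
  then show ?case using insert by simp
qed simp

section \<open>Null directions of a family of quadratic forms\<close>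

lemma continuous_on_locally:
  fixes f :: "'a::t2_space \<Rightarrow> 'b::topological_space"
  assumes "\<And>z. z \<in> S \<Longrightarrow> \<exists>W. open W \<and> z \<in> W \<and> continuous_on (S \<inter> W) f"
  shows "continuous_on S f"
  unfolding continuous_on_eq_continuous_within
proof
  fix z assume z: "z \<in> S"
  then obtain W where W: "open W" "z \<in> W" "continuous_on (S \<inter> W) f" using assms by blast
  then have "continuous (at z within (S \<inter> W)) f"
    using z by (simp add: continuous_on_eq_continuous_within)
  moreover have "at z within (S \<inter> W) = at z within S"
    by (rule at_within_nhd[OF W(2,1)]) auto
  ultimately show "continuous (at z within S) f" by simp
qed

text \<open>
  The form \<open>a u^2 + 2 b u v + c v^2\<close> takes the value \<open>\<tau> + Re (\<alpha> * cis (2 t))\<close> at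
  \<open>(cos t, sin t)\<close>, where \<open>\<tau> = (a + c) / 2\<close> and \<open>\<alpha> = (a - c) / 2 - \<i> b\<close>. Only
  \<open>(\<alpha> / \<bar>\<alpha>\<bar>)^2\<close> is independent of the scaling of the form, in particular of its sign; its
  logarithm then fixes the sign.
\<close>

lemma form_at_cos_sin:
  fixes a b c t :: real
  shows "a * (cos t)\<^sup>2 + 2 * b * cos t * sin t + c * (sin t)\<^sup>2
    = (a + c) / 2 + Re (Complex ((a - c) / 2) (- b) * cis (2 * t))"
proof -
  have "2 * (a * (cos t)\<^sup>2 + c * (sin t)\<^sup>2) = (a + c) + (a - c) * cos (2 * t)"
    unfolding cos_double sin_squared_eq by (simp add: algebra_simps)
  moreover have "Re (Complex ((a - c) / 2) (- b) * cis (2 * t)) = ((a - c) * cos (2 * t)) / 2 + 2 * b * cos t * sin t"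
    using sin_double[of t] by simp
  moreover have "p + k + q = u / 2 + r" if "2 * (p + q) = u + v" "r = v / 2 + k" for p q r k u v :: real
    using that by (simp add: field_simps)
  ultimately show ?thesis by blast
qed

text \<open>\<open>R y\<close> relates \<open>y\<close> to all forms known there, any two being
  proportional. Divided by \<open>\<bar>\<alpha>\<bar>\<close>, with a suitable sign, the form at
  the angle \<open>t\<close> becomes \<open>T y + cos (\<psi> y + 2 * t)\<close> with
  \<open>\<bar>T y\<bar> \<le> 1\<close>, and an arccosine solves for \<open>t\<close>. As arccos is
  continuous up to the ends of its interval, the solution remains continuous where the two null
  directions merge.\<close>

lemma continuous_null_direction:
  fixes R :: "'a::real_normed_vector \<Rightarrow> real \<Rightarrow> real \<Rightarrow> real \<Rightarrow> bool"
  assumes S: "contractible S"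
    and loc: "\<And>z. z \<in> S \<Longrightarrow> \<exists>W a b c. open W \<and> z \<in> W \<and> continuous_on W a \<and> continuous_on W b \<and>
      continuous_on W c \<and> (\<forall>y\<in>S \<inter> W. R y (a y) (b y) (c y))"
    and proportional: "\<And>y a b c a' b' c'. y \<in> S \<Longrightarrow> R y a b c \<Longrightarrow> R y a' b' c' \<Longrightarrow>
      \<exists>l. l \<noteq> 0 \<and> a' = l * a \<and> b' = l * b \<and> c' = l * c"
    and disc: "\<And>y a b c. y \<in> S \<Longrightarrow> R y a b c \<Longrightarrow> (a, b, c) \<noteq> (0, 0, 0) \<and> a * c \<le> b\<^sup>2"
  obtains \<theta> where "continuous_on S \<theta>"
    "\<And>y a b c. y \<in> S \<Longrightarrow> R y a b c \<Longrightarrow>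
       a * (cos (\<theta> y))\<^sup>2 + 2 * b * cos (\<theta> y) * sin (\<theta> y) + c * (sin (\<theta> y))\<^sup>2 = 0"
proof -
  define \<alpha> where "\<alpha> a b c = Complex ((a - c) / 2) (- b)" for a b c :: real
  have \<alpha>_scale: "\<alpha> (l * a) (l * b) (l * c) = l *\<^sub>R \<alpha> a b c" for l a b c
    by (simp add: \<alpha>_def complex_eq_iff field_simps)
  have norm_\<alpha>: "(cmod (\<alpha> a b c))\<^sup>2 = ((a - c) / 2)\<^sup>2 + b\<^sup>2" for a b c
    by (simp add: \<alpha>_def cmod_power2)
  have \<tau>_le: "\<bar>(a + c) / 2\<bar> \<le> cmod (\<alpha> a b c)" if "y \<in> S" "R y a b c" for y a b c
  proof -
    have "((a + c) / 2)\<^sup>2 \<le> (cmod (\<alpha> a b c))\<^sup>2"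
      unfolding norm_\<alpha> using disc[OF that] by (simp add: power2_eq_square field_simps)
    then show ?thesis using abs_le_square_iff[of "(a + c) / 2" "cmod (\<alpha> a b c)"] by simp
  qed
  have \<alpha>_nz: "\<alpha> a b c \<noteq> 0" if "y \<in> S" "R y a b c" for y a b c
  proof
    assume 0: "\<alpha> a b c = 0"
    then have "b = 0" "a = c" by (auto simp: \<alpha>_def complex_eq_iff)
    moreover have "a + c = 0" using \<tau>_le[OF that] 0 by simp
    ultimately show False using disc[OF that] by auto
  qed
  have \<alpha>_cont: "continuous_on (S \<inter> W) (\<lambda>y. \<alpha> (a y) (b y) (c y))"
    if "continuous_on W a" "continuous_on W b" "continuous_on W c" for W a b c
    unfolding \<alpha>_def Complex_eq
    by (intro continuous_intros that[THEN continuous_on_subset]) auto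
  \<comment> \<open>An arbitrary choice of representatives without any continuity; \<open>P\<close>
    and \<open>T\<close> are formed so that the choice does not matter.\<close>
  define q where "q y = (SOME (a, b, c). R y a b c)" for y
  define A where "A y = fst (q y)" for y
  define B where "B y = fst (snd (q y))" for y
  define C where "C y = snd (snd (q y))" for y
  have R: "R y (A y) (B y) (C y)" if "y \<in> S" for y
  proof -
    have "\<exists>p. case p of (a, b, c) \<Rightarrow> R y a b c" using loc[OF that] that by fastforce
    then have "case q y of (a, b, c) \<Rightarrow> R y a b c" unfolding q_def by (rule someI_ex)
    then show ?thesis by (simp add: A_def B_def C_def split: prod.splits)
  qed
  define P where "P y = (\<alpha> (A y) (B y) (C y) / cmod (\<alpha> (A y) (B y) (C y)))\<^sup>2" for y
  have P: "P y = (\<alpha> a b c / cmod (\<alpha> a b c))\<^sup>2" if y: "y \<in> S" and r: "R y a b c" for y a b c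
  proof -
    obtain l where l: "l \<noteq> 0" "a = l * A y" "b = l * B y" "c = l * C y"
      using proportional[OF y R[OF y] r] by blast
    have "(complex_of_real l / complex_of_real \<bar>l\<bar>)\<^sup>2 = 1"
      using l(1) by (auto simp: abs_if power2_eq_square)
    moreover have "l *\<^sub>R \<alpha> (A y) (B y) (C y) / cmod (l *\<^sub>R \<alpha> (A y) (B y) (C y)) =
        (complex_of_real l / complex_of_real \<bar>l\<bar>) * (\<alpha> (A y) (B y) (C y) / cmod (\<alpha> (A y) (B y) (C y)))"
      by (simp add: scaleR_conv_of_real norm_mult)
    ultimately have "(l *\<^sub>R \<alpha> (A y) (B y) (C y) / cmod (l *\<^sub>R \<alpha> (A y) (B y) (C y)))\<^sup>2 = P y"
      unfolding P_def by (simp only: power_mult_distrib mult_1_left)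
    then show ?thesis using l \<alpha>_scale by simp
  qed
  have "continuous_on S P"
  proof (rule continuous_on_locally)
    fix z assume "z \<in> S"
    from loc[OF this] obtain W a b c where W: "open W" "z \<in> W" and abc: "continuous_on W a" "continuous_on W b"
      "continuous_on W c" and RW: "\<forall>y\<in>S \<inter> W. R y (a y) (b y) (c y)" by (elim exE conjE)
    note \<alpha>_cont[OF abc]
    moreover have "\<alpha> (a y) (b y) (c y) \<noteq> 0" if "y \<in> S \<inter> W" for y using \<alpha>_nz RW that by blast
    ultimately have "continuous_on (S \<inter> W) (\<lambda>y. (\<alpha> (a y) (b y) (c y) / cmod (\<alpha> (a y) (b y) (c y)))\<^sup>2)"
      by (intro continuous_intros) auto
    then have "continuous_on (S \<inter> W) P"
      by (rule continuous_on_eq) (rule P[symmetric]; use RW in auto)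
    then show "\<exists>W. open W \<and> z \<in> W \<and> continuous_on (S \<inter> W) P" using W by blast
  qed
  moreover have "P y \<noteq> 0" if "y \<in> S" for y using \<alpha>_nz[OF that R[OF that]] by (simp add: P_def)
  ultimately obtain g where g: "continuous_on S g" "\<And>y. y \<in> S \<Longrightarrow> P y = exp (g y)"
    using continuous_logarithm_on_contractible[OF _ S] by metis
  \<comment> \<open>Halving the logarithm gives a continuous square root of \<open>P\<close>, that
    is, a continuous choice between \<open>\<alpha> / \<bar>\<alpha>\<bar>\<close> and its
    negative.\<close>
  define \<psi> where "\<psi> y = Im (g y) / 2" for y
  have \<psi>: "continuous_on S \<psi>" unfolding \<psi>_def by (intro continuous_intros g) auto
  have cis_\<psi>: "(cis (\<psi> y))\<^sup>2 = P y" if y: "y \<in> S" for y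
  proof -
    have "cmod (P y) = 1" using \<alpha>_nz[OF y R[OF y]] by (simp add: P_def norm_power norm_divide)
    then have "Re (g y) = 0" using g(2)[OF y] by simp
    then have "P y = cis (Im (g y))" using g(2)[OF y] by (simp add: exp_eq_polar)
    then show ?thesis by (simp add: \<psi>_def cis_mult power2_eq_square)
  qed
  have real: "\<exists>r. cis (\<psi> y) = of_real r * \<alpha> a b c \<and> \<bar>r\<bar> = 1 / cmod (\<alpha> a b c)"
    if "y \<in> S" "R y a b c" for y a b c
  proof -
    have "(cis (\<psi> y))\<^sup>2 = (\<alpha> a b c / cmod (\<alpha> a b c))\<^sup>2" using cis_\<psi>[OF that(1)] P[OF that] by simp
    then have "cis (\<psi> y) = \<alpha> a b c / cmod (\<alpha> a b c) \<or> cis (\<psi> y) = - (\<alpha> a b c / cmod (\<alpha> a b c))"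
      unfolding power2_eq_iff .
    then consider "cis (\<psi> y) = of_real (1 / cmod (\<alpha> a b c)) * \<alpha> a b c"
      | "cis (\<psi> y) = of_real (- (1 / cmod (\<alpha> a b c))) * \<alpha> a b c"
      by (elim disjE) simp_all
    then show ?thesis by cases (intro exI conjI, assumption, simp)+
  qed
  \<comment> \<open>\<open>cis (\<psi> y) / \<alpha>\<close> is the real factor \<open>r\<close>
    found above, so \<open>T y\<close> is \<open>\<tau> / \<bar>\<alpha>\<bar>\<close> with the sign
    selected by \<open>\<psi>\<close>. Scaling the form multiplies \<open>\<tau>\<close> and divides
    this factor by the same number.\<close>
  define T where "T y = (A y + C y) / 2 * Re (cis (\<psi> y) / \<alpha> (A y) (B y) (C y))" for y
  have T: "T y = (a + c) / 2 * Re (cis (\<psi> y) / \<alpha> a b c)" if y: "y \<in> S" and r: "R y a b c" for y a b c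
  proof -
    obtain l where l: "l \<noteq> 0" "a = l * A y" "b = l * B y" "c = l * C y"
      using proportional[OF y R[OF y] r] by blast
    have "cis (\<psi> y) / \<alpha> a b c = (1 / l) *\<^sub>R (cis (\<psi> y) / \<alpha> (A y) (B y) (C y))"
      unfolding l(2-4) \<alpha>_scale by (simp add: scaleR_conv_of_real)
    then have "Re (cis (\<psi> y) / \<alpha> a b c) = Re (cis (\<psi> y) / \<alpha> (A y) (B y) (C y)) / l"
      by simp
    moreover have "(a + c) / 2 * (X / l) = (A y + C y) / 2 * X" for X
      using l by (simp add: field_simps)
    ultimately show ?thesis unfolding T_def by (simp only:)
  qed
  have "continuous_on S T"
  proof (rule continuous_on_locally)
    fix z assume "z \<in> S"
    from loc[OF this] obtain W a b c where W: "open W" "z \<in> W" and abc: "continuous_on W a" "continuous_on W b"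
      "continuous_on W c" and RW: "\<forall>y\<in>S \<inter> W. R y (a y) (b y) (c y)" by (elim exE conjE)
    note \<alpha>_cont[OF abc]
    moreover have "\<alpha> (a y) (b y) (c y) \<noteq> 0" if "y \<in> S \<inter> W" for y using \<alpha>_nz RW that by blast
    ultimately have "continuous_on (S \<inter> W) (\<lambda>y. (a y + c y) / 2 * Re (cis (\<psi> y) / \<alpha> (a y) (b y) (c y)))"
      by (intro continuous_intros continuous_on_subset[OF abc(1)] continuous_on_subset[OF abc(3)]
          continuous_on_subset[OF \<psi>]) auto
    then have "continuous_on (S \<inter> W) T"
      by (rule continuous_on_eq) (rule T[symmetric]; use RW in auto)
    then show "\<exists>W. open W \<and> z \<in> W \<and> continuous_on (S \<inter> W) T" using W by blast
  qed
  have T_le: "\<bar>T y\<bar> \<le> 1" if y: "y \<in> S" for y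
  proof -
    obtain r where r: "cis (\<psi> y) = of_real r * \<alpha> (A y) (B y) (C y)" "\<bar>r\<bar> = 1 / cmod (\<alpha> (A y) (B y) (C y))"
      using real[OF y R[OF y]] by blast
    have "T y = (A y + C y) / 2 * r" unfolding T_def r(1) using \<alpha>_nz[OF y R[OF y]] by simp
    then have "\<bar>T y\<bar> = \<bar>(A y + C y) / 2\<bar> * \<bar>r\<bar>" by (simp only: abs_mult)
    then have "\<bar>T y\<bar> = \<bar>(A y + C y) / 2\<bar> / cmod (\<alpha> (A y) (B y) (C y))" unfolding r(2) by simp
    then show ?thesis using \<tau>_le[OF y R[OF y]] \<alpha>_nz[OF y R[OF y]] by (simp add: divide_le_eq)
  qed
  \<comment> \<open>The solution of
    \<open>T y + cos (\<psi> y + 2 * \<theta> y) = 0\<close>.\<close>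
  define \<theta> where "\<theta> y = (arccos (- T y) - \<psi> y) / 2" for y
  have "continuous_on S \<theta>"
    unfolding \<theta>_def
  proof (intro continuous_intros \<open>continuous_on S T\<close> \<psi> ballI)
    fix y assume "y \<in> S"
    then show "- 1 \<le> - T y \<and> - T y \<le> 1" using T_le[of y] by linarith
  qed auto
  moreover have "a * (cos (\<theta> y))\<^sup>2 + 2 * b * cos (\<theta> y) * sin (\<theta> y) + c * (sin (\<theta> y))\<^sup>2 = 0"
    if y: "y \<in> S" and R: "R y a b c" for y a b c
  proof -
    obtain r where r: "cis (\<psi> y) = of_real r * \<alpha> a b c" "\<bar>r\<bar> = 1 / cmod (\<alpha> a b c)"
      using real[OF y R] by blast
    have Ty: "T y = (a + c) / 2 * r" unfolding T[OF y R] r(1) using \<alpha>_nz[OF y R] by simp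
    have "r * ((a + c) / 2 + Re (\<alpha> a b c * cis (2 * \<theta> y))) = T y + Re ((of_real r * \<alpha> a b c) * cis (2 * \<theta> y))"
      by (simp add: Ty algebra_simps)
    also have "\<dots> = T y + cos (\<psi> y + 2 * \<theta> y)" unfolding r(1)[symmetric] cis_mult by simp
    also have "\<psi> y + 2 * \<theta> y = arccos (- T y)" by (simp add: \<theta>_def field_simps)
    also have "T y + cos (arccos (- T y)) = 0" using T_le[OF y] by (simp add: cos_arccos_abs)
    finally have "(a + c) / 2 + Re (\<alpha> a b c * cis (2 * \<theta> y)) = 0"
      using r(2) \<alpha>_nz[OF y R] by auto
    then show ?thesis unfolding form_at_cos_sin \<alpha>_def .
  qed
  ultimately show thesis using that by blast
qed

section \<open>Monge charts of a parametrized surface\<close>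

lemma has_derivative_compose_smooth:
  assumes h: "smooth_on U h" and \<phi>: "(\<phi> has_derivative \<phi>') (at y within T)" and y: "\<phi> y \<in> U"
  shows "((\<lambda>y. h (\<phi> y)) has_derivative (\<lambda>u. dderiv (\<phi>' u) h (\<phi> y))) (at y within T)"
  using has_derivative_compose[OF \<phi> smooth_on_has_derivative[OF h y]] .

lemma continuous_on_dderiv:
  fixes h :: "plane \<Rightarrow> 'b::real_normed_vector"
  assumes h: "smooth_on U h" and \<phi>: "continuous_on W \<phi>" "\<phi> ` W \<subseteq> U" and w: "continuous_on W w"
  shows "continuous_on W (\<lambda>y. dderiv (w y) h (\<phi> y))"
proof -
  have 1: "continuous_on W (\<lambda>y. dderiv v h (\<phi> y))" for v
    using continuous_on_compose2[OF smooth_on_continuous[OF smooth_on_dderiv[OF h]] \<phi>] .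
  have "continuous_on W (\<lambda>y. w y $ 1 *\<^sub>R dderiv (axis 1 1) h (\<phi> y) + w y $ 2 *\<^sub>R dderiv (axis 2 1) h (\<phi> y))"
    by (intro continuous_intros w 1)
  moreover have "dderiv (w y) h (\<phi> y) = w y $ 1 *\<^sub>R dderiv (axis 1 1) h (\<phi> y) + w y $ 2 *\<^sub>R dderiv (axis 2 1) h (\<phi> y)"
    if "y \<in> W" for y
    by (rule dderiv_expand[OF smooth_on_differentiable[OF h]]) (use \<phi>(2) that in blast)
  ultimately show ?thesis by (simp cong: continuous_on_cong)
qed

lemma continuous_on_bil_hessian:
  assumes h: "smooth_on U h" and \<phi>: "continuous_on W \<phi>" "\<phi> ` W \<subseteq> U"
    and v: "continuous_on W v" and w: "continuous_on W w"
  shows "continuous_on W (\<lambda>y. bil (hessian h (\<phi> y)) (v y) (w y))"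
proof -
  have 1: "continuous_on W (\<lambda>y. hessian h (\<phi> y) $ i $ j)" for i j
    using continuous_on_compose2[OF smooth_on_continuous[OF hessian_nth_smooth[OF h]] \<phi>] .
  show ?thesis unfolding bil_def by (intro continuous_intros v w 1)
qed

lemma bil_scale: "bil Q (a *\<^sub>R v) (a *\<^sub>R v) = a\<^sup>2 * bil Q v v"
  unfolding bil_def vector_scaleR_component real_scaleR_def by (simp add: power2_eq_square algebra_simps)

text \<open>\<open>\<phi>\<close> is only assumed to be differentiable once, so the composition need
  not have a second order expansion. Subtracting the differential of \<open>h\<close> on the actual
  secant of \<open>\<phi>\<close> leaves the Taylor remainder of \<open>h\<close> alone, and for
  this the convergence of the secant slopes \<open>\<omega> t\<close> to \<open>\<phi>' u\<close> is
  enough.\<close>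

lemma second_order_contact_limit:
  fixes h :: "plane \<Rightarrow> real" and \<phi> :: "'a::real_normed_vector \<Rightarrow> plane"
  assumes U: "open U" and h: "smooth_on U h" and x: "\<phi> z \<in> U"
    and \<phi>: "(\<phi> has_derivative \<phi>') (at z)"
  shows "((\<lambda>t. (h (\<phi> (z + t *\<^sub>R u)) - h (\<phi> z) - dderiv (\<phi> (z + t *\<^sub>R u) - \<phi> z) h (\<phi> z)) / t\<^sup>2)
    \<longlongrightarrow> bil (hessian h (\<phi> z)) (\<phi>' u) (\<phi>' u) / 2) (at 0)"
proof -
  define \<omega> where "\<omega> t = (\<phi> (z + t *\<^sub>R u) - \<phi> z) /\<^sub>R t" for t :: real
  interpret \<phi>': bounded_linear \<phi>' using \<phi> by (rule has_derivative_bounded_linear)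
  have "((\<lambda>t. z + t *\<^sub>R u) has_derivative (\<lambda>s. s *\<^sub>R u)) (at 0)"
    by (auto intro!: derivative_eq_intros)
  then have "((\<lambda>t. \<phi> (z + t *\<^sub>R u)) has_derivative (\<lambda>s. \<phi>' (s *\<^sub>R u))) (at 0)"
    using has_derivative_compose[of "\<lambda>t. z + t *\<^sub>R u" _ 0 UNIV \<phi> \<phi>'] \<phi> by simp
  then have "((\<lambda>t. norm (\<phi> (z + t *\<^sub>R u) - \<phi> z - t *\<^sub>R \<phi>' u) / norm t) \<longlongrightarrow> 0) (at 0)"
    by (simp add: has_derivative_at \<phi>'.scaleR)
  moreover have "norm (\<phi> (z + t *\<^sub>R u) - \<phi> z - t *\<^sub>R \<phi>' u) / norm t = norm (\<omega> t - \<phi>' u)" if "t \<noteq> 0" for t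
  proof -
    have "\<phi> (z + t *\<^sub>R u) - \<phi> z - t *\<^sub>R \<phi>' u = t *\<^sub>R (\<omega> t - \<phi>' u)"
      using that by (simp add: \<omega>_def scaleR_diff_right)
    then show ?thesis using that by simp
  qed
  ultimately have "((\<lambda>t. norm (\<omega> t - \<phi>' u)) \<longlongrightarrow> 0) (at 0)"
    by (simp cong: LIM_cong)
  then have \<omega>: "(\<omega> \<longlongrightarrow> \<phi>' u) (at 0)"
    by (simp add: tendsto_norm_zero_iff LIM_zero_iff)
  have \<omega>_eq: "\<phi> (z + t *\<^sub>R u) = \<phi> z + t *\<^sub>R \<omega> t" if "t \<noteq> 0" for t
    using that by (simp add: \<omega>_def)
  obtain r where r: "r > 0" "ball (\<phi> z) r \<subseteq> U" using U x open_contains_ball by blast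
  have "((\<lambda>t. norm (t *\<^sub>R \<omega> t)) \<longlongrightarrow> norm (0 *\<^sub>R \<phi>' u)) (at 0)"
    by (intro tendsto_intros \<omega>)
  then have small: "\<forall>\<^sub>F t in at 0. norm (t *\<^sub>R \<omega> t) < r"
    using r(1) by (auto dest: order_tendstoD(2))
  \<comment> \<open>Taylor's formula for \<open>h\<close> along the secant with Lagrange remainder
    at the parameter \<open>\<xi>\<close>; the bound on \<open>\<xi>\<close> drives the intermediate
    point to \<open>\<phi> z\<close>.\<close>
  define P where "P t \<xi> \<longleftrightarrow> \<bar>\<xi>\<bar> \<le> \<bar>t\<bar> \<and> \<phi> z + \<xi> *\<^sub>R \<omega> t \<in> U \<and>
      h (\<phi> z + t *\<^sub>R \<omega> t) = h (\<phi> z) + dderiv (\<omega> t) h (\<phi> z) * t + bil (hessian h (\<phi> z + \<xi> *\<^sub>R \<omega> t)) (\<omega> t) (\<omega> t) / 2 * t\<^sup>2"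
    for t \<xi>
  have ex: "\<exists>\<xi>. P t \<xi>" if t: "norm (t *\<^sub>R \<omega> t) < r" for t
  proof -
    have inU: "\<phi> z + s *\<^sub>R \<omega> t \<in> U" if "\<bar>s\<bar> \<le> \<bar>t\<bar>" for s
    proof -
      have "norm (s *\<^sub>R \<omega> t) \<le> norm (t *\<^sub>R \<omega> t)" using that by (simp add: mult_right_mono)
      then have "\<phi> z + s *\<^sub>R \<omega> t \<in> ball (\<phi> z) r" using t by (simp add: dist_norm)
      then show ?thesis using r by blast
    qed
    define D :: "nat \<Rightarrow> real \<Rightarrow> real" where
      "D m = (if m = 0 then (\<lambda>s. h (\<phi> z + s *\<^sub>R \<omega> t)) else if m = 1 then (\<lambda>s. dderiv (\<omega> t) h (\<phi> z + s *\<^sub>R \<omega> t))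
         else (\<lambda>s. dderiv (\<omega> t) (dderiv (\<omega> t) h) (\<phi> z + s *\<^sub>R \<omega> t)))" for m
    have "\<exists>\<xi>. \<bar>\<xi>\<bar> \<le> \<bar>t\<bar> \<and> h (\<phi> z + t *\<^sub>R \<omega> t) = (\<Sum>m<2. D m 0 / fact m * t ^ m) + D 2 \<xi> / fact 2 * t ^ 2"
    proof (rule Maclaurin_bi_le[where f = "\<lambda>s. h (\<phi> z + s *\<^sub>R \<omega> t)"])
      show "\<forall>m s. m < 2 \<and> \<bar>s\<bar> \<le> \<bar>t\<bar> \<longrightarrow> (D m has_real_derivative D (Suc m) s) (at s)"
      proof (intro allI impI, elim conjE)
        fix m s assume "m < (2::nat)" and s: "\<bar>s\<bar> \<le> \<bar>t\<bar>"
        then consider "m = 0" | "m = 1" by linarith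
        then show "(D m has_real_derivative D (Suc m) s) (at s)"
          by cases (auto simp: D_def intro!: deriv_along_line smooth_on_differentiable[OF h]
              smooth_on_differentiable[OF smooth_on_dderiv[OF h]] inU[OF s])
      qed
    qed (simp add: D_def)
    then obtain \<xi> where \<xi>: "\<bar>\<xi>\<bar> \<le> \<bar>t\<bar>"
      "h (\<phi> z + t *\<^sub>R \<omega> t) = (\<Sum>m<2. D m 0 / fact m * t ^ m) + D 2 \<xi> / fact 2 * t ^ 2" by blast
    then have "P t \<xi>" unfolding P_def
      by (simp add: inU numeral_2_eq_2 D_def dderiv_dderiv_hessian[OF U h inU[OF \<xi>(1)]])
    then show ?thesis ..
  qed
  define \<xi> where "\<xi> t = (SOME s. P t s)" for t
  have P: "\<forall>\<^sub>F t in at 0. P t (\<xi> t)"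
    using small by (rule eventually_mono) (unfold \<xi>_def, rule someI_ex, rule ex)
  have "(\<xi> \<longlongrightarrow> 0) (at 0)"
  proof (rule Lim_null_comparison)
    show "\<forall>\<^sub>F t in at 0. norm (\<xi> t) \<le> \<bar>t\<bar>" using P by (rule eventually_mono) (simp add: P_def)
    show "((\<lambda>t::real. \<bar>t\<bar>) \<longlongrightarrow> 0) (at 0)" by (intro tendsto_rabs_zero tendsto_ident_at)
  qed
  then have "((\<lambda>t. \<phi> z + \<xi> t *\<^sub>R \<omega> t) \<longlongrightarrow> \<phi> z + 0 *\<^sub>R \<phi>' u) (at 0)"
    by (intro tendsto_intros \<omega>)
  then have arg: "((\<lambda>t. \<phi> z + \<xi> t *\<^sub>R \<omega> t) \<longlongrightarrow> \<phi> z) (at 0)" by simp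
  have "isCont (\<lambda>x. hessian h x $ i $ j) (\<phi> z)" for i j
    using smooth_on_continuous[OF hessian_nth_smooth[OF h]] U x by (simp add: continuous_on_eq_continuous_at)
  then have "((\<lambda>t. hessian h (\<phi> z + \<xi> t *\<^sub>R \<omega> t) $ i $ j) \<longlongrightarrow> hessian h (\<phi> z) $ i $ j) (at 0)" for i j
    using arg by (rule isCont_tendsto_compose)
  then have "((\<lambda>t. hessian h (\<phi> z + \<xi> t *\<^sub>R \<omega> t)) \<longlongrightarrow> hessian h (\<phi> z)) (at 0)"
    by (intro vec_tendstoI)
  then have "((\<lambda>t. bil (hessian h (\<phi> z + \<xi> t *\<^sub>R \<omega> t)) (\<omega> t) (\<omega> t) / 2) \<longlongrightarrow> bil (hessian h (\<phi> z)) (\<phi>' u) (\<phi>' u) / 2) (at 0)"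
    unfolding bil_def by (intro tendsto_intros \<omega>) auto
  moreover have "\<forall>\<^sub>F t in at 0. bil (hessian h (\<phi> z + \<xi> t *\<^sub>R \<omega> t)) (\<omega> t) (\<omega> t) / 2 =
      (h (\<phi> (z + t *\<^sub>R u)) - h (\<phi> z) - dderiv (\<phi> (z + t *\<^sub>R u) - \<phi> z) h (\<phi> z)) / t\<^sup>2"
    using P eventually_neq_at_within[of 0]
  proof eventually_elim
    case (elim t)
    have "dderiv (t *\<^sub>R \<omega> t) h (\<phi> z) = t * dderiv (\<omega> t) h (\<phi> z)"
      by (simp add: linear_scale[OF linear_dderiv[OF smooth_on_differentiable[OF h x]]])
    then show ?case using elim by (simp add: P_def \<omega>_eq)
  qed
  ultimately show ?thesis by (rule Lim_transform_eventually)
qed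

text \<open>\<open>\<phi>\<close> is the parametrization read in the Monge chart. Only class C^1 is
  kept, since second derivatives of the surface are read off from a limit in which
  \<open>\<phi>\<close> is differentiated once.\<close>

definition local_chart :: "(space \<Rightarrow> 'a) set \<Rightarrow> 'a set \<Rightarrow> (plane \<Rightarrow> 'a) \<Rightarrow> plane \<Rightarrow> (space \<Rightarrow> 'a) \<Rightarrow> plane set \<Rightarrow> real set
    \<Rightarrow> (plane \<Rightarrow> real) \<Rightarrow> plane set \<Rightarrow> (plane \<Rightarrow> plane) \<Rightarrow> (plane \<Rightarrow> plane \<Rightarrow> plane) \<Rightarrow> bool" where
  "local_chart A S X z c U I h W \<phi> \<phi>' \<longleftrightarrow> monge A S c U I h \<and> open W \<and> z \<in> W \<and> \<phi> ` W \<subseteq> U \<and> inj_on \<phi> W \<and>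
     (\<forall>y\<in>W. X y = c (\<phi> y, h (\<phi> y)) \<and> (\<phi> has_derivative \<phi>' y) (at y) \<and> inj (\<phi>' y)) \<and>
     (\<forall>u. continuous_on W (\<lambda>y. \<phi>' y u))"

text \<open>Affine and projective space are treated together through homogeneous coordinates:
  appending 1 to the coordinates, every change of coordinates becomes a linear bijection up to a
  factor that may vary from point to point.\<close>

locale projective_coords =
  fixes A :: "(space \<Rightarrow> 'a) set"
  assumes inj_coords: "c \<in> A \<Longrightarrow> inj c"
    and transition: "c \<in> A \<Longrightarrow> d \<in> A \<Longrightarrow> \<exists>M :: space \<times> real \<Rightarrow> space \<times> real. linear M \<and> bij M \<and>
      (\<forall>a b. c a = d b \<longleftrightarrow> (\<exists>\<mu>. \<mu> \<noteq> 0 \<and> M (a, 1) = \<mu> *\<^sub>R (b, 1)))"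

text \<open>The Jacobian determinant turns injectivity of the derivative into an open
  condition.\<close>

lemma inj_derivative_iff:
  fixes \<phi> :: "plane \<Rightarrow> plane"
  assumes "\<phi> differentiable (at y)"
  shows "inj (\<lambda>v. dderiv v \<phi> y) \<longleftrightarrow>
    dderiv (axis 1 1) \<phi> y $ 1 * dderiv (axis 2 1) \<phi> y $ 2 - dderiv (axis 1 1) \<phi> y $ 2 * dderiv (axis 2 1) \<phi> y $ 1 \<noteq> 0"
    (is "_ \<longleftrightarrow> ?J \<noteq> 0")
proof -
  note L = linear_dderiv[OF assms]
  define p where "p = dderiv (axis 1 1) \<phi> y"
  define q where "q = dderiv (axis 2 1) \<phi> y"
  have e: "dderiv v \<phi> y = v $ 1 *\<^sub>R p + v $ 2 *\<^sub>R q" for v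
    unfolding p_def q_def by (rule dderiv_expand[OF assms])
  have "inj (\<lambda>v. dderiv v \<phi> y) \<longleftrightarrow> (\<forall>v. dderiv v \<phi> y = 0 \<longrightarrow> v = 0)"
    by (rule linear_injective_0[OF L])
  also have "\<dots> \<longleftrightarrow> p $ 1 * q $ 2 - p $ 2 * q $ 1 \<noteq> 0"
  proof (intro iffI notI allI impI)
    assume inj: "\<forall>v. dderiv v \<phi> y = 0 \<longrightarrow> v = 0" and J: "p $ 1 * q $ 2 - p $ 2 * q $ 1 = 0"
    \<comment> \<open>These two vectors come from the adjugate of the matrix with columns
      \<open>p\<close> and \<open>q\<close>; they lie in its kernel when the determinant
      vanishes.\<close>
    have "dderiv (vector [q $ 2, - p $ 2]) \<phi> y = 0" "dderiv (vector [q $ 1, - p $ 1]) \<phi> y = 0"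
      unfolding e using J by (simp_all add: vec_eq_iff forall_2 algebra_simps)
    then have "(vector [q $ 2, - p $ 2] :: plane) = 0" "(vector [q $ 1, - p $ 1] :: plane) = 0"
      using inj by blast+
    then have "p = 0" by (simp add: vec_eq_iff forall_2)
    then have "dderiv (axis 1 1) \<phi> y = 0" by (simp add: p_def)
    then have "(axis 1 1 :: plane) = 0" using inj by blast
    then show False by (simp add: axis_eq_0_iff)
  next
    fix v assume J: "p $ 1 * q $ 2 - p $ 2 * q $ 1 \<noteq> 0" and v: "dderiv v \<phi> y = 0"
    then have v1: "v $ 1 * p $ 1 + v $ 2 * q $ 1 = 0" and v2: "v $ 1 * p $ 2 + v $ 2 * q $ 2 = 0"
      unfolding e by (simp_all add: vec_eq_iff forall_2)
    have "v $ 1 * (p $ 1 * q $ 2 - p $ 2 * q $ 1) =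
        (v $ 1 * p $ 1 + v $ 2 * q $ 1) * q $ 2 - (v $ 1 * p $ 2 + v $ 2 * q $ 2) * q $ 1"
      by (simp add: algebra_simps)
    moreover have "v $ 2 * (p $ 1 * q $ 2 - p $ 2 * q $ 1) =
        (v $ 1 * p $ 2 + v $ 2 * q $ 2) * p $ 1 - (v $ 1 * p $ 1 + v $ 2 * q $ 1) * p $ 2"
      by (simp add: algebra_simps)
    ultimately show "v = 0" using J unfolding v1 v2 by (simp add: vec_eq_iff forall_2)
  qed
  finally show ?thesis unfolding p_def q_def .
qed


lemma local_chartD:
  assumes "local_chart A S X z c U I h W \<phi> \<phi>'"
  shows "monge A S c U I h" "c \<in> A" "open U" "open I" "smooth_on U h" "open W" "z \<in> W" "\<phi> ` W \<subseteq> U" "inj_on \<phi> W"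
    "\<And>y. y \<in> W \<Longrightarrow> \<phi> y \<in> U"
    "\<And>y. y \<in> W \<Longrightarrow> X y = c (\<phi> y, h (\<phi> y))"
    "\<And>y. y \<in> W \<Longrightarrow> (\<phi> has_derivative \<phi>' y) (at y)"
    "\<And>y. y \<in> W \<Longrightarrow> inj (\<phi>' y)"
    "\<And>u. continuous_on W (\<lambda>y. \<phi>' y u)"
    "continuous_on W \<phi>"
    "\<And>y. y \<in> W \<Longrightarrow> linear (\<phi>' y)"
  using assms unfolding local_chart_def monge_def
  by (blast intro: has_derivative_linear has_derivative_continuous_on has_derivative_at_withinI image_subset_iff)+

lemma local_chart_move:
  "local_chart A S X z c U I h W \<phi> \<phi>' \<Longrightarrow> y \<in> W \<Longrightarrow> local_chart A S X y c U I h W \<phi> \<phi>'"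
  unfolding local_chart_def by blast

text \<open>The derivative is known to be bijective at \<open>z\<close> only, so the neighbourhood
  is cut down to the points with nonzero Jacobian. \<open>\<phi>\<close> inherits injectivity from
  \<open>X\<close>, which factors through it.\<close>

lemma smooth_parametrization_chart:
  assumes "smooth_parametrization A S V X" "z \<in> V"
  obtains c U I h W \<phi> \<phi>' where "local_chart A S X z c U I h W \<phi> \<phi>'" "W \<subseteq> V"
proof -
  obtain c U I h W \<phi> where m: "monge A S c U I h" and W: "open W" "z \<in> W" "W \<subseteq> V"
    and \<phi>: "smooth_on W \<phi>" "\<phi> ` W \<subseteq> U" and bij: "bij (frechet_derivative \<phi> (at z))"
    and X: "\<forall>y\<in>W. X y = c (\<phi> y, h (\<phi> y))" and inj: "inj_on X V"
    using assms unfolding smooth_parametrization_def by metis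
  define J where "J y = dderiv (axis 1 1) \<phi> y $ 1 * dderiv (axis 2 1) \<phi> y $ 2 - dderiv (axis 1 1) \<phi> y $ 2 * dderiv (axis 2 1) \<phi> y $ 1" for y
  have c: "continuous_on W (dderiv v \<phi>)" for v
    using smooth_on_continuous[OF smooth_on_dderiv[OF \<phi>(1)]] .
  have J: "continuous_on W J" unfolding J_def by (intro continuous_intros c)
  define W' where "W' = W \<inter> J -` (- {0})"
  have Jiff: "inj (\<lambda>v. dderiv v \<phi> y) \<longleftrightarrow> J y \<noteq> 0" if "y \<in> W" for y
    using inj_derivative_iff[OF smooth_on_differentiable[OF \<phi>(1) that]] by (simp add: J_def)
  have "local_chart A S X z c U I h W' \<phi> (\<lambda>y v. dderiv v \<phi> y)"
    unfolding local_chart_def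
  proof (intro conjI ballI allI)
    show "open W'" unfolding W'_def using J W(1) by (intro continuous_open_preimage) auto
    show "z \<in> W'" unfolding W'_def using W(2) Jiff[OF W(2)] bij by (simp add: dderiv_def bij_is_inj)
    show "\<phi> ` W' \<subseteq> U" using \<phi>(2) by (auto simp: W'_def)
    show "inj_on \<phi> W'"
    proof (rule inj_onI)
      fix a b assume "a \<in> W'" "b \<in> W'" "\<phi> a = \<phi> b"
      then have "X a = X b" "a \<in> V" "b \<in> V" using X W(3) by (auto simp: W'_def)
      then show "a = b" using inj by (auto dest: inj_onD)
    qed
    show "continuous_on W' (\<lambda>y. dderiv u \<phi> y)" for u
      using continuous_on_subset[OF c] by (simp add: W'_def)
  qed (use m X \<phi> Jiff in \<open>auto simp: W'_def intro: smooth_on_has_derivative\<close>)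
  moreover have "W' \<subseteq> V" using W(3) by (auto simp: W'_def)
  ultimately show thesis using that by blast
qed

lemma local_chart_in_surface:
  assumes lc: "local_chart A S X z c U I h W \<phi> \<phi>'" and y: "y \<in> W"
  shows "X y \<in> S"
proof -
  have "S \<inter> c ` (U \<times> I) = (\<lambda>x. c (x, h x)) ` U" using local_chartD(1)[OF lc] by (simp add: monge_def)
  moreover have "X y \<in> (\<lambda>x. c (x, h x)) ` U"
    unfolding local_chartD(11)[OF lc y] using local_chartD(10)[OF lc y] by (rule imageI)
  ultimately have "X y \<in> S \<inter> c ` (U \<times> I)" by (simp only:)
  then show ?thesis by (rule IntD1)
qed

context projective_coords
begin

text \<open>Needed because \<open>points_where\<close> may supply any Monge form at a given point.
  The new expression of the parametrization is the old one followed by the linear map of homogeneous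
  coordinates and division by the last coordinate.\<close>

lemma chart_change:
  assumes X: "smooth_parametrization A S V X" and z: "z \<in> V"
    and d: "monge A S d U' I' k" and x: "x \<in> U'" "X z = d (x, k x)"
  obtains W \<psi> \<psi>' where "local_chart A S X z d U' I' k W \<psi> \<psi>'" "\<psi> z = x"
proof -
  obtain c U I h W \<phi> \<phi>' where lc: "local_chart A S X z c U I h W \<phi> \<phi>'" and WV: "W \<subseteq> V"
    using smooth_parametrization_chart[OF X z] by metis
  note lcD = local_chartD[OF lc]
  have dA: "d \<in> A" and k: "smooth_on U' k" and op: "open U'" "open I'" and kI: "k ` U' \<subseteq> I'"
    and dS: "S \<inter> d ` (U' \<times> I') = (\<lambda>x. d (x, k x)) ` U'"
    using d by (auto simp: monge_def)
  obtain M :: "space \<times> real \<Rightarrow> space \<times> real" where M: "linear M" "bij M"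
    and Mcd: "\<And>a b. c a = d b \<longleftrightarrow> (\<exists>\<mu>. \<mu> \<noteq> 0 \<and> M (a, 1) = \<mu> *\<^sub>R (b, 1))"
    using transition[OF lcD(2) dA] by blast
  interpret M: bounded_linear M using M(1) by (simp add: linear_conv_bounded_linear)
  define N where "N y = M ((\<phi> y, h (\<phi> y)), 1)" for y
  define N' where "N' y u = M ((\<phi>' y u, dderiv (\<phi>' y u) h (\<phi> y)), 0)" for y u
  have N: "(N has_derivative N' y) (at y)" if "y \<in> W" for y
    unfolding N_def[abs_def] N'_def[abs_def]
    by (intro M.has_derivative has_derivative_Pair has_derivative_const lcD(12)[OF that]
        has_derivative_compose_smooth[OF lcD(5)] lcD(10)[OF that])
  have N'c: "continuous_on W (\<lambda>y. N' y u)" for u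
    unfolding N'_def
    by (intro M.continuous_on continuous_on_Pair continuous_on_const lcD(14) continuous_on_dderiv[OF lcD(5,15,8)])
  have Nc: "continuous_on W N"
    using N has_derivative_at_withinI has_derivative_continuous_on by blast
  \<comment> \<open>Affine coordinates of the lift \<open>N y\<close>. They are defined on
    \<open>W1\<close>, where the last coordinate does not vanish, and lie in the box of the new
    chart on \<open>W2\<close>.\<close>
  define b where "b y = fst (N y) /\<^sub>R snd (N y)" for y
  obtain \<mu> where \<mu>: "\<mu> \<noteq> 0" "N z = \<mu> *\<^sub>R ((x, k x), 1)"
    using Mcd[of "(\<phi> z, h (\<phi> z))" "(x, k x)"] lcD(11)[OF lcD(7)] x(2) unfolding N_def by metis
  have bz: "b z = (x, k x)" and sz: "snd (N z) \<noteq> 0" using \<mu> by (simp_all add: b_def)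
  define W1 where "W1 = W \<inter> (\<lambda>y. snd (N y)) -` (- {0})"
  have oW1: "open W1" unfolding W1_def
    by (intro continuous_open_preimage continuous_intros Nc lcD(6))
  have bc: "continuous_on W1 b"
    unfolding b_def by (intro continuous_intros continuous_on_subset[OF Nc]) (auto simp: W1_def)
  define W2 where "W2 = W1 \<inter> b -` (U' \<times> I')"
  have oW2: "open W2" unfolding W2_def by (intro continuous_open_preimage bc oW1 open_Times op)
  have zW2: "z \<in> W2" using lcD(7) sz bz x(1) kI by (auto simp: W2_def W1_def)
  have W2: "y \<in> W" "snd (N y) \<noteq> 0" "b y \<in> U' \<times> I'" if "y \<in> W2" for y
    using that unfolding W2_def W1_def by simp_all
  have Nb: "N y = snd (N y) *\<^sub>R (b y, 1)" if "y \<in> W2" for y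
    using W2(2)[OF that] by (simp add: b_def prod_eq_iff)
  have Xb: "X y = d (b y)" if "y \<in> W2" for y
  proof -
    have "M ((\<phi> y, h (\<phi> y)), 1) = N y" by (simp only: N_def)
    then have "M ((\<phi> y, h (\<phi> y)), 1) = snd (N y) *\<^sub>R (b y, 1)" using Nb[OF that] by (rule trans)
    with W2(2)[OF that] have "\<exists>\<mu>. \<mu> \<noteq> 0 \<and> M ((\<phi> y, h (\<phi> y)), 1) = \<mu> *\<^sub>R (b y, 1)"
      by (intro exI conjI)
    then have "c (\<phi> y, h (\<phi> y)) = d (b y)" unfolding Mcd .
    then show ?thesis using lcD(11) W2[OF that] by simp
  qed
  define \<psi> where "\<psi> y = fst (b y)" for y
  \<comment> \<open>Inside the box the surface is the graph of \<open>k\<close>, and this forces the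
    vertical coordinate.\<close>
  have b\<psi>: "b y = (\<psi> y, k (\<psi> y))" and \<psi>U: "\<psi> y \<in> U'" if "y \<in> W2" for y
  proof -
    have "X y \<in> S" by (rule local_chart_in_surface[OF lc W2(1)[OF that]])
    then have "X y \<in> S \<inter> d ` (U' \<times> I')" using imageI[OF W2(3)[OF that], of d] Xb[OF that] by simp
    then obtain x' where x': "x' \<in> U'" "X y = d (x', k x')" unfolding dS by (elim imageE)
    then have "b y = (x', k x')" using Xb[OF that] inj_coords[OF dA] by (simp add: inj_eq)
    then show "b y = (\<psi> y, k (\<psi> y))" "\<psi> y \<in> U'" using x' by (simp_all add: \<psi>_def)
  qed
  define \<psi>' where "\<psi>' y u = inverse (snd (N y)) *\<^sub>R fst (fst (N' y u))
      + (- (inverse (snd (N y)) * snd (N' y u) * inverse (snd (N y)))) *\<^sub>R fst (fst (N y))" for y u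
  have N_eq: "N y = snd (N y) *\<^sub>R ((\<psi> y, k (\<psi> y)), 1)" if "y \<in> W2" for y
    using Nb[OF that] unfolding b\<psi>[OF that] .
  have \<psi>: "(\<psi> has_derivative \<psi>' y) (at y)" if "y \<in> W2" for y
    unfolding \<psi>_def[abs_def] b_def \<psi>'_def[abs_def] fst_scaleR
    by (rule has_derivative_scaleR[OF Deriv.has_derivative_inverse[OF W2(2)[OF that] has_derivative_snd[OF N[OF W2(1)[OF that]]]]
        has_derivative_fst[OF has_derivative_fst[OF N[OF W2(1)[OF that]]]]])
  \<comment> \<open>A vector in the kernel would make the derivative of the lift proportional to the
    lift itself. Before applying \<open>M\<close> the derivative has last coordinate 0 and the lift
    has last coordinate 1, so the factor is 0, and injectivity of \<open>\<phi>' y\<close>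
    applies.\<close>
  have inj: "inj (\<psi>' y)" if y: "y \<in> W2" for y
  proof -
    have "u = 0" if u: "\<psi>' y u = 0" for u
    proof -
      have 1: "((\<lambda>y. snd (N y) *\<^sub>R ((\<psi> y, k (\<psi> y)), 1::real)) has_derivative
          (\<lambda>u. snd (N y) *\<^sub>R ((\<psi>' y u, dderiv (\<psi>' y u) k (\<psi> y)), 0) + snd (N' y u) *\<^sub>R ((\<psi> y, k (\<psi> y)), 1))) (at y)"
        by (intro has_derivative_scaleR has_derivative_snd has_derivative_Pair has_derivative_const
            N[OF W2(1)[OF y]] \<psi>[OF y] has_derivative_compose_smooth[OF k] \<psi>U[OF y])
      have "(N has_derivative
          (\<lambda>u. snd (N y) *\<^sub>R ((\<psi>' y u, dderiv (\<psi>' y u) k (\<psi> y)), 0) + snd (N' y u) *\<^sub>R ((\<psi> y, k (\<psi> y)), 1))) (at y)"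
        by (rule has_derivative_transform_within_open[OF 1 oW2 y]) (rule N_eq[symmetric])
      then have "N' y = (\<lambda>u. snd (N y) *\<^sub>R ((\<psi>' y u, dderiv (\<psi>' y u) k (\<psi> y)), 0) + snd (N' y u) *\<^sub>R ((\<psi> y, k (\<psi> y)), 1))"
        using N[OF W2(1)[OF y]] has_derivative_unique by blast
      then have "N' y u = snd (N y) *\<^sub>R ((\<psi>' y u, dderiv (\<psi>' y u) k (\<psi> y)), 0) + snd (N' y u) *\<^sub>R ((\<psi> y, k (\<psi> y)), 1)"
        by (rule fun_cong)
      moreover have "dderiv 0 k (\<psi> y) = 0"
        by (rule linear_0[OF linear_dderiv[OF smooth_on_differentiable[OF k \<psi>U[OF y]]]])
      ultimately have "N' y u = snd (N' y u) *\<^sub>R ((\<psi> y, k (\<psi> y)), 1)"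
        unfolding u zero_prod_def[symmetric] scaleR_zero_right add_0_left by (simp only: zero_prod_def[symmetric] scaleR_zero_right add_0_left)
      moreover have "(snd (N' y u) / snd (N y)) *\<^sub>R N y = snd (N' y u) *\<^sub>R ((\<psi> y, k (\<psi> y)), 1)"
      proof -
        have "(a / t) *\<^sub>R v = a *\<^sub>R w" if "v = t *\<^sub>R w" "t \<noteq> 0" for a t :: real and v w :: "space \<times> real"
          using that by simp
        then show ?thesis using N_eq[OF y] W2(2)[OF y] by blast
      qed
      ultimately have "N' y u = (snd (N' y u) / snd (N y)) *\<^sub>R N y" by simp
      then have "M ((\<phi>' y u, dderiv (\<phi>' y u) h (\<phi> y)), 0) = M ((snd (N' y u) / snd (N y)) *\<^sub>R ((\<phi> y, h (\<phi> y)), 1))"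
        by (simp only: N_def N'_def M.scaleR)
      then have e: "((\<phi>' y u, dderiv (\<phi>' y u) h (\<phi> y)), 0) = (snd (N' y u) / snd (N y)) *\<^sub>R ((\<phi> y, h (\<phi> y)), 1::real)"
        by (rule injD[OF bij_is_inj[OF M(2)]])
      have "snd (N' y u) / snd (N y) = 0" using arg_cong[OF e, of snd] by simp
      then have "\<phi>' y u = 0" using arg_cong[OF e, of "fst \<circ> fst"] by simp
      then show "u = 0"
        using lcD(13,16)[OF W2(1)[OF y]] by (metis linear_injective_0)
    qed
    moreover have "linear (\<psi>' y)" using \<psi>[OF y] has_derivative_linear by blast
    ultimately show ?thesis by (simp add: linear_injective_0)
  qed
  have "local_chart A S X z d U' I' k W2 \<psi> \<psi>'"
    unfolding local_chart_def
  proof (intro conjI ballI allI)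
    show "inj_on \<psi> W2"
    proof (rule inj_onI)
      fix p q assume pq: "p \<in> W2" "q \<in> W2" "\<psi> p = \<psi> q"
      then have "X p = X q" using Xb b\<psi> by simp
      moreover have "p \<in> V" "q \<in> V" using pq W2(1) WV by blast+
      moreover have "inj_on X V" using X by (simp add: smooth_parametrization_def)
      ultimately show "p = q" by (auto dest: inj_onD)
    qed
    show "continuous_on W2 (\<lambda>y. \<psi>' y u)" for u
      unfolding \<psi>'_def
      by (intro continuous_intros continuous_on_subset[OF Nc] continuous_on_subset[OF N'c])
         (use W2 in auto)
  show "\<psi> ` W2 \<subseteq> U'" using \<psi>U by blast
    show "X y = d (\<psi> y, k (\<psi> y))" if "y \<in> W2" for y using Xb[OF that] b\<psi>[OF that] by simp
  qed (fact d oW2 zW2 \<psi> inj)+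
  moreover have "\<psi> z = x" using bz by (simp add: \<psi>_def)
  ultimately show thesis using that by blast
qed

abbreviation pb_hessian :: "(plane \<Rightarrow> real) \<Rightarrow> (plane \<Rightarrow> plane) \<Rightarrow> (plane \<Rightarrow> plane \<Rightarrow> plane)
    \<Rightarrow> plane \<Rightarrow> plane \<Rightarrow> plane \<Rightarrow> real" where
  "pb_hessian h \<phi> \<phi>' z u w \<equiv> bil (hessian h (\<phi> z)) (\<phi>' z u) (\<phi>' z w)"

text \<open>
  The second fundamental form of a lift to \<open>real^4\<close> is its second derivative modulo the tangent space.
  In a Monge chart it is the Hessian; a rescaling of the lift multiplies it by a factor.
\<close>

lemma hessian_proportional:
  assumes lc: "local_chart A S X z c U I h W \<phi> \<phi>'"
    and ld: "local_chart A S X z d U' I' k W' \<psi> \<psi>'"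
  obtains l where "l \<noteq> 0"
    "\<And>u. pb_hessian h \<phi> \<phi>' z u u = l * pb_hessian k \<psi> \<psi>' z u u"
proof -
  note lcD = local_chartD[OF lc] and ldD = local_chartD[OF ld]
  obtain M :: "space \<times> real \<Rightarrow> space \<times> real" where M: "linear M" "bij M"
    and Mcd: "\<And>a b. c a = d b \<longleftrightarrow> (\<exists>\<mu>. \<mu> \<noteq> 0 \<and> M (a, 1) = \<mu> *\<^sub>R (b, 1))"
    using transition[OF lcD(2) ldD(2)] by blast
  interpret M: bounded_linear M using M(1) by (simp add: linear_conv_bounded_linear)
  have dk: "linear (\<lambda>v. dderiv v k (\<psi> z))"
    by (rule linear_dderiv[OF smooth_on_differentiable[OF ldD(5) ldD(10)[OF ldD(7)]]])
  have dh: "linear (\<lambda>v. dderiv v h (\<phi> z))"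
    by (rule linear_dderiv[OF smooth_on_differentiable[OF lcD(5) lcD(10)[OF lcD(7)]]])
  interpret dk: bounded_linear "\<lambda>v. dderiv v k (\<psi> z)" using dk by (simp add: linear_conv_bounded_linear)
  interpret dh: bounded_linear "\<lambda>v. dderiv v h (\<phi> z)" using dh by (simp add: linear_conv_bounded_linear)
  define N where "N y = M ((\<phi> y, h (\<phi> y)), 1)" for y
  have N: "snd (N y) \<noteq> 0 \<and> N y = snd (N y) *\<^sub>R ((\<psi> y, k (\<psi> y)), 1)" if "y \<in> W \<inter> W'" for y
  proof -
    have "c (\<phi> y, h (\<phi> y)) = d (\<psi> y, k (\<psi> y))" using lcD(11) ldD(11) that by fastforce
    then obtain \<mu> where \<mu>: "\<mu> \<noteq> 0" "N y = \<mu> *\<^sub>R ((\<psi> y, k (\<psi> y)), 1)" unfolding Mcd N_def by blast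
    then have "snd (N y) = \<mu>" by simp
    then show ?thesis using \<mu> by simp
  qed
  \<comment> \<open>The homogeneous equation of the tangent plane to the graph of \<open>k\<close>
    at \<open>\<psi> z\<close>. On the lifted graph it takes the value \<open>R\<close>, the
    deviation of \<open>k\<close> from its tangent plane.\<close>
  define l :: "space \<times> real \<Rightarrow> real" where
    "l w = snd (fst w) - dderiv (fst (fst w)) k (\<psi> z) - snd w * (k (\<psi> z) - dderiv (\<psi> z) k (\<psi> z))" for w
  have "linear l"
    by (rule linearI) (simp_all add: l_def dk.add dk.scaleR algebra_simps)
  then have "linear (l \<circ> M)" using M(1) by (rule linear_compose[rotated])
  then interpret lM: linear "l \<circ> M" .
  define p where "p a = l (M ((a, 0), 0))" for a
  define \<beta> where "\<beta> = l (M ((0, 1), 0))"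
  define \<kappa> where "\<kappa> = l (M ((0, 0), 1))"
  have lM: "l (M ((a, b), t)) = p a + \<beta> * b + \<kappa> * t" for a b t
  proof -
    have "((a, b), t) = ((a, 0), 0) + b *\<^sub>R ((0, 1), 0) + t *\<^sub>R ((0, 0), 1)" by simp
    then have "(l \<circ> M) ((a, b), t) = (l \<circ> M) ((a, 0), 0) + b *\<^sub>R (l \<circ> M) ((0, 1), 0) + t *\<^sub>R (l \<circ> M) ((0, 0), 1)"
      by (simp only: lM.add lM.scale)
    then show ?thesis by (simp add: p_def \<beta>_def \<kappa>_def)
  qed
  have p: "linear p"
  proof (rule linearI)
    show "p (a + b) = p a + p b" for a b
      using lM.add[of "((a, 0), 0)" "((b, 0), 0)"] by (simp add: p_def)
    show "p (r *\<^sub>R a) = r *\<^sub>R p a" for r a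
      using lM.scale[of r "((a, 0), 0)"] by (simp add: p_def)
  qed
  interpret p: bounded_linear p using p by (simp add: linear_conv_bounded_linear)
  define T where "T y = h (\<phi> y) - h (\<phi> z) - dderiv (\<phi> y - \<phi> z) h (\<phi> z)" for y
  define R where "R y = k (\<psi> y) - k (\<psi> z) - dderiv (\<psi> y - \<psi> z) k (\<psi> z)" for y
  define F where "F y = p (\<phi> y) + \<beta> * h (\<phi> y) + \<kappa>" for y
  have z: "z \<in> W \<inter> W'" using lcD(7) ldD(7) by simp
  have oW: "open (W \<inter> W')" using lcD(6) ldD(6) by blast
  \<comment> \<open>The same equation evaluated in both coordinate systems; \<open>snd (N y)\<close>
    is the factor between the two lifts.\<close>
  have FR: "F y = snd (N y) * R y" if "y \<in> W \<inter> W'" for y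
  proof -
    have "F y = l (N y)" unfolding N_def lM F_def by simp
    also have "\<dots> = l (snd (N y) *\<^sub>R ((\<psi> y, k (\<psi> y)), 1))" using N[OF that] by metis
    also have "\<dots> = snd (N y) * l ((\<psi> y, k (\<psi> y)), 1)" by (simp only: linear_scale[OF \<open>linear l\<close>] real_scaleR_def)
    also have "l ((\<psi> y, k (\<psi> y)), 1) = R y" by (simp add: l_def R_def dk.diff)
    finally show ?thesis .
  qed
  note D\<phi> = lcD(12)[OF lcD(7)] and D\<psi> = ldD(12)[OF ldD(7)]
  have Dh: "((\<lambda>y. h (\<phi> y)) has_derivative (\<lambda>u. dderiv (\<phi>' z u) h (\<phi> z))) (at z)"
    by (rule has_derivative_compose_smooth[OF lcD(5) D\<phi> lcD(10)[OF lcD(7)]])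
  have Dk: "((\<lambda>y. k (\<psi> y)) has_derivative (\<lambda>u. dderiv (\<psi>' z u) k (\<psi> z))) (at z)"
    by (rule has_derivative_compose_smooth[OF ldD(5) D\<psi> ldD(10)[OF ldD(7)]])
  have DN: "((\<lambda>y. snd (N y)) has_derivative (\<lambda>u. snd (M ((\<phi>' z u, dderiv (\<phi>' z u) h (\<phi> z)), 0)))) (at z)"
    unfolding N_def
    by (intro has_derivative_snd M.has_derivative has_derivative_Pair has_derivative_const D\<phi> Dh)
  have DR: "(R has_derivative (\<lambda>u. dderiv (\<psi>' z u) k (\<psi> z) - 0 - dderiv (\<psi>' z u - 0) k (\<psi> z))) (at z)"
    unfolding R_def[abs_def]
    by (intro has_derivative_diff dk.has_derivative has_derivative_const D\<psi> Dk)
  have "((\<lambda>y. snd (N y) * R y) has_derivative (\<lambda>u. snd (N z) * (dderiv (\<psi>' z u) k (\<psi> z) - 0 - dderiv (\<psi>' z u - 0) k (\<psi> z))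
      + snd (M ((\<phi>' z u, dderiv (\<phi>' z u) h (\<phi> z)), 0)) * R z)) (at z)"
    by (rule has_derivative_mult[OF DN DR])
  then have "((\<lambda>y. snd (N y) * R y) has_derivative (\<lambda>u. 0)) (at z)" by (simp add: R_def dk.zero)
  then have "(F has_derivative (\<lambda>u. 0)) (at z)"
    by (rule has_derivative_transform_within_open[OF _ oW z]) (rule FR[symmetric])
  moreover have "(F has_derivative (\<lambda>u. p (\<phi>' z u) + \<beta> * dderiv (\<phi>' z u) h (\<phi> z) + 0)) (at z)"
    unfolding F_def[abs_def]
    by (intro has_derivative_add p.has_derivative has_derivative_const has_derivative_mult_right D\<phi> Dh)
  ultimately have "(\<lambda>u. 0) = (\<lambda>u. p (\<phi>' z u) + \<beta> * dderiv (\<phi>' z u) h (\<phi> z) + 0)"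
    by (rule has_derivative_unique)
  then have *: "p (\<phi>' z u) + \<beta> * dderiv (\<phi>' z u) h (\<phi> z) = 0" for u by (metis add.right_neutral)
  have surj: "surj (\<phi>' z)"
    using linear_inj_imp_surj[OF lcD(16)[OF lcD(7)] lcD(13)[OF lcD(7)]] .
  have pa: "p a = - (\<beta> * dderiv a h (\<phi> z))" for a
  proof -
    obtain u where "a = \<phi>' z u" using surj by (metis surjD)
    then show ?thesis using *[of u] by (simp add: eq_neg_iff_add_eq_0)
  qed
  have "F z = 0" using FR[OF z] by (simp add: R_def dk.zero)
  \<comment> \<open>\<open>F\<close> vanishes to first order at \<open>z\<close>, so it is a
    multiple of the equation of the tangent plane to the graph of \<open>h\<close>.\<close>
  then have FT: "F y = \<beta> * T y" for y
  proof -
    have "F y = F y - F z" using \<open>F z = 0\<close> by simp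
    also have "\<dots> = p (\<phi> y) - p (\<phi> z) + \<beta> * (h (\<phi> y) - h (\<phi> z))" by (simp add: F_def algebra_simps)
    finally show ?thesis by (simp add: pa T_def dh.diff algebra_simps)
  qed
  \<comment> \<open>Otherwise \<open>l \<circ> M\<close> would vanish identically, but
    \<open>M\<close> is onto and \<open>l\<close> takes the value 1 on the vertical
    direction.\<close>
  have \<beta>: "\<beta> \<noteq> 0"
  proof
    assume 0: "\<beta> = 0"
    then have "p a = 0" for a using pa by simp
    moreover have "\<kappa> = 0" using \<open>F z = 0\<close> by (simp add: F_def 0 calculation)
    ultimately have "l (M w) = 0" for w using lM[of "fst (fst w)" "snd (fst w)" "snd w"] 0 by simp
    then have "l ((0, 1), 0) = 0" using M(2) by (metis bij_def surjD)
    then show False by (simp add: l_def dk.zero)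
  qed
  have cont: "isCont (\<lambda>y. snd (N y)) z"
    using DN has_derivative_continuous by blast
  \<comment> \<open>Both Hessians appear as limits after dividing
    \<open>\<beta> * T = snd (N y) * R\<close> by \<open>t\<^sup>2\<close>.\<close>
  have "\<beta> * pb_hessian h \<phi> \<phi>' z u u = snd (N z) * pb_hessian k \<psi> \<psi>' z u u" for u
  proof -
    have lim: "((\<lambda>t. z + t *\<^sub>R u) \<longlongrightarrow> z) (at 0)"
      by (rule tendsto_eq_intros refl | simp)+
    have 1: "((\<lambda>t. T (z + t *\<^sub>R u) / t\<^sup>2) \<longlongrightarrow> pb_hessian h \<phi> \<phi>' z u u / 2) (at 0)"
      unfolding T_def by (rule second_order_contact_limit[OF lcD(3,5) lcD(10)[OF lcD(7)] D\<phi>])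
    have 2: "((\<lambda>t. R (z + t *\<^sub>R u) / t\<^sup>2) \<longlongrightarrow> pb_hessian k \<psi> \<psi>' z u u / 2) (at 0)"
      unfolding R_def by (rule second_order_contact_limit[OF ldD(3,5) ldD(10)[OF ldD(7)] D\<psi>])
    have "((\<lambda>t. snd (N (z + t *\<^sub>R u)) * (R (z + t *\<^sub>R u) / t\<^sup>2)) \<longlongrightarrow>
        snd (N z) * (pb_hessian k \<psi> \<psi>' z u u / 2)) (at 0)"
      by (intro tendsto_mult 2 isCont_tendsto_compose[OF cont lim])
    moreover have "\<forall>\<^sub>F t in at 0. snd (N (z + t *\<^sub>R u)) * (R (z + t *\<^sub>R u) / t\<^sup>2) = \<beta> * (T (z + t *\<^sub>R u) / t\<^sup>2)"
      using topological_tendstoD[OF lim oW z]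
    proof (rule eventually_mono)
      fix t assume "z + t *\<^sub>R u \<in> W \<inter> W'"
      from FR[OF this] show "snd (N (z + t *\<^sub>R u)) * (R (z + t *\<^sub>R u) / t\<^sup>2) = \<beta> * (T (z + t *\<^sub>R u) / t\<^sup>2)"
        unfolding FT by simp
    qed
    ultimately have "((\<lambda>t. \<beta> * (T (z + t *\<^sub>R u) / t\<^sup>2)) \<longlongrightarrow>
        snd (N z) * (pb_hessian k \<psi> \<psi>' z u u / 2)) (at 0)"
      by (rule Lim_transform_eventually)
    moreover have "((\<lambda>t. \<beta> * (T (z + t *\<^sub>R u) / t\<^sup>2)) \<longlongrightarrow> \<beta> * (pb_hessian h \<phi> \<phi>' z u u / 2)) (at 0)"
      by (intro tendsto_mult tendsto_const 1)
    ultimately show ?thesis using tendsto_unique[OF trivial_limit_at] by fastforce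
  qed
  then have "pb_hessian h \<phi> \<phi>' z u u = (snd (N z) / \<beta>) * pb_hessian k \<psi> \<psi>' z u u" for u
    using \<beta> by (simp add: field_simps)
  moreover have "snd (N z) / \<beta> \<noteq> 0" using N[OF z] \<beta> by simp
  ultimately show thesis using that by blast
qed

end

section \<open>Changes of coordinates in affine and in projective space\<close>

lemma linear_inv_space:
  fixes L :: "'a::euclidean_space \<Rightarrow> 'b::euclidean_space"
  assumes "linear L" "bij L"
  shows "linear (inv L)"
proof (rule linearI)
  have s: "L (inv L x) = x" for x using assms(2) by (simp add: bij_is_surj surj_f_inv_f)
  have i: "inv L (L x) = x" for x using assms(2) by (simp add: bij_is_inj)
  show "inv L (a + b) = inv L a + inv L b" for a b
    by (metis i s linear_add[OF assms(1)])
  show "inv L (r *\<^sub>R a) = r *\<^sub>R inv L a" for r a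
    by (metis i s linear_scale[OF assms(1)])
qed

interpretation R3: projective_coords R3_coords
proof
  fix c :: "space \<Rightarrow> real^3" assume "c \<in> R3_coords"
  then show "inj c" by (auto simp: R3_coords_def inj_def bij_def)
next
  fix c d :: "space \<Rightarrow> real^3" assume "c \<in> R3_coords" "d \<in> R3_coords"
  then obtain K a L b where K: "linear K" "bij K" "c = (\<lambda>y. K y + a)" and L: "linear L" "bij L" "d = (\<lambda>y. L y + b)"
    unfolding R3_coords_def by blast
  have s: "L (inv L x) = x" for x using L(2) by (simp add: bij_is_surj surj_f_inv_f)
  have i: "inv L (L x) = x" for x using L(2) by (simp add: bij_is_inj)
  note inv = linear_inv_space[OF L(1,2)]
  \<comment> \<open>The affine change of coordinates in homogeneous form. It keeps the last
    coordinate, so here the factor \<open>\<mu>\<close> can only be 1.\<close>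
  define M where "M w = (inv L (K (fst w) + snd w *\<^sub>R (a - b)), snd w)" for w :: "space \<times> real"
  have M: "linear M"
    by (rule linearI) (simp_all add: M_def linear_add[OF inv] linear_scale[OF inv] linear_add[OF K(1)]
        linear_scale[OF K(1)] linear_diff[OF inv] algebra_simps)
  have "w = 0" if "M w = 0" for w
  proof -
    have "snd w = 0" "inv L (K (fst w)) = 0" using that by (auto simp: M_def zero_prod_def)
    then have "K (fst w) = 0" using s[of "K (fst w)"] linear_0[OF L(1)] by simp
    then have "fst w = 0" using linear_injective_0[OF K(1)] bij_is_inj[OF K(2)] by blast
    then show ?thesis using \<open>snd w = 0\<close> by (simp add: prod_eq_iff)
  qed
  then have "inj M" using M by (simp add: linear_injective_0)
  then have "bij M" using linear_inj_imp_surj[OF M] by (simp add: bij_def)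
  moreover have "c p = d q \<longleftrightarrow> (\<exists>\<mu>. \<mu> \<noteq> 0 \<and> M (p, 1) = \<mu> *\<^sub>R (q, 1))" for p q
  proof -
    have "c p = d q \<longleftrightarrow> L q = K p + (a - b)" by (auto simp: K L algebra_simps)
    also have "\<dots> \<longleftrightarrow> q = inv L (K p + (a - b))" using s i by metis
    also have "\<dots> \<longleftrightarrow> (\<exists>\<mu>. \<mu> \<noteq> 0 \<and> M (p, 1) = \<mu> *\<^sub>R (q, 1))" by (auto simp: M_def)
    finally show ?thesis .
  qed
  ultimately show "\<exists>M :: space \<times> real \<Rightarrow> space \<times> real. linear M \<and> bij M \<and>
      (\<forall>a b. c a = d b \<longleftrightarrow> (\<exists>\<mu>. \<mu> \<noteq> 0 \<and> M (a, 1) = \<mu> *\<^sub>R (b, 1)))"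
    using M by blast
qed

lemma proj_eq_iff:
  assumes "x \<noteq> 0" "y \<noteq> 0"
  shows "proj x = proj y \<longleftrightarrow> (\<exists>\<mu>. \<mu> \<noteq> 0 \<and> x = \<mu> *\<^sub>R y)"
proof -
  have "proj x = proj y \<longleftrightarrow> span {x} = span {y}"
    unfolding proj_def using assms by (intro Abs_rp3_inject) blast+
  also have "\<dots> \<longleftrightarrow> (\<exists>\<mu>. \<mu> \<noteq> 0 \<and> x = \<mu> *\<^sub>R y)"
  proof
    assume "span {x} = span {y}"
    then have "x \<in> span {y}" using span_base[of x "{x}"] by simp
    then obtain \<mu> where "x = \<mu> *\<^sub>R y" by (auto simp: span_singleton)
    then show "\<exists>\<mu>. \<mu> \<noteq> 0 \<and> x = \<mu> *\<^sub>R y" using assms(1) by auto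
  next
    assume "\<exists>\<mu>. \<mu> \<noteq> 0 \<and> x = \<mu> *\<^sub>R y"
    then obtain \<mu> where \<mu>: "\<mu> \<noteq> 0" "x = \<mu> *\<^sub>R y" by blast
    then have y: "y = inverse \<mu> *\<^sub>R x" by simp
    have "x \<in> span {y}" unfolding \<mu>(2) by (intro span_scale span_base) simp
    moreover have "y \<in> span {x}" unfolding y by (intro span_scale span_base) simp
    ultimately show "span {x} = span {y}"
      by (intro equalityI span_minimal subspace_span) auto
  qed
  finally show ?thesis .
qed

interpretation RP3: projective_coords RP3_coords
proof
  fix c :: "space \<Rightarrow> rp3" assume "c \<in> RP3_coords"
  then obtain L :: "space \<times> real \<Rightarrow> real^4" where L: "linear L" "bij L" "c = (\<lambda>y. proj (L (y, 1)))" unfolding RP3_coords_def by blast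
  have nz: "L (y, 1) \<noteq> 0" for y
    using L(1,2) by (metis bij_is_inj linear_injective_0 snd_conv snd_zero zero_neq_one)
  show "inj c"
  proof (rule injI)
    fix p q assume "c p = c q"
    then obtain \<mu> where "\<mu> \<noteq> 0" "L (p, 1) = \<mu> *\<^sub>R L (q, 1)" using proj_eq_iff[OF nz nz] by (auto simp: L(3))
    then have "L (p, 1) = L (\<mu> *\<^sub>R (q, 1))" by (simp only: linear_scale[OF L(1)])
    then have "(p, 1) = \<mu> *\<^sub>R (q, 1::real)" using L(2) by (meson bij_is_inj injD)
    then show "p = q" by simp
  qed
next
  fix c d :: "space \<Rightarrow> rp3" assume "c \<in> RP3_coords" "d \<in> RP3_coords"
  then obtain K L :: "space \<times> real \<Rightarrow> real^4" where K: "linear K" "bij K" "c = (\<lambda>y. proj (K (y, 1)))"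
    and L: "linear L" "bij L" "d = (\<lambda>y. proj (L (y, 1)))" unfolding RP3_coords_def by blast
  have nzK: "K (y, 1) \<noteq> 0" and nzL: "L (y, 1) \<noteq> 0" for y
    using K(1,2) L(1,2) by (metis bij_is_inj linear_injective_0 snd_conv snd_zero zero_neq_one)+
  have s: "L (inv L x) = x" for x using L(2) by (simp add: bij_is_surj surj_f_inv_f)
  have i: "inv L (L x) = x" for x using L(2) by (simp add: bij_is_inj)
  have "linear (inv L \<circ> K)" by (rule linear_compose[OF K(1) linear_inv_space[OF L(1,2)]])
  moreover have "bij (inv L \<circ> K)" by (rule bij_comp[OF K(2) bij_imp_bij_inv[OF L(2)]])
  moreover have "c p = d q \<longleftrightarrow> (\<exists>\<mu>. \<mu> \<noteq> 0 \<and> (inv L \<circ> K) (p, 1) = \<mu> *\<^sub>R (q, 1))" for p q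
  proof -
    have "c p = d q \<longleftrightarrow> (\<exists>\<mu>. \<mu> \<noteq> 0 \<and> K (p, 1) = \<mu> *\<^sub>R L (q, 1))"
      unfolding K(3) L(3) by (rule proj_eq_iff[OF nzK nzL])
    also have "\<dots> \<longleftrightarrow> (\<exists>\<mu>. \<mu> \<noteq> 0 \<and> K (p, 1) = L (\<mu> *\<^sub>R (q, 1)))" by (simp only: linear_scale[OF L(1)])
    also have "\<dots> \<longleftrightarrow> (\<exists>\<mu>. \<mu> \<noteq> 0 \<and> (inv L \<circ> K) (p, 1) = \<mu> *\<^sub>R (q, 1))" unfolding o_def using s i by metis
    finally show ?thesis .
  qed
  ultimately show "\<exists>M :: space \<times> real \<Rightarrow> space \<times> real. linear M \<and> bij M \<and>
      (\<forall>a b. c a = d b \<longleftrightarrow> (\<exists>\<mu>. \<mu> \<noteq> 0 \<and> M (a, 1) = \<mu> *\<^sub>R (b, 1)))" by blast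
qed

section \<open>Quadratic forms in the plane and asymptotic lines\<close>

text \<open>For the identity matrix this is Lagrange's identity; in general it computes the Gram
  determinant of two vectors. It is the link between the sign of \<open>det Q\<close> and null or
  indefinite vectors.\<close>

lemma bil_lagrange:
  assumes "Q $ 2 $ 1 = Q $ 1 $ 2"
  shows "bil Q v v * bil Q w w = (bil Q v w)\<^sup>2 + det Q * (v $ 1 * w $ 2 - v $ 2 * w $ 1)\<^sup>2"
  unfolding bil_def det_2 assms by (simp add: power2_eq_square algebra_simps)

lemma bil_linear_left: "linear (\<lambda>v. bil Q v w)"
  by (rule linearI) (simp_all add: bil_def algebra_simps)

lemma symmetric_matrix_eq_0:
  fixes Q :: "real^2^2"
  assumes "Q $ 2 $ 1 = Q $ 1 $ 2" "\<And>w. bil Q w w = 0"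
  shows "Q = 0"
proof -
  have "Q $ 1 $ 1 = 0" "Q $ 2 $ 2 = 0" "Q $ 1 $ 1 + 2 * Q $ 1 $ 2 + Q $ 2 $ 2 = 0"
    using assms(2)[of "vector [1, 0]"] assms(2)[of "vector [0, 1]"] assms(2)[of "vector [1, 1]"] assms(1)
    by (simp_all add: bil_def)
  then show ?thesis using assms(1) by (simp add: vec_eq_iff forall_2)
qed

lemma cross_eq_0_imp:
  fixes v w :: plane
  assumes "v \<noteq> 0" "v $ 1 * w $ 2 - v $ 2 * w $ 1 = 0"
  shows "w = ((v \<bullet> w) / (v \<bullet> v)) *\<^sub>R v"
proof -
  have vv: "v \<bullet> v \<noteq> 0" using assms(1) by simp
  have "(v \<bullet> v) *\<^sub>R w = (v \<bullet> w) *\<^sub>R v"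
  proof -
    have "(v \<bullet> v) * w $ 1 = (v \<bullet> w) * v $ 1 - v $ 2 * (v $ 1 * w $ 2 - v $ 2 * w $ 1)"
      by (simp add: inner_vec_def sum_2 algebra_simps)
    moreover have "(v \<bullet> v) * w $ 2 = (v \<bullet> w) * v $ 2 + v $ 1 * (v $ 1 * w $ 2 - v $ 2 * w $ 1)"
      by (simp add: inner_vec_def sum_2 algebra_simps)
    ultimately show ?thesis using assms(2) by (simp add: vec_eq_iff forall_2)
  qed
  then have "w = inverse (v \<bullet> v) *\<^sub>R ((v \<bullet> w) *\<^sub>R v)"
    using vv by (metis scaleR_scaleR left_inverse scaleR_one)
  then show ?thesis by (simp add: divide_inverse mult.commute)
qed

text \<open>By \<open>bil_lagrange\<close> a null vector of a degenerate form is orthogonal to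
  everything, and two independent ones would make the form zero. The factor is explicit so that it
  depends continuously on the vectors.\<close>

lemma kernel_unique:
  fixes Q :: "real^2^2"
  assumes Q: "Q $ 2 $ 1 = Q $ 1 $ 2" "Q \<noteq> 0" "det Q = 0"
    and v: "v \<noteq> 0" "bil Q v v = 0" and w: "bil Q w w = 0"
  shows "w = ((v \<bullet> w) / (v \<bullet> v)) *\<^sub>R v"
proof (rule cross_eq_0_imp[OF v(1)], rule ccontr)
  let ?c = "v $ 1 * w $ 2 - v $ 2 * w $ 1"
  assume c: "?c \<noteq> 0"
  have v0: "bil Q v u = 0" for u
    using bil_lagrange[OF Q(1), of v u] v Q(3) by simp
  have w0: "bil Q w u = 0" for u
    using bil_lagrange[OF Q(1), of w u] w Q(3) by simp
  have "bil Q u u = 0" for u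
  proof -
    have "?c *\<^sub>R u = (u $ 1 * w $ 2 - u $ 2 * w $ 1) *\<^sub>R v + (v $ 1 * u $ 2 - v $ 2 * u $ 1) *\<^sub>R w"
      by (simp add: vec_eq_iff forall_2 algebra_simps)
    then have "bil Q (?c *\<^sub>R u) u = (u $ 1 * w $ 2 - u $ 2 * w $ 1) * bil Q v u + (v $ 1 * u $ 2 - v $ 2 * u $ 1) * bil Q w u"
      by (simp add: linear_add[OF bil_linear_left] linear_scale[OF bil_linear_left])
    then show ?thesis using c v0 w0 by (simp add: linear_scale[OF bil_linear_left])
  qed
  then show False using symmetric_matrix_eq_0[OF Q(1)] Q(2) by blast
qed

text \<open>Like the next lemma, this rephrases the sign of the determinant by values of the form
  only, which makes it visibly stable under linear substitutions and nonzero factors.\<close>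

lemma det_neg_iff_indefinite:
  fixes Q :: "real^2^2"
  assumes Q: "Q $ 2 $ 1 = Q $ 1 $ 2"
  shows "det Q < 0 \<longleftrightarrow> (\<exists>v w. bil Q v v * bil Q w w < 0)"
proof
  assume d: "det Q < 0"
  show "\<exists>v w. bil Q v v * bil Q w w < 0"
  proof (cases "Q $ 1 $ 1 = 0")
    case False
    \<comment> \<open>The second vector is orthogonal to the first with respect to \<open>Q\<close>,
      as in completing the square.\<close>
    have "bil Q (vector [1, 0]) (vector [1, 0]) * bil Q (vector [- Q $ 1 $ 2, Q $ 1 $ 1]) (vector [- Q $ 1 $ 2, Q $ 1 $ 1])
        = (Q $ 1 $ 1)\<^sup>2 * det Q"
      by (simp add: bil_def det_2 Q power2_eq_square algebra_simps)
    also have "\<dots> < 0" using d False by (simp add: mult_pos_neg)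
    finally show ?thesis by blast
  next
    case True
    then have b: "Q $ 1 $ 2 \<noteq> 0" using d by (auto simp: det_2 Q)
    \<comment> \<open>Without the square of the first variable the form is linear in it, so it takes
      every value \<open>e\<close> already on vectors with second coordinate 1.\<close>
    have *: "bil Q (vector [(e - Q $ 2 $ 2) / (2 * Q $ 1 $ 2), 1]) (vector [(e - Q $ 2 $ 2) / (2 * Q $ 1 $ 2), 1]) = e" for e
      using b True by (simp add: bil_def Q field_simps)
    have "(1::real) * (- 1) < 0" by simp
    then show ?thesis using *[of 1] *[of "-1"] by metis
  qed
next
  assume "\<exists>v w. bil Q v v * bil Q w w < 0"
  then obtain v w where "bil Q v v * bil Q w w < 0" by blast
  then show "det Q < 0" unfolding bil_lagrange[OF Q]
    by (smt (verit) mult_nonneg_nonneg zero_le_power2)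
qed

lemma det_nonpos_iff_null:
  fixes Q :: "real^2^2"
  assumes Q: "Q $ 2 $ 1 = Q $ 1 $ 2"
  shows "det Q \<le> 0 \<longleftrightarrow> (\<exists>v. v \<noteq> 0 \<and> bil Q v v = 0)"
proof
  assume d: "det Q \<le> 0"
  define a b c where "a = Q $ 1 $ 1" and "b = Q $ 1 $ 2" and "c = Q $ 2 $ 2"
  have D: "b\<^sup>2 - a * c \<ge> 0" using d by (simp add: det_2 Q a_def b_def c_def power2_eq_square)
  show "\<exists>v. v \<noteq> 0 \<and> bil Q v v = 0"
  proof (cases "a = 0")
    case True
    then have "bil Q (vector [1, 0]) (vector [1, 0]) = 0" by (simp add: bil_def a_def)
    moreover have "(vector [1, 0] :: plane) \<noteq> 0" by (simp add: vec_eq_iff forall_2)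
    ultimately show ?thesis by blast
  next
    case False
    define r where "r = sqrt (b\<^sup>2 - a * c)"
    have r: "r\<^sup>2 = b\<^sup>2 - a * c" using D by (simp add: r_def)
    have "bil Q (vector [r - b, a]) (vector [r - b, a]) = a * (r\<^sup>2 - (b\<^sup>2 - a * c))"
      by (simp add: bil_def Q a_def b_def c_def power2_eq_square algebra_simps)
    moreover have "(vector [r - b, a] :: plane) \<noteq> 0" using False by (simp add: vec_eq_iff forall_2)
    ultimately show ?thesis using r by auto
  qed
next
  assume "\<exists>v. v \<noteq> 0 \<and> bil Q v v = 0"
  then obtain v where v: "v \<noteq> 0" "bil Q v v = 0" by blast
  show "det Q \<le> 0"
  proof (rule ccontr)
    assume d: "\<not> det Q \<le> 0"
    have "det Q * (v $ 1 * w $ 2 - v $ 2 * w $ 1)\<^sup>2 = 0" for w :: plane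
      using bil_lagrange[OF Q, of v w] v(2) d
      by (smt (verit) mult_eq_0_iff zero_le_power2 mult_nonneg_nonneg)
    then have "v $ 1 * w $ 2 - v $ 2 * w $ 1 = 0" for w :: plane using d by fastforce
    from this[of "vector [1, 0]"] this[of "vector [0, 1]"] have "v = 0" by (simp add: vec_eq_iff forall_2)
    then show False using v by simp
  qed
qed

text \<open>The equations compare coefficients in \<open>(p * x + q * y) * (r * x + s * y)\<close>;
  the factors come from the quadratic formula.\<close>

lemma binary_form_factorization:
  fixes a b c :: real
  assumes "b\<^sup>2 - a * c \<ge> 0"
  obtains p q r s where "a = p * r" "2 * b = p * s + q * r" "c = q * s"
proof (cases "a = 0")
  case True
  show thesis by (rule that[of 0 "2 * b" c 1]) (use True in auto)
next
  case False
  define t where "t = sqrt (b\<^sup>2 - a * c)"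
  have t: "t\<^sup>2 = b\<^sup>2 - a * c" using assms by (simp add: t_def)
  show thesis
  proof (rule that[of a 1 "(b - t) / a" "b + t"])
    have "(b + t) * ((b - t) / a) = (b\<^sup>2 - t\<^sup>2) / a" by (simp add: power2_eq_square algebra_simps)
    then show "c = (b + t) * ((b - t) / a)" using False by (simp add: t)
  qed (use False in auto)
qed

lemma span_singleton_eq_iff:
  fixes v w :: "'a::real_vector"
  assumes "v \<noteq> 0" "w \<noteq> 0"
  shows "span {v} = span {w} \<longleftrightarrow> (\<exists>k. v = k *\<^sub>R w)"
proof
  assume "span {v} = span {w}"
  then have "v \<in> span {w}" using span_base[of v "{v}"] by simp
  then show "\<exists>k. v = k *\<^sub>R w" by (auto simp: span_singleton)
next
  assume "\<exists>k. v = k *\<^sub>R w"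
  then obtain k where k: "v = k *\<^sub>R w" by blast
  then have "k \<noteq> 0" using assms(1) by auto
  then have w: "w = inverse k *\<^sub>R v" using k by simp
  have "v \<in> span {w}" unfolding k by (intro span_scale span_base) simp
  moreover have "w \<in> span {v}" unfolding w by (intro span_scale span_base) simp
  ultimately show "span {v} = span {w}"
    by (intro equalityI span_minimal subspace_span) auto
qed

text \<open>Asymptotic lines are the lifts by \<open>G\<close> to the tangent plane of the null
  lines of the Hessian. Unless the Hessian is definite it splits into two linear factors, whose zero
  lines coincide exactly if \<open>p * s - q * r\<close>, hence the discriminant, vanishes. For the
  zero Hessian every tangent line would be asymptotic.\<close>

lemma card_asymptotic_lines:
  assumes U: "open U" "smooth_on U h" "x \<in> U" and nz: "hessian h x \<noteq> 0"
  shows "card (asymptotic_lines h x) =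
    (if det (hessian h x) < 0 then 2 else if det (hessian h x) = 0 then 1 else 0)"
proof -
  let ?Q = "hessian h x"
  note sym = hessian_symmetric[OF U]
  define G :: "plane \<Rightarrow> space" where "G w = (w, dderiv w h x)" for w
  have "linear (\<lambda>w. dderiv w h x)" by (rule linear_dderiv[OF smooth_on_differentiable[OF U(2,3)]])
  then have Gs: "G (r *\<^sub>R w) = r *\<^sub>R G w" for r w
    unfolding G_def by (simp add: linear_scale[where f = "\<lambda>w. dderiv w h x"])
  have G0: "G w \<noteq> 0" if "w \<noteq> 0" for w using that by (simp add: G_def zero_prod_def)
  have lines: "asymptotic_lines h x = (\<lambda>w. span {G w}) ` {w. w \<noteq> 0 \<and> bil ?Q w w = 0}"
  proof -
    have "asymptotic h x v \<longleftrightarrow> (\<exists>w. w \<noteq> 0 \<and> bil ?Q w w = 0 \<and> v = G w)" for v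
      unfolding asymptotic_iff[OF U] G_def by (cases v) auto
    then have "{v. asymptotic h x v} = G ` {w. w \<noteq> 0 \<and> bil ?Q w w = 0}" by (simp add: set_eq_iff image_iff)
    then have "(\<lambda>v. span {v}) ` {v. asymptotic h x v} = (\<lambda>w. span {G w}) ` {w. w \<noteq> 0 \<and> bil ?Q w w = 0}"
      by (simp add: image_image)
    then show ?thesis by (simp only: asymptotic_lines_def setcompr_eq_image)
  qed
  show ?thesis
  proof (cases "det ?Q > 0")
    case True
    then have e: "{w. w \<noteq> 0 \<and> bil ?Q w w = 0} = {}" using det_nonpos_iff_null[OF sym] by force
    show ?thesis unfolding lines e using True by simp
  next
    case False
    then have "(?Q $ 1 $ 2)\<^sup>2 - ?Q $ 1 $ 1 * ?Q $ 2 $ 2 \<ge> 0" using det_hessian[OF U] by simp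
    then obtain p q r s where f: "?Q $ 1 $ 1 = p * r" "2 * ?Q $ 1 $ 2 = p * s + q * r" "?Q $ 2 $ 2 = q * s"
      by (rule binary_form_factorization)
    have bil: "bil ?Q w w = (p * w $ 1 + q * w $ 2) * (r * w $ 1 + s * w $ 2)" for w
    proof -
      have "bil ?Q w w = w $ 1 * w $ 1 * ?Q $ 1 $ 1 + w $ 1 * w $ 2 * (2 * ?Q $ 1 $ 2) + w $ 2 * w $ 2 * ?Q $ 2 $ 2"
        by (simp add: bil_def sym algebra_simps)
      then show ?thesis unfolding f by (simp add: algebra_simps)
    qed
    have d: "4 * det ?Q = - (p * s - q * r)\<^sup>2"
    proof -
      have "4 * det ?Q = 4 * (?Q $ 1 $ 1 * ?Q $ 2 $ 2) - (2 * ?Q $ 1 $ 2)\<^sup>2"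
        unfolding det_hessian[OF U] by (simp add: power2_eq_square)
      then show ?thesis unfolding f by (simp add: power2_eq_square algebra_simps)
    qed
    define v :: plane where "v = vector [- q, p]"
    define w :: plane where "w = vector [- s, r]"
    have nz': "?Q $ 1 $ 1 \<noteq> 0 \<or> ?Q $ 1 $ 2 \<noteq> 0 \<or> ?Q $ 2 $ 2 \<noteq> 0"
      using nz sym by (auto simp: vec_eq_iff forall_2)
    have v0: "v \<noteq> 0" and w0: "w \<noteq> 0" using nz' f by (auto simp: v_def w_def vec_eq_iff forall_2)
    have cross: "v $ 1 * w $ 2 - v $ 2 * w $ 1 = p * s - q * r" by (simp add: v_def w_def algebra_simps)
    have "asymptotic_lines h x = {span {G v}, span {G w}}"
    proof
      show "{span {G v}, span {G w}} \<subseteq> asymptotic_lines h x"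
        unfolding lines using v0 w0 by (auto simp: bil v_def w_def)
      show "asymptotic_lines h x \<subseteq> {span {G v}, span {G w}}"
      proof
        fix L assume "L \<in> asymptotic_lines h x"
        then obtain u where u: "u \<noteq> 0" "bil ?Q u u = 0" "L = span {G u}" unfolding lines by blast
        from u(2) have "v $ 1 * u $ 2 - v $ 2 * u $ 1 = 0 \<or> w $ 1 * u $ 2 - w $ 2 * u $ 1 = 0"
        proof -
          have "v $ 1 * u $ 2 - v $ 2 * u $ 1 = - (p * u $ 1 + q * u $ 2)"
            "w $ 1 * u $ 2 - w $ 2 * u $ 1 = - (r * u $ 1 + s * u $ 2)"
            by (simp_all add: v_def w_def)
          moreover have "p * u $ 1 + q * u $ 2 = 0 \<or> r * u $ 1 + s * u $ 2 = 0"
            using u(2) unfolding bil by simp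
          ultimately show ?thesis by auto
        qed
        then have "(\<exists>k. u = k *\<^sub>R v) \<or> (\<exists>k. u = k *\<^sub>R w)"
          using cross_eq_0_imp[OF v0] cross_eq_0_imp[OF w0] by blast
        then show "L \<in> {span {G v}, span {G w}}"
          unfolding u(3) using span_singleton_eq_iff[OF G0[OF u(1)] G0[OF v0]]
            span_singleton_eq_iff[OF G0[OF u(1)] G0[OF w0]] Gs by auto
      qed
    qed
    moreover have "span {G v} = span {G w} \<longleftrightarrow> p * s - q * r = 0"
    proof
      assume "span {G v} = span {G w}"
      then obtain k where "G v = k *\<^sub>R G w" using span_singleton_eq_iff[OF G0[OF v0] G0[OF w0]] by blast
      then have "v = k *\<^sub>R w" by (simp add: G_def)
      then show "p * s - q * r = 0" unfolding cross[symmetric] by simp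
    next
      assume "p * s - q * r = 0"
      then obtain k where "w = k *\<^sub>R v" using cross_eq_0_imp[OF v0, of w] cross by auto
      then have "span {G w} = span {G v}" using span_singleton_eq_iff[OF G0[OF w0] G0[OF v0]] Gs by auto
      then show "span {G v} = span {G w}" ..
    qed
    moreover have "det ?Q = 0 \<longleftrightarrow> p * s - q * r = 0" 
    proof -
      have "det ?Q = - ((p * s - q * r)\<^sup>2 / 4)" using d by simp
      then show ?thesis by simp
    qed
    ultimately show ?thesis using False by (auto simp: card_insert_if)
  qed
qed

lemma hyperbolic_at_iff:
  assumes "open U" "smooth_on U h" "x \<in> U" "hessian h x \<noteq> 0"
  shows "hyperbolic_at h x \<longleftrightarrow> det (hessian h x) < 0"
  unfolding hyperbolic_at_def card_asymptotic_lines[OF assms] by auto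

lemma parabolic_at_iff:
  assumes "open U" "smooth_on U h" "x \<in> U" "hessian h x \<noteq> 0"
  shows "parabolic_at h x \<longleftrightarrow> det (hessian h x) = 0"
  unfolding parabolic_at_def card_asymptotic_lines[OF assms] by auto

section \<open>The boundary circle in a Monge chart\<close>

definition circ :: "real \<Rightarrow> plane" where
  "circ s = cos s *\<^sub>R axis 1 1 + sin s *\<^sub>R axis 2 1"

definition tang :: "real \<Rightarrow> plane" where
  "tang s = - sin s *\<^sub>R axis 1 1 + cos s *\<^sub>R axis 2 1"

lemma circ_nth [simp]: "circ s $ 1 = cos s" "circ s $ 2 = sin s"
  by (simp_all add: circ_def axis_def)

lemma tang_nth [simp]: "tang s $ 1 = - sin s" "tang s $ 2 = cos s"
  by (simp_all add: tang_def axis_def)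

lemma norm_circ [simp]: "norm (circ s) = 1"
  by (simp add: norm_eq_1 inner_vec_def sum_2 flip: power2_eq_square)

lemma inner_circ [simp]:
  "circ s \<bullet> circ s = 1" "circ s \<bullet> tang s = 0"
  "tang s \<bullet> circ s = 0" "tang s \<bullet> tang s = 1"
  by (simp_all add: inner_vec_def sum_2 flip: power2_eq_square)

lemma circ_has_vector_derivative: "(circ has_vector_derivative tang s) (at s)"
  unfolding circ_def[abs_def] tang_def by (auto intro!: derivative_eq_intros)

lemma continuous_on_circ: "continuous_on S circ"
  unfolding circ_def[abs_def] by (intro continuous_intros)

lemma continuous_on_tang: "continuous_on S tang"
  unfolding tang_def[abs_def] by (intro continuous_intros)

lemma circ_frame: "u = (u \<bullet> circ s) *\<^sub>R circ s + (u \<bullet> tang s) *\<^sub>R tang s"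
proof -
  have k: "cos s * (cos s * x) + sin s * (sin s * x) = x" for x
  proof -
    have "cos s * (cos s * x) + sin s * (sin s * x) = ((cos s)\<^sup>2 + (sin s)\<^sup>2) * x"
      by (simp only: power2_eq_square distrib_right mult.assoc)
    then show ?thesis by simp
  qed
  show ?thesis
    by (simp add: vec_eq_iff forall_2 inner_vec_def sum_2 algebra_simps, simp add: k)
qed

lemma circ_periodic: "circ (s + 2 * pi) = circ s"
  by (simp add: circ_def)

lemma circ_rotate:
  "circ (s + t) = cos t *\<^sub>R circ s + sin t *\<^sub>R tang s"
  by (simp add: vec_eq_iff forall_2 cos_add sin_add algebra_simps)

lemma norm_1_imp_circ:
  assumes "norm (y :: plane) = 1"
  obtains s where "0 \<le> s" "s < 2 * pi" "y = circ s"
proof -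
  have "(y $ 1)\<^sup>2 + (y $ 2)\<^sup>2 = 1"
    using assms by (simp add: norm_eq_1 inner_vec_def sum_2 power2_eq_square)
  then obtain s where "0 \<le> s" "s < 2 * pi" "y $ 1 = cos s" "y $ 2 = sin s"
    using sincos_total_2pi by metis
  then show thesis using that by (simp add: vec_eq_iff forall_2)
qed

lemma circ_eq_near:
  assumes "circ s = circ t" "\<bar>s - t\<bar> < 2 * pi"
  shows "s = t"
proof -
  have "sin s = sin t \<and> cos s = cos t" using assms(1) by (metis circ_nth)
  then obtain n :: int where n: "s = t + 2 * pi * n" unfolding sin_cos_eq_iff by blast
  have "n = 0"
  proof (rule ccontr)
    assume "n \<noteq> 0"
    then have "1 \<le> \<bar>real_of_int n\<bar>" by linarith
    then have "2 * pi \<le> \<bar>2 * pi * n\<bar>" by (simp add: abs_mult)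
    then show False using n assms(2) by auto
  qed
  then show "s = t" using n by simp
qed

lemma circ_inj_on: "inj_on circ {0..<2 * pi}"
  by (rule inj_onI) (auto intro!: circ_eq_near)

text \<open>A local inverse of \<open>circ\<close>: the tangential coordinate is the sine of the
  angle, and positivity of the radial one excludes the opposite half of the circle.\<close>

lemma circ_near:
  assumes y: "norm y = 1" and pos: "y \<bullet> circ s > 0"
    and e: "0 < e" "e \<le> pi / 2" and small: "\<bar>y \<bullet> tang s\<bar> < sin e"
  shows "\<exists>t. \<bar>t\<bar> < e \<and> y = circ (s + t)"
proof -
  define a where "a = y \<bullet> tang s"
  define b where "b = y \<bullet> circ s"
  have yab: "y = b *\<^sub>R circ s + a *\<^sub>R tang s" unfolding a_def b_def by (rule circ_frame)
  have "y \<bullet> y = b\<^sup>2 + a\<^sup>2"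
  proof -
    have "y \<bullet> y = y \<bullet> (b *\<^sub>R circ s + a *\<^sub>R tang s)" using yab by simp
    also have "\<dots> = b\<^sup>2 + a\<^sup>2" by (simp add: inner_add_right a_def b_def power2_eq_square)
    finally show ?thesis .
  qed
  then have ab: "b\<^sup>2 = 1 - a\<^sup>2" using y by (simp add: norm_eq_1)
  have se: "sin e \<le> 1" by simp
  have a: "- sin e < a" "a < sin e" using small by (auto simp: a_def)
  then have a1: "- 1 \<le> a" "a \<le> 1" using se by linarith+
  define t where "t = arcsin a"
  have "arcsin a < arcsin (sin e)" by (rule arcsin_less_arcsin[OF a1(1) a(2) se])
  moreover have "arcsin (- sin e) < arcsin a" by (rule arcsin_less_arcsin[OF _ a(1) a1(2)]) simp
  ultimately have "\<bar>t\<bar> < e" using e by (simp add: t_def arcsin_minus arcsin_sin abs_less_iff)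
  moreover have "sin t = a" using a1 by (simp add: t_def)
  moreover have "cos t = b"
  proof -
    have "cos t = sqrt (1 - a\<^sup>2)" using a1 by (simp add: t_def cos_arcsin)
    then show ?thesis using ab pos by (metis b_def real_sqrt_abs abs_of_pos)
  qed
  ultimately show ?thesis using yab by (auto simp: circ_rotate)
qed

text \<open>
  \<open>\<phi>\<close> is the parametrization of the disc read in a Monge chart, \<open>\<phi>'\<close> its derivative, and
  \<open>f s\<close> is the angle from the asymptotic direction at \<open>circ s\<close> to the tangent of the circle, in units of \<open>pi\<close>.
\<close>

locale boundary_chart =
  fixes h :: "plane \<Rightarrow> real" and U :: "plane set" and \<phi> :: "plane \<Rightarrow> plane" and \<phi>' :: "plane \<Rightarrow> plane \<Rightarrow> plane"
    and W :: "plane set" and f :: "real \<Rightarrow> real"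
  assumes U: "open U" and h: "smooth_on U h" and generic: "x \<in> U \<Longrightarrow> generic_at h x"
    and W: "open W" and \<phi>_in: "y \<in> W \<Longrightarrow> \<phi> y \<in> U" and \<phi>_inj: "inj_on \<phi> W"
    and \<phi>_deriv: "y \<in> W \<Longrightarrow> (\<phi> has_derivative \<phi>' y) (at y)"
    and \<phi>'_inj: "y \<in> W \<Longrightarrow> inj (\<phi>' y)"
    and \<phi>'_cont: "continuous_on W (\<lambda>y. \<phi>' y u)"
    and inside: "y \<in> W \<Longrightarrow> norm y < 1 \<Longrightarrow> det (hessian h (\<phi> y)) < 0"
    and on_circle: "y \<in> W \<Longrightarrow> norm y = 1 \<Longrightarrow> det (hessian h (\<phi> y)) = 0"
    and f_cont: "isCont f s"
    and null: "circ s \<in> W \<Longrightarrow>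
      (let w = \<phi>' (circ s) (sin (pi * f s) *\<^sub>R circ s + cos (pi * f s) *\<^sub>R tang s) in
       bil (hessian h (\<phi> (circ s))) w w = 0)"
begin

text \<open>The differential of the Hessian determinant, with the symmetry of the Hessian already
  used.\<close>

definition dd :: "plane \<Rightarrow> plane \<Rightarrow> real" where
  "dd x w = hessian h x $ 1 $ 1 * dderiv w (\<lambda>x. hessian h x $ 2 $ 2) x
    + dderiv w (\<lambda>x. hessian h x $ 1 $ 1) x * hessian h x $ 2 $ 2
    - 2 * (hessian h x $ 1 $ 2 * dderiv w (\<lambda>x. hessian h x $ 1 $ 2) x)"

definition \<gamma> :: "real \<Rightarrow> plane" where "\<gamma> s = \<phi> (circ s)"

definition v :: "real \<Rightarrow> plane" where
  "v s = sin (pi * f s) *\<^sub>R circ s + cos (pi * f s) *\<^sub>R tang s"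

definition \<omega> :: "real \<Rightarrow> plane" where "\<omega> s = \<phi>' (circ s) (v s)"

text \<open>The derivative of the Hessian determinant across the boundary, along the outward
  radius.\<close>

definition \<rho> :: "real \<Rightarrow> real" where "\<rho> s = dd (\<gamma> s) (\<phi>' (circ s) (circ s))"

definition dom :: "real set" where "dom = {s. circ s \<in> W}"

section \<open>The Hessian determinant near the boundary curve\<close>

lemma sym: "x \<in> U \<Longrightarrow> hessian h x $ 2 $ 1 = hessian h x $ 1 $ 2"
  by (rule hessian_symmetric[OF U h])

lemma hess_nz: "x \<in> U \<Longrightarrow> hessian h x \<noteq> 0"
  using generic by (simp add: generic_at_def)

lemma hyperbolic_iff: "x \<in> U \<Longrightarrow> hyperbolic_at h x \<longleftrightarrow> det (hessian h x) < 0"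
  by (rule hyperbolic_at_iff[OF U h _ hess_nz])

lemma parabolic_iff: "x \<in> U \<Longrightarrow> parabolic_at h x \<longleftrightarrow> det (hessian h x) = 0"
  by (rule parabolic_at_iff[OF U h _ hess_nz])

lemma hess_deriv:
  "x \<in> U \<Longrightarrow> ((\<lambda>x. hessian h x $ i $ j) has_derivative (\<lambda>w. dderiv w (\<lambda>x. hessian h x $ i $ j) x)) (at x)"
  by (rule hessian_nth_has_derivative[OF h])

lemma det_deriv:
  assumes x: "x \<in> U"
  shows "((\<lambda>x. det (hessian h x)) has_derivative dd x) (at x)"
proof -
  have "dderiv w (\<lambda>x. hessian h x $ 2 $ 1) x = dderiv w (\<lambda>x. hessian h x $ 1 $ 2) x" for w
    by (rule dderiv_cong_open[OF U x sym])
  then show ?thesis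
    unfolding det_2 dd_def[abs_def]
    using has_derivative_diff[OF has_derivative_mult[OF hess_deriv[OF x, of 1 1] hess_deriv[OF x, of 2 2]]
        has_derivative_mult[OF hess_deriv[OF x, of 1 2] hess_deriv[OF x, of 2 1]]]
    by (simp add: sym[OF x])
qed

lemma dd_linear: "x \<in> U \<Longrightarrow> linear (dd x)"
  using det_deriv has_derivative_linear by blast

lemma dd_cont:
  assumes "continuous_on S a" "a ` S \<subseteq> U" "continuous_on S b"
  shows "continuous_on S (\<lambda>s. dd (a s) (b s))"
proof -
  have 1: "continuous_on S (\<lambda>s. hessian h (a s) $ i $ j)" for i j
    using continuous_on_compose2[OF smooth_on_continuous[OF hessian_nth_smooth[OF h]] assms(1,2)] .
  have 2: "continuous_on S (\<lambda>s. dderiv (b s) (\<lambda>x. hessian h x $ i $ j) (a s))" for i j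
    by (rule continuous_on_dderiv[OF hessian_nth_smooth[OF h] assms])
  show ?thesis unfolding dd_def by (intro continuous_intros 1 2)
qed

lemma \<phi>_cont: "continuous_on W \<phi>"
  using \<phi>_deriv has_derivative_at_withinI has_derivative_continuous_on by blast

lemma \<phi>'_linear: "y \<in> W \<Longrightarrow> linear (\<phi>' y)"
  using \<phi>_deriv has_derivative_linear by blast

lemma \<phi>'_nz: "y \<in> W \<Longrightarrow> u \<noteq> 0 \<Longrightarrow> \<phi>' y u \<noteq> 0"
  using \<phi>'_linear \<phi>'_inj linear_injective_0 by blast

lemma \<phi>'_cont2:
  assumes "continuous_on S a" "a ` S \<subseteq> W" "continuous_on S b"
  shows "continuous_on S (\<lambda>s. \<phi>' (a s) (b s))"
proof -
  have 1: "continuous_on S (\<lambda>s. \<phi>' (a s) u)" for u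
    using continuous_on_compose2[OF \<phi>'_cont assms(1,2)] .
  have "continuous_on S (\<lambda>s. b s $ 1 *\<^sub>R \<phi>' (a s) (axis 1 1) + b s $ 2 *\<^sub>R \<phi>' (a s) (axis 2 1))"
    by (intro continuous_intros 1 assms)
  moreover have "\<phi>' (a s) (b s) = b s $ 1 *\<^sub>R \<phi>' (a s) (axis 1 1) + b s $ 2 *\<^sub>R \<phi>' (a s) (axis 2 1)" if "s \<in> S" for s
  proof -
    have L: "linear (\<phi>' (a s))" using assms(2) that \<phi>'_linear by blast
    have "\<phi>' (a s) (b s) = \<phi>' (a s) (b s $ 1 *\<^sub>R axis 1 1 + b s $ 2 *\<^sub>R axis 2 1)"
      using plane_expand by metis
    then show ?thesis by (simp only: linear_add[OF L] linear_scale[OF L])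
  qed
  ultimately show ?thesis by (simp cong: continuous_on_cong)
qed

lemma open_dom: "open dom"
proof -
  have "open (circ -` W)"
    using continuous_on_circ[of UNIV] W by (simp add: continuous_on_open_vimage)
  then show ?thesis by (simp add: dom_def vimage_def)
qed

lemma circ_dom: "s \<in> dom \<Longrightarrow> circ s \<in> W" by (simp add: dom_def)

lemma \<gamma>_in: "s \<in> dom \<Longrightarrow> \<gamma> s \<in> U" using \<phi>_in circ_dom by (simp add: \<gamma>_def)

lemma det_\<gamma>: "s \<in> dom \<Longrightarrow> det (hessian h (\<gamma> s)) = 0"
  using on_circle circ_dom by (simp add: \<gamma>_def)

lemma \<gamma>_deriv: "s \<in> dom \<Longrightarrow> (\<gamma> has_vector_derivative \<phi>' (circ s) (tang s)) (at s)"
proof -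
  assume s: "s \<in> dom"
  have "(\<gamma> has_derivative (\<lambda>r. \<phi>' (circ s) (r *\<^sub>R tang s))) (at s)"
    unfolding \<gamma>_def[abs_def]
    using has_derivative_compose[OF circ_has_vector_derivative[unfolded has_vector_derivative_def] \<phi>_deriv[OF circ_dom[OF s]]] .
  then show ?thesis
    unfolding has_vector_derivative_def by (simp add: linear_scale[OF \<phi>'_linear[OF circ_dom[OF s]]])
qed

lemma \<gamma>_cont: "continuous_on dom \<gamma>"
  unfolding \<gamma>_def[abs_def]
  by (rule continuous_on_compose2[OF \<phi>_cont continuous_on_circ]) (auto simp: dom_def)

lemma v_cont: "continuous_on S v"
proof -
  have "continuous_on S f" using f_cont continuous_at_imp_continuous_on by blast
  then show ?thesis
    unfolding v_def[abs_def] by (intro continuous_intros continuous_on_circ continuous_on_tang)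
qed

lemma \<omega>_cont: "continuous_on dom \<omega>"
  unfolding \<omega>_def[abs_def]
  by (rule \<phi>'_cont2[OF continuous_on_circ _ v_cont]) (auto simp: dom_def)

lemma \<rho>_cont: "continuous_on dom \<rho>"
  unfolding \<rho>_def[abs_def]
  by (intro dd_cont \<gamma>_cont \<phi>'_cont2 continuous_on_circ) (auto simp: \<gamma>_in dom_def[symmetric] circ_dom)

lemma v_nz: "v s \<noteq> 0"
proof
  assume "v s = 0"
  then have "v s \<bullet> circ s = 0" "v s \<bullet> tang s = 0" by simp_all
  then have "sin (pi * f s) = 0" "cos (pi * f s) = 0" by (simp_all add: v_def inner_add_left)
  then show False using sin_cos_squared_add[of "pi * f s"] by simp
qed

lemma \<omega>_nz: "s \<in> dom \<Longrightarrow> \<omega> s \<noteq> 0"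
  unfolding \<omega>_def by (rule \<phi>'_nz[OF circ_dom v_nz])

lemma \<omega>_null: "s \<in> dom \<Longrightarrow> bil (hessian h (\<gamma> s)) (\<omega> s) (\<omega> s) = 0"
  using null[OF circ_dom] by (simp add: Let_def \<gamma>_def \<omega>_def v_def)

lemma dd_tangent:
  assumes s: "s \<in> dom"
  shows "dd (\<gamma> s) (\<phi>' (circ s) (tang s)) = 0"
proof -
  have "((\<lambda>s. det (hessian h (\<gamma> s))) has_derivative (\<lambda>r. dd (\<gamma> s) (r *\<^sub>R \<phi>' (circ s) (tang s)))) (at s)"
    using has_derivative_compose[OF \<gamma>_deriv[OF s, unfolded has_vector_derivative_def] det_deriv[OF \<gamma>_in[OF s]]] .
  moreover have "((\<lambda>s. det (hessian h (\<gamma> s))) has_derivative (\<lambda>r. 0)) (at s)"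
    by (rule has_derivative_transform_within_open[OF has_derivative_const[of 0] open_dom s]) (simp add: det_\<gamma>)
  ultimately have "(\<lambda>r. dd (\<gamma> s) (r *\<^sub>R \<phi>' (circ s) (tang s))) = (\<lambda>r. 0)"
    by (rule has_derivative_unique)
  from fun_cong[OF this, of 1] show ?thesis by simp
qed

text \<open>The determinant is constant along the boundary, so only the radial component
  \<open>sin (pi * f s)\<close> of \<open>v s\<close> contributes.\<close>

lemma dd_\<omega>:
  assumes s: "s \<in> dom"
  shows "dd (\<gamma> s) (\<omega> s) = sin (pi * f s) * \<rho> s"
  unfolding \<omega>_def v_def \<rho>_def
  using dd_tangent[OF s]
  by (simp add: linear_add[OF \<phi>'_linear[OF circ_dom[OF s]]] linear_scale[OF \<phi>'_linear[OF circ_dom[OF s]]]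
      linear_add[OF dd_linear[OF \<gamma>_in[OF s]]] linear_scale[OF dd_linear[OF \<gamma>_in[OF s]]])

lemma radial_deriv:
  assumes "r *\<^sub>R e \<in> W"
  shows "((\<lambda>r. det (hessian h (\<phi> (r *\<^sub>R e)))) has_real_derivative dd (\<phi> (r *\<^sub>R e)) (\<phi>' (r *\<^sub>R e) e)) (at r)"
proof -
  have 1: "((\<lambda>r. r *\<^sub>R e) has_derivative (\<lambda>t. t *\<^sub>R e)) (at r)"
    by (auto intro!: derivative_eq_intros)
  have "((\<lambda>r. det (hessian h (\<phi> (r *\<^sub>R e)))) has_derivative (\<lambda>t. dd (\<phi> (r *\<^sub>R e)) (\<phi>' (r *\<^sub>R e) (t *\<^sub>R e)))) (at r)"
    using has_derivative_compose[OF has_derivative_compose[OF 1 \<phi>_deriv[OF assms]] det_deriv[OF \<phi>_in[OF assms]]] .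
  then show ?thesis
    unfolding has_field_derivative_def
    by (rule has_derivative_eq_rhs)
       (simp add: fun_eq_iff linear_scale[OF \<phi>'_linear[OF assms]] linear_scale[OF dd_linear[OF \<phi>_in[OF assms]]])
qed

text \<open>In general position the determinant has a nonzero differential where it vanishes. As the
  tangential derivative is zero, the radial one is not, and its sign follows from the negative
  values inside the disc.\<close>

lemma \<rho>_pos:
  assumes s: "s \<in> dom"
  shows "\<rho> s > 0"
proof -
  have "\<rho> s \<noteq> 0"
  proof
    assume 0: "\<rho> s = 0"
    have "dd (\<gamma> s) (\<phi>' (circ s) u) = 0" for u
    proof -
      have "\<phi>' (circ s) u = (u \<bullet> circ s) *\<^sub>R \<phi>' (circ s) (circ s) + (u \<bullet> tang s) *\<^sub>R \<phi>' (circ s) (tang s)"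
        by (subst circ_frame[of u s])
          (simp only: linear_add[OF \<phi>'_linear[OF circ_dom[OF s]]] linear_scale[OF \<phi>'_linear[OF circ_dom[OF s]]])
      then show ?thesis
        using 0 dd_tangent[OF s]
        by (simp add: \<rho>_def linear_add[OF dd_linear[OF \<gamma>_in[OF s]]] linear_scale[OF dd_linear[OF \<gamma>_in[OF s]]])
    qed
    moreover have "surj (\<phi>' (circ s))"
      by (rule linear_inj_imp_surj[OF \<phi>'_linear[OF circ_dom[OF s]] \<phi>'_inj[OF circ_dom[OF s]]])
    ultimately have zero: "dd (\<gamma> s) w = 0" for w by (metis surjD)
    have "regular_zero (\<lambda>x. det (hessian h x)) (\<gamma> s)"
      using generic[OF \<gamma>_in[OF s]] by (simp add: generic_at_def)
    then have "surj (dd (\<gamma> s))"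
      using det_\<gamma>[OF s] frechet_derivative_at[OF det_deriv[OF \<gamma>_in[OF s]]] by (simp add: regular_zero_def)
    then obtain w where "1 = dd (\<gamma> s) w" by (rule surjE)
    then show False using zero by simp
  qed
  moreover have "\<not> \<rho> s < 0"
  proof
    assume "\<rho> s < 0"
    have "((\<lambda>r. det (hessian h (\<phi> (r *\<^sub>R circ s)))) has_real_derivative \<rho> s) (at 1)"
      using radial_deriv[of 1 "circ s"] circ_dom[OF s] by (simp add: \<rho>_def \<gamma>_def)
    from DERIV_neg_dec_left[OF this \<open>\<rho> s < 0\<close>] obtain d where d: "d > 0"
      "\<And>t. t > 0 \<Longrightarrow> t < d \<Longrightarrow> det (hessian h (\<phi> (1 *\<^sub>R circ s))) < det (hessian h (\<phi> ((1 - t) *\<^sub>R circ s)))"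
      by metis
    have "((\<lambda>t. (1 - t) *\<^sub>R circ s) \<longlongrightarrow> (1 - 0) *\<^sub>R circ s) (at_right 0)"
      by (intro tendsto_intros)
    then have "\<forall>\<^sub>F t in at_right 0. (1 - t) *\<^sub>R circ s \<in> W"
      by (rule topological_tendstoD) (use W circ_dom[OF s] in auto)
    moreover have "\<forall>\<^sub>F t in at_right 0. 0 < t \<and> t < min d 1"
      using d(1) by (intro eventually_at_rightI[of 0 "min d 1"]) auto
    ultimately have "\<forall>\<^sub>F t in at_right 0. (1 - t) *\<^sub>R circ s \<in> W \<and> 0 < t \<and> t < min d 1"
      by (rule eventually_conj)
    then obtain t where t: "(1 - t) *\<^sub>R circ s \<in> W" "0 < t" "t < min d 1"
      using eventually_happens'[OF trivial_limit_at_right_real] by blast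
    have "det (hessian h (\<phi> ((1 - t) *\<^sub>R circ s))) < 0" using t by (intro inside) auto
    moreover have "det (hessian h (\<phi> (1 *\<^sub>R circ s))) = 0" using det_\<gamma>[OF s] by (simp add: \<gamma>_def)
    ultimately show False using d(2)[of t] t by simp
  qed
  ultimately show ?thesis by linarith
qed

text \<open>The determinant is negative inside the circle and increases strictly along radii near
  it, so it cannot vanish again just outside. Invariance of domain ensures that the points so
  reached fill a neighbourhood in the chart.\<close>

lemma zero_set_near:
  assumes s: "s \<in> dom" and e: "e > 0"
  shows "\<forall>\<^sub>F x in nhds (\<gamma> s). det (hessian h x) = 0 \<longrightarrow> (\<exists>t\<in>dom. \<bar>t - s\<bar> < e \<and> x = \<gamma> t)"
proof -
  define z where "z = circ s"
  have zW: "z \<in> W" using circ_dom[OF s] by (simp add: z_def)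
  \<comment> \<open>Up to the factor \<open>norm y\<close>, the radial derivative of the
    determinant.\<close>
  define G where "G y = dd (\<phi> y) (\<phi>' y y)" for y
  have "continuous_on W G"
    unfolding G_def[abs_def]
    by (intro dd_cont \<phi>_cont \<phi>'_cont2 continuous_on_id) (auto simp: \<phi>_in)
  then have "open (W \<inter> G -` {0<..})" using W by (intro continuous_open_preimage) auto
  moreover have "z \<in> W \<inter> G -` {0<..}" using zW \<rho>_pos[OF s] by (simp add: G_def z_def \<rho>_def \<gamma>_def)
  ultimately obtain r where r: "r > 0" "ball z r \<subseteq> W \<inter> G -` {0<..}" using open_contains_ball by blast
  define d where "d = min e (pi / 2)"
  have d: "0 < d" "d \<le> pi / 2" "d \<le> e" using e by (auto simp: d_def)
  have sd: "sin d > 0" using d pi_gt_zero by (intro sin_gt_zero) linarith+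
  \<comment> \<open>The radius is halved so that, for a point outside the circle, the radial segment
    down to the circle stays in \<open>ball z r\<close>. The other two conditions are those of
    \<open>circ_near\<close>.\<close>
  define N where "N = ball z (r / 2) \<inter> {y. 0 < y \<bullet> circ s} \<inter> {y. \<bar>y \<bullet> tang s\<bar> < sin d}"
  have "open N" unfolding N_def
    by (intro open_Int open_ball open_Collect_less continuous_intros)
  have zN: "z \<in> N" using r(1) sd by (simp add: N_def z_def)
  have NW: "N \<subseteq> W" using r by (auto simp: N_def)
  have "open (\<phi> ` N)"
    by (rule invariance_of_domain[OF continuous_on_subset[OF \<phi>_cont NW] \<open>open N\<close> inj_on_subset[OF \<phi>_inj NW]])
  moreover have "\<gamma> s \<in> \<phi> ` N" using zN by (simp add: \<gamma>_def z_def)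
  ultimately have "\<forall>\<^sub>F x in nhds (\<gamma> s). x \<in> \<phi> ` N" by (rule eventually_nhds_in_open)
  then show ?thesis
  proof (rule eventually_mono, intro impI)
    fix x assume "x \<in> \<phi> ` N" and D0: "det (hessian h x) = 0"
    then obtain y where y: "y \<in> N" "x = \<phi> y" by blast
    have yW: "y \<in> W" using y(1) NW by blast
    have "y \<noteq> 0" using y(1) by (auto simp: N_def)
    have dist: "norm (z - y) < r / 2" using y(1) by (simp add: N_def dist_norm)
    have n1: "norm y \<ge> 1"
      using inside[OF yW] D0 y(2) by fastforce
    have "norm y = 1"
    proof (rule ccontr)
      assume "norm y \<noteq> 1"
      then have gt: "1 < norm y" using n1 by simp
      define u where "u = y /\<^sub>R norm y"
      have nu: "norm u = 1" using \<open>y \<noteq> 0\<close> by (simp add: u_def)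
      have yu: "y = norm y *\<^sub>R u" using \<open>y \<noteq> 0\<close> by (simp add: u_def)
      have near: "t *\<^sub>R u \<in> ball z r" if "1 \<le> t" "t \<le> norm y" for t
      proof -
        have "norm (y - t *\<^sub>R u) = norm y - t"
        proof -
          have "y - t *\<^sub>R u = (norm y - t) *\<^sub>R u" using yu by (simp add: scaleR_diff_left)
          then show ?thesis using that nu by simp
        qed
        also have "\<dots> \<le> norm y - norm z" using that by (simp add: z_def)
        also have "\<dots> \<le> norm (z - y)" using norm_triangle_ineq2[of y z] by (simp add: norm_minus_commute)
        finally have "norm (z - t *\<^sub>R u) \<le> norm (z - y) + norm (z - y)"
          using norm_triangle_ineq[of "z - y" "y - t *\<^sub>R u"] by simp
        then show ?thesis using dist by (simp add: dist_norm)
      qed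
      have inW: "t *\<^sub>R u \<in> W" if "1 \<le> t" "t \<le> norm y" for t using near[OF that] r(2) by blast
      \<comment> \<open>The determinant vanishes at both ends of the radial segment, on the circle
        and at \<open>y\<close>, which contradicts its strict increase.\<close>
      have "\<exists>t>1. t < norm y \<and> det (hessian h (\<phi> (norm y *\<^sub>R u))) - det (hessian h (\<phi> (1 *\<^sub>R u)))
          = (norm y - 1) * dd (\<phi> (t *\<^sub>R u)) (\<phi>' (t *\<^sub>R u) u)"
        by (rule MVT2[OF gt]) (rule radial_deriv[OF inW])
      then obtain t where t: "1 < t" "t < norm y" and eq: "det (hessian h (\<phi> (norm y *\<^sub>R u))) - det (hessian h (\<phi> (1 *\<^sub>R u)))
          = (norm y - 1) * dd (\<phi> (t *\<^sub>R u)) (\<phi>' (t *\<^sub>R u) u)" by blast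
      have "det (hessian h (\<phi> (1 *\<^sub>R u))) = 0" using on_circle[of u] inW[of 1] gt nu by simp
      moreover have "det (hessian h (\<phi> (norm y *\<^sub>R u))) = 0" using D0 y(2) yu by simp
      ultimately have 0: "dd (\<phi> (t *\<^sub>R u)) (\<phi>' (t *\<^sub>R u) u) = 0" using eq gt by simp
      have tW: "t *\<^sub>R u \<in> W" using inW t by simp
      have "G (t *\<^sub>R u) = t * dd (\<phi> (t *\<^sub>R u)) (\<phi>' (t *\<^sub>R u) u)"
        by (simp add: G_def linear_scale[OF \<phi>'_linear[OF tW]] linear_scale[OF dd_linear[OF \<phi>_in[OF tW]]])
      moreover have "G (t *\<^sub>R u) > 0" using near[of t] t r(2) by auto
      ultimately show False using 0 by simp
    qed
    moreover have "0 < y \<bullet> circ s" "\<bar>y \<bullet> tang s\<bar> < sin d" using y(1) by (auto simp: N_def)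
    ultimately obtain t where t: "\<bar>t\<bar> < d" "y = circ (s + t)" using circ_near[of y s d] d by blast
    have "s + t \<in> dom" using yW t(2) by (simp add: dom_def)
    moreover have "\<bar>(s + t) - s\<bar> < e" using t(1) d(3) by simp
    moreover have "x = \<gamma> (s + t)" using y(2) t(2) by (simp add: \<gamma>_def)
    ultimately show "\<exists>t\<in>dom. \<bar>t - s\<bar> < e \<and> x = \<gamma> t" by blast
  qed
qed

section \<open>Asymptotic directions and godrons along the boundary curve\<close>

lemma parabolic_\<gamma>: "s \<in> dom \<Longrightarrow> parabolic_at h (\<gamma> s)"
  using parabolic_iff[OF \<gamma>_in] det_\<gamma> by simp

lemma eventually_dom: "s \<in> dom \<Longrightarrow> \<forall>\<^sub>F t in at s. t \<in> dom"
  using open_dom by (rule eventually_at_in_open')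

text \<open>By \<open>zero_set_near\<close>, conditions on the nearby parabolic points of the chart
  become conditions on nearby parameters.\<close>

lemma eventually_parabolic_if:
  assumes s: "s \<in> dom" and R: "\<forall>\<^sub>F t in at s. R (\<gamma> t)"
  shows "\<forall>\<^sub>F x in at (\<gamma> s) within {x. parabolic_at h x}. R x"
proof -
  obtain e where e: "e > 0" "\<And>t. t \<noteq> s \<Longrightarrow> \<bar>t - s\<bar> < e \<Longrightarrow> R (\<gamma> t)"
    using R by (auto simp: eventually_at dist_real_def)
  have "\<forall>\<^sub>F x in nhds (\<gamma> s). x \<in> U" using U \<gamma>_in[OF s] by (rule eventually_nhds_in_open)
  then have "\<forall>\<^sub>F x in nhds (\<gamma> s). x \<noteq> \<gamma> s \<longrightarrow> x \<in> {x. parabolic_at h x} \<longrightarrow> R x"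
    using zero_set_near[OF s e(1)]
  proof eventually_elim
    case (elim x)
    show ?case
    proof (intro impI)
      assume ne: "x \<noteq> \<gamma> s" and "x \<in> {x. parabolic_at h x}"
      then have "det (hessian h x) = 0" using parabolic_iff elim by simp
      then obtain t where t: "\<bar>t - s\<bar> < e" "x = \<gamma> t" using elim by blast
      then show "R x" using e(2)[of t] ne by (cases "t = s") simp_all
    qed
  qed
  then show ?thesis by (simp add: eventually_at_filter)
qed

text \<open>The converse passage rests on injectivity: a nearby parameter different from
  \<open>s\<close> gives a parabolic point different from \<open>\<gamma> s\<close>.\<close>

lemma eventually_parabolic_imp:
  assumes s: "s \<in> dom" and R: "\<forall>\<^sub>F x in at (\<gamma> s) within {x. parabolic_at h x}. R x"
  shows "\<forall>\<^sub>F t in at s. R (\<gamma> t)"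
proof -
  have "\<forall>\<^sub>F x in nhds (\<gamma> s). x \<noteq> \<gamma> s \<longrightarrow> parabolic_at h x \<longrightarrow> R x"
    using R by (simp add: eventually_at_filter)
  moreover have "(\<gamma> \<longlongrightarrow> \<gamma> s) (at s)"
    using \<gamma>_cont open_dom s by (simp add: continuous_on_eq_continuous_at isCont_def)
  ultimately have "\<forall>\<^sub>F t in at s. \<gamma> t \<noteq> \<gamma> s \<longrightarrow> parabolic_at h (\<gamma> t) \<longrightarrow> R (\<gamma> t)"
    unfolding filterlim_iff by blast
  moreover have "\<forall>\<^sub>F t in at s. t \<noteq> s \<and> \<bar>t - s\<bar> < 2 * pi"
    by (auto simp: eventually_at dist_real_def intro!: exI[of _ "2 * pi"])
  ultimately show ?thesis using eventually_dom[OF s]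
  proof eventually_elim
    case (elim t)
    have "\<gamma> t \<noteq> \<gamma> s"
    proof
      assume "\<gamma> t = \<gamma> s"
      then have "circ t = circ s"
        using \<phi>_inj circ_dom s elim by (auto simp: \<gamma>_def dest: inj_onD)
      then show False using circ_eq_near elim by blast
    qed
    then show ?case using elim parabolic_\<gamma> by blast
  qed
qed

lemma dderiv_h_linear: "x \<in> U \<Longrightarrow> linear (\<lambda>w. dderiv w h x)"
  by (rule linear_dderiv[OF smooth_on_differentiable[OF h]])

definition asym :: "real \<Rightarrow> space" where "asym s = (\<omega> s, dderiv (\<omega> s) h (\<gamma> s))"

lemma asymptotic_\<gamma>:
  assumes s: "s \<in> dom"
  shows "asymptotic h (\<gamma> s) w \<longleftrightarrow> (\<exists>\<mu>. \<mu> \<noteq> 0 \<and> w = \<mu> *\<^sub>R asym s)"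
proof
  note x = \<gamma>_in[OF s]
  assume "asymptotic h (\<gamma> s) w"
  then have w: "fst w \<noteq> 0" "snd w = dderiv (fst w) h (\<gamma> s)" "bil (hessian h (\<gamma> s)) (fst w) (fst w) = 0"
    unfolding asymptotic_iff[OF U h x] by auto
  then obtain \<mu> where \<mu>: "fst w = \<mu> *\<^sub>R \<omega> s"
    using kernel_unique[OF sym[OF x] hess_nz[OF x] det_\<gamma>[OF s] \<omega>_nz[OF s] \<omega>_null[OF s]] by blast
  then have "\<mu> \<noteq> 0" "w = \<mu> *\<^sub>R asym s"
    using w by (auto simp: asym_def prod_eq_iff linear_scale[OF dderiv_h_linear[OF x]])
  then show "\<exists>\<mu>. \<mu> \<noteq> 0 \<and> w = \<mu> *\<^sub>R asym s" by blast
next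
  note x = \<gamma>_in[OF s]
  assume "\<exists>\<mu>. \<mu> \<noteq> 0 \<and> w = \<mu> *\<^sub>R asym s"
  then obtain \<mu> where "\<mu> \<noteq> 0" "w = \<mu> *\<^sub>R asym s" by blast
  then show "asymptotic h (\<gamma> s) w"
    unfolding asymptotic_iff[OF U h x]
    using \<omega>_nz[OF s] \<omega>_null[OF s] by (simp add: asym_def linear_scale[OF dderiv_h_linear[OF x]] bil_scale)
qed

text \<open>The determinant is 0 at the point itself, so its derivative along the half-line decides
  on which side this starts. At a godron the derivative vanishes and the test is silent.\<close>

lemma directed_iff:
  assumes s: "s \<in> dom" and nz: "dd (\<gamma> s) (fst w) \<noteq> 0"
  shows "directed_to_hyperbolic h (\<gamma> s) w \<longleftrightarrow> dd (\<gamma> s) (fst w) < 0"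
proof -
  note x = \<gamma>_in[OF s]
  define g where "g t = det (hessian h (\<gamma> s + t *\<^sub>R fst w))" for t
  have 1: "((\<lambda>t. \<gamma> s + t *\<^sub>R fst w) has_derivative (\<lambda>t. t *\<^sub>R fst w)) (at 0)"
    by (auto intro!: derivative_eq_intros)
  have "(g has_derivative (\<lambda>t. dd (\<gamma> s) (t *\<^sub>R fst w))) (at 0)"
    unfolding g_def[abs_def]
    using has_derivative_compose[OF 1, of "\<lambda>x. det (hessian h x)" "dd (\<gamma> s)"] det_deriv[OF x] by simp
  then have g: "(g has_real_derivative dd (\<gamma> s) (fst w)) (at 0)"
    unfolding has_field_derivative_def
    by (rule has_derivative_eq_rhs) (simp add: fun_eq_iff linear_scale[OF dd_linear[OF x]])
  have g0: "g 0 = 0" using det_\<gamma>[OF s] by (simp add: g_def)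
  have "((\<lambda>t. \<gamma> s + t *\<^sub>R fst w) \<longlongrightarrow> \<gamma> s + 0 *\<^sub>R fst w) (at_right 0)" by (intro tendsto_intros)
  then have "\<forall>\<^sub>F t in at_right 0. \<gamma> s + t *\<^sub>R fst w \<in> U"
    by (rule topological_tendstoD) (use U x in auto)
  then have ev: "\<forall>\<^sub>F t in at_right 0. hyperbolic_at h (\<gamma> s + t *\<^sub>R fst w) \<longleftrightarrow> g t < 0"
    by (rule eventually_mono) (simp add: hyperbolic_iff g_def)
  have dir: "directed_to_hyperbolic h (\<gamma> s) w \<longleftrightarrow> (\<forall>\<^sub>F t in at_right 0. g t < 0)"
    unfolding directed_to_hyperbolic_def using ev by (rule eventually_cong)
  show ?thesis
  proof (cases "dd (\<gamma> s) (fst w) < 0")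
    case True
    from DERIV_neg_dec_right[OF g this] obtain d where d: "d > 0" "\<And>t. 0 < t \<Longrightarrow> t < d \<Longrightarrow> g (0 + t) < g 0"
      by metis
    then have "\<forall>\<^sub>F t in at_right 0. g t < 0"
      using g0 by (intro eventually_at_rightI[of 0 d]) auto
    then show ?thesis using dir True by simp
  next
    case False
    then have "0 < dd (\<gamma> s) (fst w)" using nz by simp
    from DERIV_pos_inc_right[OF g this] obtain d where d: "d > 0" "\<And>t. 0 < t \<Longrightarrow> t < d \<Longrightarrow> g 0 < g (0 + t)"
      by metis
    then have pos: "\<forall>\<^sub>F t in at_right 0. g t > 0"
      using g0 by (intro eventually_at_rightI[of 0 d]) auto
    have "\<not> (\<forall>\<^sub>F t in at_right 0. g t < 0)"
    proof
      assume "\<forall>\<^sub>F t in at_right 0. g t < 0"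
      with pos have "\<forall>\<^sub>F t in at_right (0::real). False" by eventually_elim simp
      then show False by simp
    qed
    then show ?thesis using dir False by simp
  qed
qed

text \<open>As \<open>\<rho> s\<close> is positive, the condition is that the preimage
  \<open>\<mu> *\<^sub>R v s\<close> in the parameter plane has a negative radial component, that
  is, points into the disc.\<close>

lemma directed_asym:
  assumes s: "s \<in> dom" and nz: "sin (pi * f s) \<noteq> 0" and \<mu>: "\<mu> \<noteq> 0"
  shows "directed_to_hyperbolic h (\<gamma> s) (\<mu> *\<^sub>R asym s) \<longleftrightarrow> \<mu> * sin (pi * f s) < 0"
proof -
  have d: "dd (\<gamma> s) (fst (\<mu> *\<^sub>R asym s)) = (\<mu> * sin (pi * f s)) * \<rho> s"
    using dd_\<omega>[OF s] by (simp add: asym_def linear_scale[OF dd_linear[OF \<gamma>_in[OF s]]])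
  have "dd (\<gamma> s) (fst (\<mu> *\<^sub>R asym s)) \<noteq> 0" unfolding d using nz \<mu> \<rho>_pos[OF s] by simp
  then show ?thesis
    using directed_iff[OF s, of "\<mu> *\<^sub>R asym s"] \<rho>_pos[OF s] unfolding d by (simp add: mult_less_0_iff)
qed

lemma sin_pi_eq_0_iff: "sin (pi * x) = 0 \<longleftrightarrow> x \<in> \<int>" for x :: real
  unfolding sin_zero_iff_int2 Ints_def by (auto simp: mult.commute)

text \<open>The velocity of a curve of parabolic points is annihilated by the differential of the
  determinant, and by \<open>dd_\<omega>\<close> this happens to the asymptotic direction only if
  \<open>sin (pi * f s)\<close> vanishes. In that case the boundary curve itself serves as the
  required curve.\<close>

lemma godron_iff:
  assumes s: "s \<in> dom"
  shows "godron_at h (\<gamma> s) \<longleftrightarrow> f s \<in> \<int>"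
proof
  note x = \<gamma>_in[OF s]
  assume "godron_at h (\<gamma> s)"
  then obtain w \<eta> where w: "asymptotic h (\<gamma> s) w" and \<eta>: "\<eta> 0 = \<gamma> s" "(\<eta> has_vector_derivative fst w) (at 0)"
    "\<forall>\<^sub>F t in nhds 0. parabolic_at h (\<eta> t)" unfolding godron_at_def by blast
  obtain \<mu> where \<mu>: "\<mu> \<noteq> 0" "w = \<mu> *\<^sub>R asym s" using asymptotic_\<gamma>[OF s] w by blast
  have "(\<eta> \<longlongrightarrow> \<eta> 0) (nhds 0)"
    using has_vector_derivative_continuous[OF \<eta>(2)] by (simp add: isCont_def tendsto_at_iff_tendsto_nhds)
  then have "\<forall>\<^sub>F t in nhds 0. \<eta> t \<in> U" by (rule topological_tendstoD) (use U x \<eta> in auto)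
  with \<eta>(3) have "\<forall>\<^sub>F t in nhds 0. det (hessian h (\<eta> t)) = 0"
    by eventually_elim (simp add: parabolic_iff)
  then obtain T where T: "open T" "0 \<in> T" "\<And>t. t \<in> T \<Longrightarrow> det (hessian h (\<eta> t)) = 0"
    unfolding eventually_nhds by blast
  have "((\<lambda>t. det (hessian h (\<eta> t))) has_derivative (\<lambda>r. dd (\<gamma> s) (r *\<^sub>R fst w))) (at 0)"
    using has_derivative_compose[OF \<eta>(2)[unfolded has_vector_derivative_def], of "\<lambda>x. det (hessian h x)" "dd (\<gamma> s)"]
      det_deriv[OF x] \<eta>(1) by simp
  moreover have "((\<lambda>t. det (hessian h (\<eta> t))) has_derivative (\<lambda>r. 0)) (at 0)"
    by (rule has_derivative_transform_within_open[OF has_derivative_const[of 0] T(1,2)]) (simp add: T(3))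
  ultimately have "(\<lambda>r. dd (\<gamma> s) (r *\<^sub>R fst w)) = (\<lambda>r. 0)" by (rule has_derivative_unique)
  from fun_cong[OF this, of 1] have "dd (\<gamma> s) (fst w) = 0" by simp
  then have "\<mu> * (sin (pi * f s) * \<rho> s) = 0"
    using dd_\<omega>[OF s] by (simp add: \<mu>(2) asym_def linear_scale[OF dd_linear[OF x]])
  then show "f s \<in> \<int>" using \<mu>(1) \<rho>_pos[OF s] sin_pi_eq_0_iff by simp
next
  note x = \<gamma>_in[OF s]
  assume "f s \<in> \<int>"
  then have sin: "sin (pi * f s) = 0" by (simp add: sin_pi_eq_0_iff)
  \<comment> \<open>Here \<open>v s\<close> is \<open>b\<close> times \<open>tang s\<close>, with
    \<open>b\<close> equal to 1 or -1; running through the boundary curve at speed \<open>b\<close>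
    produces exactly the velocity \<open>\<omega> s\<close>.\<close>
  define b where "b = cos (pi * f s)"
  have \<omega>s: "\<omega> s = b *\<^sub>R \<phi>' (circ s) (tang s)"
    by (simp add: \<omega>_def v_def sin b_def linear_scale[OF \<phi>'_linear[OF circ_dom[OF s]]])
  define \<eta> where "\<eta> t = \<gamma> (s + b * t)" for t
  have 1: "((\<lambda>t. s + b * t) has_vector_derivative b) (at 0)"
    by (auto intro!: derivative_eq_intros)
  have "(\<eta> has_vector_derivative b *\<^sub>R \<phi>' (circ s) (tang s)) (at 0)"
    unfolding \<eta>_def[abs_def]
    using vector_diff_chain_at[OF 1, of \<gamma> "\<phi>' (circ s) (tang s)"] \<gamma>_deriv[OF s] by (simp add: o_def)
  moreover have "\<forall>\<^sub>F t in nhds 0. parabolic_at h (\<eta> t)"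
  proof -
    have "((\<lambda>t. s + b * t) \<longlongrightarrow> s + b * 0) (nhds 0)" by (intro tendsto_intros filterlim_ident)
    then have "\<forall>\<^sub>F t in nhds 0. s + b * t \<in> dom" by (rule topological_tendstoD) (use open_dom s in auto)
    then show ?thesis by (rule eventually_mono) (simp add: \<eta>_def parabolic_\<gamma>)
  qed
  moreover have "asymptotic h (\<gamma> s) (asym s)" unfolding asymptotic_\<gamma>[OF s] by (intro exI[of _ 1]) simp
  moreover have "fst (asym s) = b *\<^sub>R \<phi>' (circ s) (tang s)" by (simp add: asym_def \<omega>s)
  moreover have "\<eta> 0 = \<gamma> s" by (simp add: \<eta>_def)
  ultimately show "godron_at h (\<gamma> s)"
    unfolding godron_at_def using parabolic_\<gamma>[OF s] by metis
qed

end

text \<open>In all three differentiations \<open>w\<close> is constant, so the formula remains valid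
  when it is evaluated at a vector depending on \<open>x\<close>.\<close>

lemma cubic_form_expand:
  assumes U: "open U" and h: "smooth_on U h" and x: "x \<in> U"
  shows "cubic_form h x w = (w $ 1)\<^sup>2 * dderiv w (\<lambda>x. hessian h x $ 1 $ 1) x
    + 2 * (w $ 1 * w $ 2) * dderiv w (\<lambda>x. hessian h x $ 1 $ 2) x
    + (w $ 2)\<^sup>2 * dderiv w (\<lambda>x. hessian h x $ 2 $ 2) x"
proof -
  have "cubic_form h x w = dderiv w (dderiv w (dderiv w h)) x"
    by (simp add: cubic_form_def numeral_3_eq_3)
  also have "\<dots> = dderiv w (\<lambda>y. (w $ 1)\<^sup>2 * hessian h y $ 1 $ 1 + 2 * (w $ 1 * w $ 2) * hessian h y $ 1 $ 2
      + (w $ 2)\<^sup>2 * hessian h y $ 2 $ 2) x"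
  proof (rule dderiv_cong_open[OF U x])
    fix y assume y: "y \<in> U"
    show "dderiv w (dderiv w h) y = (w $ 1)\<^sup>2 * hessian h y $ 1 $ 1 + 2 * (w $ 1 * w $ 2) * hessian h y $ 1 $ 2
      + (w $ 2)\<^sup>2 * hessian h y $ 2 $ 2"
      unfolding dderiv_dderiv_hessian[OF U h y] bil_def hessian_symmetric[OF U h y]
      by (simp add: power2_eq_square algebra_simps)
  qed
  also have "\<dots> = (w $ 1)\<^sup>2 * dderiv w (\<lambda>x. hessian h x $ 1 $ 1) x
    + 2 * (w $ 1 * w $ 2) * dderiv w (\<lambda>x. hessian h x $ 1 $ 2) x
    + (w $ 2)\<^sup>2 * dderiv w (\<lambda>x. hessian h x $ 2 $ 2) x"
    by (rule dderiv_eqI[of _ "\<lambda>v. (w $ 1)\<^sup>2 * dderiv v (\<lambda>x. hessian h x $ 1 $ 1) x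
        + 2 * (w $ 1 * w $ 2) * dderiv v (\<lambda>x. hessian h x $ 1 $ 2) x
        + (w $ 2)\<^sup>2 * dderiv v (\<lambda>x. hessian h x $ 2 $ 2) x"])
      (intro has_derivative_add has_derivative_mult_right hessian_nth_has_derivative[OF h x])
  finally show ?thesis .
qed

section \<open>The cubic form at the kernel field and general position\<close>

context boundary_chart
begin

definition kf :: "2 \<Rightarrow> plane \<Rightarrow> plane" where "kf i x = kernel_field i h x"

text \<open>The entry of the Hessian that is nonzero where \<open>kf i\<close> is a nonzero kernel field.\<close>

definition entry :: "2 \<Rightarrow> plane \<Rightarrow> real" where
  "entry i x = (if i = 1 then hessian h x $ 2 $ 2 else hessian h x $ 1 $ 1)"

lemma kf_nth:
  assumes "x \<in> U"
  shows "kf i x $ 1 = (if i = 1 then hessian h x $ 2 $ 2 else - hessian h x $ 1 $ 2)"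
    "kf i x $ 2 = (if i = 1 then - hessian h x $ 1 $ 2 else hessian h x $ 1 $ 1)"
  by (simp_all add: kf_def kernel_field_def Let_def sym[OF assms])

text \<open>An algebraic identity at all points of the chart. On the parabolic curve the last term
  drops out, and the cubic form becomes a multiple of the derivative of the determinant along the
  kernel.\<close>

lemma cubic_form_kf:
  assumes x: "x \<in> U"
  shows "cubic_form h x (kf i x) =
    entry i x * dd x (kf i x) - det (hessian h x) * dderiv (kf i x) (entry i) x"
proof (cases "i = 1")
  case True
  then have e: "entry i = (\<lambda>x. hessian h x $ 2 $ 2)" by (simp add: entry_def fun_eq_iff)
  show ?thesis
    unfolding cubic_form_expand[OF U h x] det_hessian[OF U h x] e dd_def
    by (simp add: kf_nth[OF x] True power2_eq_square algebra_simps)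
next
  case False
  then have e: "entry i = (\<lambda>x. hessian h x $ 1 $ 1)" by (simp add: entry_def fun_eq_iff)
  show ?thesis
    unfolding cubic_form_expand[OF U h x] det_hessian[OF U h x] e dd_def
    by (simp add: kf_nth[OF x] False power2_eq_square algebra_simps)
qed

text \<open>Both the form and the vector at which it is taken vary with the point; together they
  give a polynomial in the Hessian entries and their partial derivatives.\<close>

lemma cubic_form_kf_differentiable:
  assumes x: "x \<in> U"
  shows "(\<lambda>x. cubic_form h x (kf i x)) differentiable (at x)"
proof -
  define a where "a x = (if i = 1 then hessian h x $ 2 $ 2 else - hessian h x $ 1 $ 2)" for x
  define b where "b x = (if i = 1 then - hessian h x $ 1 $ 2 else hessian h x $ 1 $ 1)" for x
  define q where "q j k l x = dderiv (axis j 1) (\<lambda>x. hessian h x $ k $ l) x" for j k l :: 2 and x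
  have q: "q j k l differentiable (at x)" for j k l
    unfolding q_def[abs_def]
    by (rule smooth_on_differentiable[OF smooth_on_dderiv[OF hessian_nth_smooth[OF h]] x])
  have H: "(\<lambda>x. hessian h x $ k $ l) differentiable (at x)" for k l
    by (rule smooth_on_differentiable[OF hessian_nth_smooth[OF h] x])
  have a: "a differentiable (at x)" unfolding a_def[abs_def] using H by (cases "i = 1") simp_all
  have b: "b differentiable (at x)" unfolding b_def[abs_def] using H by (cases "i = 1") simp_all
  define P where "P x = (a x)\<^sup>2 * (a x * q 1 1 1 x + b x * q 2 1 1 x)
      + 2 * (a x * b x) * (a x * q 1 1 2 x + b x * q 2 1 2 x) + (b x)\<^sup>2 * (a x * q 1 2 2 x + b x * q 2 2 2 x)" for x
  have "P differentiable (at x)"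
    unfolding P_def[abs_def]
    by (intro differentiable_add differentiable_mult differentiable_power differentiable_const a b q)
  then obtain P' where "(P has_derivative P') (at x)" unfolding differentiable_def by blast
  moreover have "P y = cubic_form h y (kf i y)" if y: "y \<in> U" for y
  proof -
    have d: "dderiv w (\<lambda>x. hessian h x $ k $ l) y = w $ 1 * q 1 k l y + w $ 2 * q 2 k l y" for w k l
      unfolding q_def using dderiv_expand[OF smooth_on_differentiable[OF hessian_nth_smooth[OF h] y], of w k l] by simp
    have "kf i y $ 1 = a y" "kf i y $ 2 = b y" by (simp_all add: kf_nth[OF y] a_def b_def)
    then show ?thesis unfolding cubic_form_expand[OF U h y] P_def d by simp
  qed
  ultimately have "((\<lambda>x. cubic_form h x (kf i x)) has_derivative P') (at x)"
    by (rule has_derivative_transform_within_open[OF _ U x])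
  then show ?thesis unfolding differentiable_def by blast
qed

lemma kf_null:
  assumes x: "x \<in> U" "det (hessian h x) = 0"
  shows "bil (hessian h x) (kf i x) (kf i x) = 0"
proof -
  have "bil (hessian h x) (kf i x) (kf i x) = entry i x * det (hessian h x)"
    unfolding bil_def det_hessian[OF U h x(1)] kf_nth[OF x(1)] sym[OF x(1)] entry_def
    by (cases "i = 1") (simp_all add: power2_eq_square algebra_simps)
  then show ?thesis using x(2) by simp
qed

lemma kf_continuous: "continuous_on dom (\<lambda>s. kf i (\<gamma> s))"
proof -
  have 1: "continuous_on dom (\<lambda>s. hessian h (\<gamma> s) $ k $ l)" for k l
    by (rule continuous_on_compose2[OF smooth_on_continuous[OF hessian_nth_smooth[OF h]] \<gamma>_cont])
       (auto simp: \<gamma>_in)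
  have e: "kf i (\<gamma> s) = (if i = 1 then hessian h (\<gamma> s) $ 2 $ 2 else - hessian h (\<gamma> s) $ 1 $ 2) *\<^sub>R axis 1 1
      + (if i = 1 then - hessian h (\<gamma> s) $ 1 $ 2 else hessian h (\<gamma> s) $ 1 $ 1) *\<^sub>R axis 2 1" if "s \<in> dom" for s
    using plane_expand[of "kf i (\<gamma> s)"] unfolding kf_nth[OF \<gamma>_in[OF that]] .
  have "continuous_on dom (\<lambda>s. (if i = 1 then hessian h (\<gamma> s) $ 2 $ 2 else - hessian h (\<gamma> s) $ 1 $ 2) *\<^sub>R axis 1 1
      + (if i = 1 then - hessian h (\<gamma> s) $ 1 $ 2 else hessian h (\<gamma> s) $ 1 $ 1) *\<^sub>R (axis 2 1 :: plane))"
    by (cases "i = 1") (auto intro!: continuous_intros 1)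
  then show ?thesis by (rule continuous_on_eq) (rule e[symmetric])
qed

lemma entry_continuous: "continuous_on dom (\<lambda>s. entry i (\<gamma> s))"
proof -
  have 1: "continuous_on dom (\<lambda>s. hessian h (\<gamma> s) $ k $ l)" for k l
    by (rule continuous_on_compose2[OF smooth_on_continuous[OF hessian_nth_smooth[OF h]] \<gamma>_cont])
       (auto simp: \<gamma>_in)
  then show ?thesis unfolding entry_def by (cases "i = 1") simp_all
qed

text \<open>
  Along the parabolic curve the cubic form at the kernel field is a nonvanishing multiple of
  \<open>sin (pi * f s)\<close>, while general position makes all its zeros simple.
\<close>

lemma sin_f_sign:
  assumes s: "s \<in> dom" and fs: "f s \<in> \<int>"
  obtains \<sigma> :: real where "\<sigma> = 1 \<or> \<sigma> = - 1" "\<forall>\<^sub>F t in at s. \<sigma> * (sin (pi * f t) * (t - s)) > 0"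
proof -
  note x = \<gamma>_in[OF s]
  have "\<exists>i. kf i (\<gamma> s) \<noteq> 0"
  proof (rule ccontr)
    assume "\<nexists>i. kf i (\<gamma> s) \<noteq> 0"
    then have "kf 1 (\<gamma> s) = 0" "kf 2 (\<gamma> s) = 0" by auto
    then have "kf 1 (\<gamma> s) $ 1 = 0" "kf 1 (\<gamma> s) $ 2 = 0" "kf 2 (\<gamma> s) $ 2 = 0" by simp_all
    then have "hessian h (\<gamma> s) = 0" using sym[OF x] by (simp add: kf_nth[OF x] vec_eq_iff forall_2)
    then show False using hess_nz[OF x] by simp
  qed
  then obtain i where i: "kf i (\<gamma> s) \<noteq> 0" by blast
  define C where "C x = cubic_form h x (kf i x)" for x
  obtain C' where C': "(C has_derivative C') (at (\<gamma> s))"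
    using cubic_form_kf_differentiable[OF x, of i] unfolding C_def[abs_def] differentiable_def by blast
  \<comment> \<open>The factor between the cubic form and \<open>sin (pi * f t)\<close>, with
    \<open>kf i\<close> expressed as a multiple of \<open>\<omega> t\<close> by
    \<open>kernel_unique\<close>.\<close>
  define m where "m t = entry i (\<gamma> t) * ((\<omega> t \<bullet> kf i (\<gamma> t)) / (\<omega> t \<bullet> \<omega> t)) * \<rho> t" for t
  have Cm: "C (\<gamma> t) = m t * sin (pi * f t)" if t: "t \<in> dom" for t
  proof -
    have k: "kf i (\<gamma> t) = ((\<omega> t \<bullet> kf i (\<gamma> t)) / (\<omega> t \<bullet> \<omega> t)) *\<^sub>R \<omega> t"
      by (rule kernel_unique[OF sym[OF \<gamma>_in[OF t]] hess_nz[OF \<gamma>_in[OF t]] det_\<gamma>[OF t] \<omega>_nz[OF t] \<omega>_null[OF t]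
            kf_null[OF \<gamma>_in[OF t] det_\<gamma>[OF t]]])
    have "dd (\<gamma> t) (kf i (\<gamma> t)) = ((\<omega> t \<bullet> kf i (\<gamma> t)) / (\<omega> t \<bullet> \<omega> t)) * (sin (pi * f t) * \<rho> t)"
      by (subst k) (simp only: linear_scale[OF dd_linear[OF \<gamma>_in[OF t]]] dd_\<omega>[OF t] real_scaleR_def)
    then show ?thesis unfolding C_def cubic_form_kf[OF \<gamma>_in[OF t]] det_\<gamma>[OF t] m_def by simp
  qed
  have "continuous_on dom m"
    unfolding m_def[abs_def]
    by (intro continuous_intros entry_continuous kf_continuous \<omega>_cont \<rho>_cont) (auto simp: \<omega>_nz)
  then have m_cont: "isCont m s" using open_dom s by (simp add: continuous_on_eq_continuous_at)
  have "m s \<noteq> 0"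
  proof -
    have d: "hessian h (\<gamma> s) $ 1 $ 1 * hessian h (\<gamma> s) $ 2 $ 2 = (hessian h (\<gamma> s) $ 1 $ 2)\<^sup>2"
      using det_\<gamma>[OF s] unfolding det_hessian[OF U h x] by simp
    have "entry i (\<gamma> s) \<noteq> 0"
    proof
      assume "entry i (\<gamma> s) = 0"
      then have "kf i (\<gamma> s) $ 1 = 0" "kf i (\<gamma> s) $ 2 = 0"
        using d by (auto simp: kf_nth[OF x] entry_def split: if_splits)
      then show False using i by (simp add: vec_eq_iff forall_2)
    qed
    moreover have "(\<omega> s \<bullet> kf i (\<gamma> s)) / (\<omega> s \<bullet> \<omega> s) \<noteq> 0"
      using i kernel_unique[OF sym[OF x] hess_nz[OF x] det_\<gamma>[OF s] \<omega>_nz[OF s] \<omega>_null[OF s]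
            kf_null[OF x det_\<gamma>[OF s]], of i] by force
    ultimately show ?thesis using \<rho>_pos[OF s] unfolding m_def by simp
  qed
  have C0: "C (\<gamma> s) = 0" using Cm[OF s] fs sin_pi_eq_0_iff by simp
  define w where "w = \<phi>' (circ s) (tang s)"
  have "w \<noteq> 0"
  proof -
    have "tang s \<noteq> 0" using inner_circ(4)[of s] by force
    then show ?thesis unfolding w_def by (rule \<phi>'_nz[OF circ_dom[OF s]])
  qed
  \<comment> \<open>Being onto, the derivative of this map between planes is injective. Its first
    component vanishes on the velocity \<open>w\<close> of the boundary curve, so the second does
    not: the zero of \<open>C\<close> along the curve is simple.\<close>
  have "regular_zero (\<lambda>x. (det (hessian h x), C x)) (\<gamma> s)"
    using generic[OF x] i unfolding generic_at_def C_def kf_def by blast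
  then have reg: "surj (frechet_derivative (\<lambda>x. (det (hessian h x), C x)) (at (\<gamma> s)))"
    using det_\<gamma>[OF s] C0 by (simp add: regular_zero_def zero_prod_def)
  have D: "((\<lambda>x. (det (hessian h x), C x)) has_derivative (\<lambda>u. (dd (\<gamma> s) u, C' u))) (at (\<gamma> s))"
    by (intro has_derivative_Pair det_deriv[OF x] C')
  have "surj (\<lambda>u. (dd (\<gamma> s) u, C' u))"
    using reg unfolding frechet_derivative_at[OF D, symmetric] .
  moreover have lin: "linear (\<lambda>u. (dd (\<gamma> s) u, C' u))" using D has_derivative_linear by blast
  ultimately have "inj (\<lambda>u. (dd (\<gamma> s) u, C' u))"
    by (intro linear_surjective_imp_injective) (simp_all add: dim_UNIV)
  then have "(dd (\<gamma> s) w, C' w) \<noteq> 0" using \<open>w \<noteq> 0\<close> linear_injective_0[OF lin] by blast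
  then have C'w: "C' w \<noteq> 0" using dd_tangent[OF s] by (simp add: w_def zero_prod_def)
  have "((\<lambda>t. C (\<gamma> t)) has_derivative (\<lambda>r. C' (r *\<^sub>R w))) (at s)"
    using has_derivative_compose[OF \<gamma>_deriv[OF s, unfolded has_vector_derivative_def] C'] by (simp add: w_def)
  moreover have "(\<lambda>r. C' (r *\<^sub>R w)) = (*) (C' w)"
    using linear_scale[OF has_derivative_linear[OF C']] by (auto simp: fun_eq_iff)
  ultimately have "((\<lambda>t. C (\<gamma> t)) has_real_derivative C' w) (at s)" by (simp add: has_field_derivative_def)
  then have "((\<lambda>t. (C (\<gamma> t) - C (\<gamma> s)) / (t - s)) \<longlongrightarrow> C' w) (at s)"
    by (simp add: has_field_derivative_iff)
  then have "((\<lambda>t. ((C (\<gamma> t) - C (\<gamma> s)) / (t - s)) * m t) \<longlongrightarrow> C' w * m s) (at s)"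
    using m_cont by (intro tendsto_mult) (auto simp: isCont_def)
  then have lim: "((\<lambda>t. sgn (C' w * m s) * (((C (\<gamma> t) - C (\<gamma> s)) / (t - s)) * m t)) \<longlongrightarrow> sgn (C' w * m s) * (C' w * m s)) (at s)"
    by (rule tendsto_mult[OF tendsto_const])
  define \<sigma> where "\<sigma> = sgn (C' w * m s)"
  have nz: "C' w * m s \<noteq> 0" using C'w \<open>m s \<noteq> 0\<close> by simp
  have "sgn x * x > 0" if "x \<noteq> 0" for x :: real using that by (cases "x > 0") auto
  from this[OF nz] have "\<sigma> * (C' w * m s) > 0" by (simp only: \<sigma>_def)
  then have "\<forall>\<^sub>F t in at s. 0 < \<sigma> * (((C (\<gamma> t) - C (\<gamma> s)) / (t - s)) * m t)"
    using order_tendstoD(1)[OF lim] by (simp add: \<sigma>_def)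
  moreover have "\<forall>\<^sub>F t in at s. t \<noteq> s" by (simp add: eventually_at_filter)
  ultimately have "\<forall>\<^sub>F t in at s. \<sigma> * (sin (pi * f t) * (t - s)) > 0"
    using eventually_dom[OF s]
  proof eventually_elim
    case (elim t)
    \<comment> \<open>The extra factor \<open>m t\<close> completes a square, which leaves the sign
      of \<open>sin (pi * f t) * (t - s)\<close>.\<close>
    have "\<sigma> * (((C (\<gamma> t) - C (\<gamma> s)) / (t - s)) * m t) = \<sigma> * (sin (pi * f t) * (t - s)) * (m t / (t - s))\<^sup>2"
      using elim C0 by (simp add: Cm power2_eq_square)
    then have "0 < \<sigma> * (sin (pi * f t) * (t - s)) * (m t / (t - s))\<^sup>2" using elim by simp
    then show ?case by (simp add: zero_less_mult_iff)
  qed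
  moreover have "\<sigma> = 1 \<or> \<sigma> = - 1" using nz by (auto simp: \<sigma>_def sgn_if)
  ultimately show thesis using that by blast
qed

section \<open>The sense of crossing and the index of a godron\<close>

lemma cos_pi_f: "f s \<in> \<int> \<Longrightarrow> (cos (pi * f s))\<^sup>2 = 1"
  using sin_pi_eq_0_iff[of "f s"] sin_cos_squared_add[of "pi * f s"] by simp

text \<open>At an integer, \<open>cos (pi * f s)\<close> is the sign given by its parity. Multiplied
  by it, the sine becomes \<open>sin (pi * (f t - f s))\<close>, whose argument stays between
  \<open>- pi\<close> and \<open>pi\<close>.\<close>

lemma sin_f_near:
  assumes fs: "f s \<in> \<int>"
  shows "\<forall>\<^sub>F t in at s. 0 < cos (pi * f s) * sin (pi * f t) \<longleftrightarrow> 0 < f t - f s"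
    and "\<forall>\<^sub>F t in at s. cos (pi * f s) * sin (pi * f t) < 0 \<longleftrightarrow> f t - f s < 0"
proof -
  have "(f \<longlongrightarrow> f s) (at s)" using f_cont by (simp add: isCont_def)
  then have "\<forall>\<^sub>F t in at s. dist (f t) (f s) < 1" by (rule tendstoD) simp
  then have *: "\<forall>\<^sub>F t in at s. (0 < cos (pi * f s) * sin (pi * f t) \<longleftrightarrow> 0 < f t - f s) \<and>
      (cos (pi * f s) * sin (pi * f t) < 0 \<longleftrightarrow> f t - f s < 0)"
  proof (rule eventually_mono)
    fix t assume "dist (f t) (f s) < 1"
    then have d: "\<bar>f t - f s\<bar> < 1" by (simp add: dist_real_def)
    define y where "y = pi * (f t - f s)"
    have "pi * f t = pi * f s + y" by (simp add: y_def algebra_simps)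
    then have "sin (pi * f t) = cos (pi * f s) * sin y"
      using fs by (simp add: sin_add sin_pi_eq_0_iff)
    then have e: "cos (pi * f s) * sin (pi * f t) = sin y"
      using cos_pi_f[OF fs] by (simp add: power2_eq_square flip: mult.assoc)
    have y: "- pi < y" "y < pi"
    proof -
      have "\<bar>y\<bar> = pi * \<bar>f t - f s\<bar>" by (simp add: y_def abs_mult)
      also have "\<dots> < pi * 1" using d pi_gt_zero by (intro mult_strict_left_mono) auto
      finally show "- pi < y" "y < pi" by auto
    qed
    have "0 < sin y" if "0 < y" using sin_gt_zero[OF that y(2)] .
    moreover have "sin y < 0" if "y < 0" using sin_gt_zero[of "- y"] that y(1) by simp
    moreover have "sin y = 0" if "y = 0" using that by simp
    ultimately have "(0 < sin y \<longleftrightarrow> 0 < y) \<and> (sin y < 0 \<longleftrightarrow> y < 0)"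
      by (cases y "0::real" rule: linorder_cases) auto
    moreover have "0 < y \<longleftrightarrow> 0 < f t - f s" "y < 0 \<longleftrightarrow> f t - f s < 0"
      using pi_gt_zero by (simp_all add: y_def zero_less_mult_iff mult_less_0_iff)
    ultimately show "(0 < cos (pi * f s) * sin (pi * f t) \<longleftrightarrow> 0 < f t - f s) \<and>
      (cos (pi * f s) * sin (pi * f t) < 0 \<longleftrightarrow> f t - f s < 0)" unfolding e by simp
  qed
  show "\<forall>\<^sub>F t in at s. 0 < cos (pi * f s) * sin (pi * f t) \<longleftrightarrow> 0 < f t - f s"
    using * by (rule eventually_mono) blast
  show "\<forall>\<^sub>F t in at s. cos (pi * f s) * sin (pi * f t) < 0 \<longleftrightarrow> f t - f s < 0"
    using * by (rule eventually_mono) blast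
qed

text \<open>General position gives a change of sign of \<open>sin (pi * f t)\<close> at
  \<open>s\<close>; the parity of \<open>f s\<close> then decides in which sense \<open>f\<close>
  crosses.\<close>

lemma crossing_dichotomy:
  assumes s: "s \<in> dom" and fs: "f s \<in> \<int>"
  shows "upcrossing f s \<or> downcrossing f s"
proof -
  obtain \<sigma> :: real where \<sigma>: "\<sigma> = 1 \<or> \<sigma> = - 1" "\<forall>\<^sub>F t in at s. \<sigma> * (sin (pi * f t) * (t - s)) > 0"
    by (rule sin_f_sign[OF s fs])
  have b: "cos (pi * f s) = 1 \<or> cos (pi * f s) = - 1" using cos_pi_f[OF fs] by (simp add: power2_eq_1_iff)
  consider "\<sigma> * cos (pi * f s) = 1" | "\<sigma> * cos (pi * f s) = - 1" using \<sigma>(1) b by auto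
  then show ?thesis
  proof cases
    case 1
    have "upcrossing f s"
      unfolding upcrossing_def using \<sigma>(2) sin_f_near[OF fs]
    proof eventually_elim
      case (elim t)
      have "cos (pi * f s) * sin (pi * f t) * (t - s) > 0" using elim(1) 1 \<sigma>(1) b by auto
      then show ?case using elim by (auto simp: zero_less_mult_iff)
    qed
    then show ?thesis ..
  next
    case 2
    have "downcrossing f s"
      unfolding downcrossing_def using \<sigma>(2) sin_f_near[OF fs]
    proof eventually_elim
      case (elim t)
      have "cos (pi * f s) * sin (pi * f t) * (t - s) < 0" using elim(1) 2 \<sigma>(1) b by auto
      then show ?case using elim by (auto simp: mult_less_0_iff)
    qed
    then show ?thesis ..
  qed
qed

definition \<kappa> :: "real \<Rightarrow> real \<Rightarrow> real" where
  "\<kappa> s t = asym t \<bullet> ((\<gamma> s, h (\<gamma> s)) - (\<gamma> t, h (\<gamma> t)))"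

text \<open>At the godron \<open>asym s\<close> is \<open>cos (pi * f s)\<close> times the velocity
  of the boundary curve in space, while the vector from the point at \<open>t\<close> to the godron
  is approximately \<open>- (t - s)\<close> times this velocity.\<close>

lemma \<kappa>_sign:
  assumes s: "s \<in> dom" and fs: "f s \<in> \<int>"
  shows "\<forall>\<^sub>F t in at s. cos (pi * f s) * \<kappa> s t * (t - s) < 0"
proof -
  note x = \<gamma>_in[OF s]
  define b where "b = cos (pi * f s)"
  have b2: "b * b = 1" using cos_pi_f[OF fs] by (simp add: b_def power2_eq_square)
  define w where "w = \<phi>' (circ s) (tang s)"
  have "tang s \<noteq> 0" using inner_circ(4)[of s] by force
  then have w0: "w \<noteq> 0" unfolding w_def by (rule \<phi>'_nz[OF circ_dom[OF s]])
  have sin: "sin (pi * f s) = 0" using fs by (simp add: sin_pi_eq_0_iff)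
  have \<omega>s: "\<omega> s = b *\<^sub>R w"
    by (simp add: \<omega>_def v_def sin b_def w_def linear_scale[OF \<phi>'_linear[OF circ_dom[OF s]]])
  have \<omega>lim: "(\<omega> \<longlongrightarrow> b *\<^sub>R w) (at s)"
    using \<omega>_cont s \<omega>s unfolding continuous_on_eq_continuous_at[OF open_dom] isCont_def by force
  have "continuous_on dom (\<lambda>t. dderiv (\<omega> t) h (\<gamma> t))"
    by (rule continuous_on_dderiv[OF h \<gamma>_cont _ \<omega>_cont]) (auto simp: \<gamma>_in)
  then have dlim: "((\<lambda>t. dderiv (\<omega> t) h (\<gamma> t)) \<longlongrightarrow> b * dderiv w h (\<gamma> s)) (at s)"
    using s \<omega>s linear_scale[OF dderiv_h_linear[OF x], of b w]
    unfolding continuous_on_eq_continuous_at[OF open_dom] isCont_def by force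
  have q: "((\<lambda>t. (\<gamma> t $ i - \<gamma> s $ i) / (t - s)) \<longlongrightarrow> w $ i) (at s)" for i
  proof -
    have "((\<lambda>t. \<gamma> t $ i) has_vector_derivative w $ i) (at s)"
      using bounded_linear.has_vector_derivative[OF bounded_linear_vec_nth \<gamma>_deriv[OF s]] by (simp add: w_def)
    then show ?thesis by (simp add: has_real_derivative_iff_has_vector_derivative[symmetric] has_field_derivative_iff)
  qed
  have hq: "((\<lambda>t. (h (\<gamma> t) - h (\<gamma> s)) / (t - s)) \<longlongrightarrow> dderiv w h (\<gamma> s)) (at s)"
  proof -
    have "((\<lambda>t. h (\<gamma> t)) has_derivative (\<lambda>r. dderiv (r *\<^sub>R w) h (\<gamma> s))) (at s)"
      using has_derivative_compose_smooth[OF h \<gamma>_deriv[OF s, unfolded has_vector_derivative_def] x] by (simp add: w_def)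
    moreover have "(\<lambda>r. dderiv (r *\<^sub>R w) h (\<gamma> s)) = (*) (dderiv w h (\<gamma> s))"
      using linear_scale[OF dderiv_h_linear[OF x]] by (auto simp: fun_eq_iff)
    ultimately have "((\<lambda>t. h (\<gamma> t)) has_real_derivative dderiv w h (\<gamma> s)) (at s)"
      by (simp add: has_field_derivative_def)
    then show ?thesis by (simp add: has_field_derivative_iff)
  qed
  \<comment> \<open>This is \<open>- \<kappa> s t / (t - s)\<close> written with difference
    quotients. Since \<open>b\<close> is 1 or -1, \<open>b * e t\<close> tends to the squared length
    of the velocity.\<close>
  define e where "e t = \<omega> t $ 1 * ((\<gamma> t $ 1 - \<gamma> s $ 1) / (t - s)) + \<omega> t $ 2 * ((\<gamma> t $ 2 - \<gamma> s $ 2) / (t - s))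
      + dderiv (\<omega> t) h (\<gamma> t) * ((h (\<gamma> t) - h (\<gamma> s)) / (t - s))" for t
  have "((\<lambda>t. e t) \<longlongrightarrow>
      (b *\<^sub>R w) $ 1 * w $ 1 + (b *\<^sub>R w) $ 2 * w $ 2 + b * dderiv w h (\<gamma> s) * dderiv w h (\<gamma> s)) (at s)"
    unfolding e_def by (intro tendsto_intros \<omega>lim dlim q hq)
  then have lim: "((\<lambda>t. b * e t) \<longlongrightarrow>
      b * ((b *\<^sub>R w) $ 1 * w $ 1 + (b *\<^sub>R w) $ 2 * w $ 2 + b * dderiv w h (\<gamma> s) * dderiv w h (\<gamma> s))) (at s)"
    by (rule tendsto_mult[OF tendsto_const])
  have "b * ((b *\<^sub>R w) $ 1 * w $ 1 + (b *\<^sub>R w) $ 2 * w $ 2 + b * dderiv w h (\<gamma> s) * dderiv w h (\<gamma> s))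
      = (b * b) * ((w $ 1)\<^sup>2 + (w $ 2)\<^sup>2 + (dderiv w h (\<gamma> s))\<^sup>2)"
    by (simp add: power2_eq_square algebra_simps)
  also have "\<dots> > 0"
  proof -
    have "(w $ 1)\<^sup>2 + (w $ 2)\<^sup>2 > 0"
      using w0 by (auto simp: vec_eq_iff forall_2 sum_power2_gt_zero_iff)
    then show ?thesis unfolding b2 by (simp add: add_pos_nonneg)
  qed
  finally have "\<forall>\<^sub>F t in at s. 0 < b * e t"
    using order_tendstoD(1)[OF lim] by blast
  moreover have "\<forall>\<^sub>F t in at s. t \<noteq> s" by (simp add: eventually_at_filter)
  ultimately show ?thesis
  proof eventually_elim
    case (elim t)
    have "b * e t * (t - s) = b * (\<omega> t $ 1 * ((\<gamma> t $ 1 - \<gamma> s $ 1) / (t - s) * (t - s))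
        + \<omega> t $ 2 * ((\<gamma> t $ 2 - \<gamma> s $ 2) / (t - s) * (t - s))
        + dderiv (\<omega> t) h (\<gamma> t) * ((h (\<gamma> t) - h (\<gamma> s)) / (t - s) * (t - s)))"
      by (simp only: e_def distrib_right mult.assoc)
    also have "\<dots> = b * (\<omega> t $ 1 * (\<gamma> t $ 1 - \<gamma> s $ 1) + \<omega> t $ 2 * (\<gamma> t $ 2 - \<gamma> s $ 2)
        + dderiv (\<omega> t) h (\<gamma> t) * (h (\<gamma> t) - h (\<gamma> s)))"
      using elim(2) by simp
    also have "\<dots> = - (b * \<kappa> s t)"
      by (simp add: \<kappa>_def asym_def inner_vec_def sum_2 algebra_simps)
    finally have "b * \<kappa> s t = - (b * e t * (t - s))" by simp
    then have "b * \<kappa> s t * (t - s) = - (b * e t * (t - s)\<^sup>2)" by (simp add: power2_eq_square)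
    also have "\<dots> < 0" using elim by simp
    finally show ?case by (simp add: b_def)
  qed
qed

text \<open>Three signs are multiplied: for \<open>v = \<mu> *\<^sub>R asym t\<close> directed to
  the hyperbolic domain, \<open>\<mu>\<close> is opposite to \<open>sin (pi * f t)\<close>,
  \<open>\<kappa> s t\<close> is opposite to \<open>cos (pi * f s) * (t - s)\<close>, and the
  product of sine and cosine has the sign of \<open>f t - f s\<close>.\<close>

lemma directed_inner_sign:
  assumes s: "s \<in> dom" and fs: "f s \<in> \<int>"
  shows "\<forall>\<^sub>F t in at s. \<forall>v. asymptotic h (\<gamma> t) v \<and> directed_to_hyperbolic h (\<gamma> t) v \<longrightarrow>
    (f t - f s) * (t - s) \<noteq> 0 \<longrightarrow>
    0 < (f t - f s) * (t - s) * (v \<bullet> ((\<gamma> s, h (\<gamma> s)) - (\<gamma> t, h (\<gamma> t))))"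
  using sin_f_near[OF fs] \<kappa>_sign[OF s fs] eventually_dom[OF s]
proof eventually_elim
  case (elim t)
  show ?case
  proof (intro allI impI)
    fix v
    assume v: "asymptotic h (\<gamma> t) v \<and> directed_to_hyperbolic h (\<gamma> t) v"
      and nz: "(f t - f s) * (t - s) \<noteq> 0"
    with elim obtain \<mu> where \<mu>: "\<mu> \<noteq> 0" "v = \<mu> *\<^sub>R asym t" using asymptotic_\<gamma> by blast
    have "sin (pi * f t) \<noteq> 0" using elim(1,2) nz by (cases "f t - f s" "0::real" rule: linorder_cases) auto
    then have m: "\<mu> * sin (pi * f t) < 0" using directed_asym \<mu> v elim by blast
    have "(\<mu> * sin (pi * f t)) * (cos (pi * f s) * \<kappa> s t * (t - s)) > 0"
      using m elim by (intro mult_neg_neg)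
    then have "(cos (pi * f s) * sin (pi * f t)) * ((t - s) * (\<mu> * \<kappa> s t)) > 0" by (simp add: ac_simps)
    then have "(f t - f s) * ((t - s) * (\<mu> * \<kappa> s t)) > 0"
      using elim(1,2) unfolding zero_less_mult_iff[of "cos (pi * f s) * sin (pi * f t)"] zero_less_mult_iff[of "f t - f s"]
      by blast
    then show "0 < (f t - f s) * (t - s) * (v \<bullet> ((\<gamma> s, h (\<gamma> s)) - (\<gamma> t, h (\<gamma> t))))"
      by (simp add: \<mu>(2) \<kappa>_def ac_simps)
  qed
qed

lemma upcrossing_imp_positive:
  assumes s: "s \<in> dom" and fs: "f s \<in> \<int>" and up: "upcrossing f s"
  shows "positive_godron_at h (\<gamma> s)"
  unfolding positive_godron_at_def
proof (intro conjI eventually_parabolic_if[OF s])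
  show "godron_at h (\<gamma> s)" using godron_iff[OF s] fs by simp
  show "\<forall>\<^sub>F t in at s. \<forall>v. asymptotic h (\<gamma> t) v \<and> directed_to_hyperbolic h (\<gamma> t) v \<longrightarrow>
      0 < v \<bullet> ((\<gamma> s, h (\<gamma> s)) - (\<gamma> t, h (\<gamma> t)))"
    using up[unfolded upcrossing_def] directed_inner_sign[OF s fs]
    by eventually_elim (metis less_irrefl zero_less_mult_pos)
qed

lemma downcrossing_imp_negative:
  assumes s: "s \<in> dom" and fs: "f s \<in> \<int>" and down: "downcrossing f s"
  shows "negative_godron_at h (\<gamma> s)"
  unfolding negative_godron_at_def
proof (intro conjI eventually_parabolic_if[OF s])
  show "godron_at h (\<gamma> s)" using godron_iff[OF s] fs by simp
  show "\<forall>\<^sub>F t in at s. \<forall>v. asymptotic h (\<gamma> t) v \<and> directed_to_hyperbolic h (\<gamma> t) v \<longrightarrow>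
      v \<bullet> ((\<gamma> s, h (\<gamma> s)) - (\<gamma> t, h (\<gamma> t))) < 0"
    using down[unfolded downcrossing_def] directed_inner_sign[OF s fs]
    by eventually_elim (metis less_asym less_irrefl zero_less_mult_iff)
qed

text \<open>Both conditions could hold together only vacuously, without any directed asymptotic
  vector nearby. But \<open>asym t\<close> times \<open>- sin (pi * f t)\<close> is directed, and
  this factor is nonzero near a godron.\<close>

lemma not_positive_and_negative:
  assumes s: "s \<in> dom" and fs: "f s \<in> \<int>"
  shows "\<not> (positive_godron_at h (\<gamma> s) \<and> negative_godron_at h (\<gamma> s))"
proof
  assume "positive_godron_at h (\<gamma> s) \<and> negative_godron_at h (\<gamma> s)"
  then have "\<forall>\<^sub>F x in at (\<gamma> s) within {x. parabolic_at h x}. \<forall>v. \<not> (asymptotic h x v \<and> directed_to_hyperbolic h x v)"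
  proof (elim conjE)
    assume "positive_godron_at h (\<gamma> s)" "negative_godron_at h (\<gamma> s)"
    then have
      "\<forall>\<^sub>F x in at (\<gamma> s) within {x. parabolic_at h x}. \<forall>v. asymptotic h x v \<and> directed_to_hyperbolic h x v \<longrightarrow>
         v \<bullet> ((\<gamma> s, h (\<gamma> s)) - (x, h x)) > 0"
      "\<forall>\<^sub>F x in at (\<gamma> s) within {x. parabolic_at h x}. \<forall>v. asymptotic h x v \<and> directed_to_hyperbolic h x v \<longrightarrow>
         v \<bullet> ((\<gamma> s, h (\<gamma> s)) - (x, h x)) < 0"
      unfolding positive_godron_at_def negative_godron_at_def by blast+
    then show ?thesis
      by eventually_elim (meson less_asym)
  qed
  then have "\<forall>\<^sub>F t in at s. \<forall>v. \<not> (asymptotic h (\<gamma> t) v \<and> directed_to_hyperbolic h (\<gamma> t) v)"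
    by (rule eventually_parabolic_imp[OF s])
  moreover obtain \<sigma> :: real where "\<forall>\<^sub>F t in at s. \<sigma> * (sin (pi * f t) * (t - s)) > 0"
    by (rule sin_f_sign[OF s fs])
  ultimately have "\<forall>\<^sub>F t in at s. False"
    using eventually_dom[OF s]
  proof eventually_elim
    case (elim t)
    then have nz: "sin (pi * f t) \<noteq> 0" by auto
    then have "directed_to_hyperbolic h (\<gamma> t) ((- sin (pi * f t)) *\<^sub>R asym t)"
    proof -
      have "- sin (pi * f t) * sin (pi * f t) < 0" using nz zero_less_power2[of "sin (pi * f t)"] by (simp add: power2_eq_square)
      then show ?thesis using directed_asym[OF elim(3) nz, of "- sin (pi * f t)"] nz by (simp only: neg_equal_0_iff_equal not_False_eq_True simp_thms)
    qed
    moreover have "asymptotic h (\<gamma> t) ((- sin (pi * f t)) *\<^sub>R asym t)"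
      using asymptotic_\<gamma>[OF elim(3)] nz by (metis neg_equal_0_iff_equal)
    ultimately show ?case using elim(1) by blast
  qed
  then show False by simp
qed

lemma positive_iff: "s \<in> dom \<Longrightarrow> f s \<in> \<int> \<Longrightarrow> positive_godron_at h (\<gamma> s) \<longleftrightarrow> upcrossing f s"
  using upcrossing_imp_positive downcrossing_imp_negative not_positive_and_negative crossing_dichotomy by blast

lemma negative_iff: "s \<in> dom \<Longrightarrow> f s \<in> \<int> \<Longrightarrow> negative_godron_at h (\<gamma> s) \<longleftrightarrow> \<not> upcrossing f s"
  using upcrossing_imp_positive downcrossing_imp_negative not_positive_and_negative crossing_dichotomy by blast

end

section \<open>Hyperbolic discs\<close>

locale disc_parametrization = projective_coords A
  for A :: "(space \<Rightarrow> 'a) set" +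
  fixes S :: "'a set" and V :: "plane set" and X :: "plane \<Rightarrow> 'a"
  assumes generic: "generic_surface A S"
    and X: "smooth_parametrization A S V X" and V: "cball 0 1 \<subseteq> V"
    and interior_hyperbolic: "X ` ball 0 1 \<subseteq> hyperbolic_domain A S"
    and boundary_parabolic: "X ` sphere 0 1 \<subseteq> parabolic_curve A S"
begin

section \<open>The type of the points of the disc in an arbitrary chart\<close>

lemma generic_chart:
  assumes "local_chart A S X z c U I h W \<phi> \<phi>'" "x \<in> U"
  shows "generic_at h x"
  using local_chartD(1)[OF assms(1)] assms(2) generic unfolding generic_surface_def by blast

lemma hessian_chart_nz:
  assumes "local_chart A S X z c U I h W \<phi> \<phi>'" "x \<in> U"
  shows "hessian h x \<noteq> 0"
  using generic_chart[OF assms] by (simp add: generic_at_def)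

lemma hessian_chart_sym:
  assumes "local_chart A S X z c U I h W \<phi> \<phi>'" "x \<in> U"
  shows "hessian h x $ 2 $ 1 = hessian h x $ 1 $ 2"
  using hessian_symmetric local_chartD(3,5)[OF assms(1)] assms(2) by blast

lemma chart_surj:
  assumes "local_chart A S X z c U I h W \<phi> \<phi>'"
  shows "surj (\<phi>' z)"
  using linear_inj_imp_surj[OF local_chartD(16)[OF assms] local_chartD(13)[OF assms]] local_chartD(7)[OF assms] by blast

lemma det_chart_iff:
  assumes lc: "local_chart A S X z c U I h W \<phi> \<phi>'"
  shows "det (hessian h (\<phi> z)) < 0 \<longleftrightarrow>
      (\<exists>u w. pb_hessian h \<phi> \<phi>' z u u * pb_hessian h \<phi> \<phi>' z w w < 0)"
    and "det (hessian h (\<phi> z)) \<le> 0 \<longleftrightarrow> (\<exists>u. u \<noteq> 0 \<and> pb_hessian h \<phi> \<phi>' z u u = 0)"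
proof -
  note z = local_chartD(7)[OF lc]
  note s = hessian_chart_sym[OF lc local_chartD(10)[OF lc z]]
  have sj: "\<exists>u. v = \<phi>' z u" for v using chart_surj[OF lc] by (metis surjD)
  have lin: "linear (\<phi>' z)" "inj (\<phi>' z)" using local_chartD(13,16)[OF lc z] by auto
  have nz: "\<phi>' z u = 0 \<longleftrightarrow> u = 0" for u
    using lin linear_injective_0[OF lin(1)] linear_0[OF lin(1)] by blast
  show "det (hessian h (\<phi> z)) < 0 \<longleftrightarrow>
      (\<exists>u w. pb_hessian h \<phi> \<phi>' z u u * pb_hessian h \<phi> \<phi>' z w w < 0)"
    unfolding det_neg_iff_indefinite[OF s] using sj by metis
  show "det (hessian h (\<phi> z)) \<le> 0 \<longleftrightarrow> (\<exists>u. u \<noteq> 0 \<and> pb_hessian h \<phi> \<phi>' z u u = 0)"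
    unfolding det_nonpos_iff_null[OF s] using sj nz by metis
qed

text \<open>Hyperbolicity and parabolicity of a point are given in some Monge chart; proportional
  Hessians have determinants of the same sign, since the factor enters squared, so that every chart
  may be used.\<close>

lemma det_chart_transfer:
  assumes lc: "local_chart A S X z c U I h W \<phi> \<phi>'"
    and ld: "local_chart A S X z d U' I' k W' \<psi> \<psi>'"
  shows "det (hessian h (\<phi> z)) < 0 \<longleftrightarrow> det (hessian k (\<psi> z)) < 0"
    and "det (hessian h (\<phi> z)) = 0 \<longleftrightarrow> det (hessian k (\<psi> z)) = 0"
proof -
  obtain l where l: "l \<noteq> 0"
    "\<And>u. pb_hessian h \<phi> \<phi>' z u u = l * pb_hessian k \<psi> \<psi>' z u u"
    using hessian_proportional[OF lc ld] by blast
  have "l * x * (l * y) < 0 \<longleftrightarrow> x * y < 0" for x y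
  proof -
    have e: "l * x * (l * y) = (l * l) * (x * y)" by (simp add: ac_simps)
    have l2: "l * l > 0" using l(1) by (metis not_real_square_gt_zero)
    have neg: "k * q < 0 \<longleftrightarrow> q < 0" if "k > 0" for k q :: real
      using that by (simp add: mult_less_0_iff)
    show ?thesis unfolding e by (rule neg[OF l2])
  qed
  then show 1: "det (hessian h (\<phi> z)) < 0 \<longleftrightarrow> det (hessian k (\<psi> z)) < 0"
    unfolding det_chart_iff(1)[OF lc] det_chart_iff(1)[OF ld] l(2) by simp
  have "det (hessian h (\<phi> z)) \<le> 0 \<longleftrightarrow> det (hessian k (\<psi> z)) \<le> 0"
    unfolding det_chart_iff(2)[OF lc] det_chart_iff(2)[OF ld] l(2) using l(1) by simp
  with 1 show "det (hessian h (\<phi> z)) = 0 \<longleftrightarrow> det (hessian k (\<psi> z)) = 0"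
    by linarith
qed

lemma chart_at_point:
  assumes z: "z \<in> cball 0 1" and p: "X z \<in> points_where A S P"
  obtains d U I k W \<psi> \<psi>' where "local_chart A S X z d U I k W \<psi> \<psi>'" "P k (\<psi> z)"
proof -
  obtain d U I k x where d: "X z = d (x, k x)" "monge A S d U I k" "x \<in> U" "P k x"
    using p unfolding points_where_def by blast
  obtain W \<psi> \<psi>' where "local_chart A S X z d U I k W \<psi> \<psi>'" "\<psi> z = x"
    by (rule chart_change[OF X _ d(2,3,1)]) (use z V in auto)
  then show thesis using that d(4) by blast
qed

lemma det_inside:
  assumes lc: "local_chart A S X z c U I h W \<phi> \<phi>'" and z: "norm z < 1"
  shows "det (hessian h (\<phi> z)) < 0"
proof -
  have "X z \<in> points_where A S hyperbolic_at"
    using interior_hyperbolic z unfolding hyperbolic_domain_def by auto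
  then obtain d U' I' k W' \<psi> \<psi>' where ld: "local_chart A S X z d U' I' k W' \<psi> \<psi>'"
    and "hyperbolic_at k (\<psi> z)"
    using chart_at_point[of z hyperbolic_at] z by (metis less_imp_le mem_cball_0)
  then have "det (hessian k (\<psi> z)) < 0"
    using hyperbolic_at_iff local_chartD(3,5,7,10)[OF ld] hessian_chart_nz[OF ld] by blast
  then show ?thesis using det_chart_transfer(1)[OF lc ld] by blast
qed

lemma det_boundary:
  assumes lc: "local_chart A S X z c U I h W \<phi> \<phi>'" and z: "norm z = 1"
  shows "det (hessian h (\<phi> z)) = 0"
proof -
  have "X z \<in> points_where A S parabolic_at"
    using boundary_parabolic z unfolding parabolic_curve_def by auto
  then obtain d U' I' k W' \<psi> \<psi>' where ld: "local_chart A S X z d U' I' k W' \<psi> \<psi>'"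
    and "parabolic_at k (\<psi> z)"
    using chart_at_point[of z parabolic_at] z by (metis order_refl mem_cball_0)
  then have "det (hessian k (\<psi> z)) = 0"
    using parabolic_at_iff local_chartD(3,5,7,10)[OF ld] hessian_chart_nz[OF ld] by blast
  then show ?thesis using det_chart_transfer(2)[OF lc ld] by blast
qed

lemma det_closed_disc:
  assumes "local_chart A S X z c U I h W \<phi> \<phi>'" "z \<in> cball 0 1"
  shows "det (hessian h (\<phi> z)) \<le> 0"
  using det_inside[OF assms(1)] det_boundary[OF assms(1)] assms(2) by (cases "norm z < 1") auto

section \<open>An asymptotic direction field on the closed disc\<close>

definition form_at :: "plane \<Rightarrow> real \<Rightarrow> real \<Rightarrow> real \<Rightarrow> bool" where
  "form_at y a b e \<longleftrightarrow> (\<exists>c U I h W \<phi> \<phi>'. local_chart A S X y c U I h W \<phi> \<phi>' \<and>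
     a = pb_hessian h \<phi> \<phi>' y (axis 1 1) (axis 1 1) \<and>
     b = pb_hessian h \<phi> \<phi>' y (axis 1 1) (axis 2 1) \<and>
     e = pb_hessian h \<phi> \<phi>' y (axis 2 1) (axis 2 1))"

lemma form_atE:
  assumes "form_at y a b e"
  obtains c U I h W \<phi> \<phi>' where "local_chart A S X y c U I h W \<phi> \<phi>'"
     "a = pb_hessian h \<phi> \<phi>' y (axis 1 1) (axis 1 1)"
     "b = pb_hessian h \<phi> \<phi>' y (axis 1 1) (axis 2 1)"
     "e = pb_hessian h \<phi> \<phi>' y (axis 2 1) (axis 2 1)"
  using assms unfolding form_at_def by (elim exE conjE) (rule that, assumption+)

lemma form_atI:
  assumes "local_chart A S X y c U I h W \<phi> \<phi>'"
  shows "form_at y (pb_hessian h \<phi> \<phi>' y (axis 1 1) (axis 1 1))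
      (pb_hessian h \<phi> \<phi>' y (axis 1 1) (axis 2 1))
      (pb_hessian h \<phi> \<phi>' y (axis 2 1) (axis 2 1))"
  unfolding form_at_def by (intro exI conjI, rule assms) (rule refl)+

lemma chart_form_expand:
  assumes lc: "local_chart A S X z c U I h W \<phi> \<phi>'"
  shows "pb_hessian h \<phi> \<phi>' z u u =
    pb_hessian h \<phi> \<phi>' z (axis 1 1) (axis 1 1) * (u $ 1)\<^sup>2
    + 2 * pb_hessian h \<phi> \<phi>' z (axis 1 1) (axis 2 1) * u $ 1 * u $ 2
    + pb_hessian h \<phi> \<phi>' z (axis 2 1) (axis 2 1) * (u $ 2)\<^sup>2"
proof -
  note z = local_chartD(7)[OF lc]
  note s = hessian_chart_sym[OF lc local_chartD(10)[OF lc z]]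
  have L: "linear (\<phi>' z)" by (rule local_chartD(16)[OF lc z])
  have "\<phi>' z u = u $ 1 *\<^sub>R \<phi>' z (axis 1 1) + u $ 2 *\<^sub>R \<phi>' z (axis 2 1)"
    by (subst plane_expand[of u]) (simp only: linear_add[OF L] linear_scale[OF L])
  then show ?thesis
    unfolding bil_def s by (simp add: power2_eq_square algebra_simps)
qed

text \<open>A real-valued angle, not merely a direction, and valid in all charts at once: the first
  makes it periodic along the boundary, the second makes the resulting \<open>f\<close> independent
  of the chart.\<close>

definition asymptotic_angle :: "(plane \<Rightarrow> real) \<Rightarrow> bool" where
  "asymptotic_angle \<theta> \<longleftrightarrow> continuous_on (cball 0 1) \<theta> \<and>
    (\<forall>z c U I h W \<phi> \<phi>'. z \<in> cball 0 1 \<longrightarrow> local_chart A S X z c U I h W \<phi> \<phi>' \<longrightarrow>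
      pb_hessian h \<phi> \<phi>' z (circ (\<theta> z)) (circ (\<theta> z)) = 0)"

lemma asymptotic_angleD:
  assumes "asymptotic_angle \<theta>"
  shows "continuous_on (cball 0 1) \<theta>"
    "z \<in> cball 0 1 \<Longrightarrow> local_chart A S X z c U I h W \<phi> \<phi>' \<Longrightarrow>
      pb_hessian h \<phi> \<phi>' z (circ (\<theta> z)) (circ (\<theta> z)) = 0"
  using assms unfolding asymptotic_angle_def by simp_all

text \<open>Each chart has its own Hessian pulled back to the disc, which is why
  \<open>form_at\<close> is a relation rather than a function of the point;
  \<open>hessian_proportional\<close> compares its values.\<close>

lemma asymptotic_angle_exists:
  obtains \<theta> where "asymptotic_angle \<theta>"
proof (rule continuous_null_direction[of "cball 0 1" form_at])
  show "contractible (cball 0 1 :: plane set)" by (simp add: convex_imp_contractible)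
next
  fix z :: plane assume z: "z \<in> cball 0 1"
  have "z \<in> V" using z V by blast
  obtain c U I h W \<phi> \<phi>' where lc: "local_chart A S X z c U I h W \<phi> \<phi>'"
    by (rule smooth_parametrization_chart[OF X \<open>z \<in> V\<close>])
  have cont: "continuous_on W (\<lambda>y. pb_hessian h \<phi> \<phi>' y u w)" for u w
    by (rule continuous_on_bil_hessian[OF local_chartD(5,15,8)[OF lc] local_chartD(14)[OF lc] local_chartD(14)[OF lc]])
  let ?a = "\<lambda>y. pb_hessian h \<phi> \<phi>' y (axis 1 1) (axis 1 1)"
    and ?b = "\<lambda>y. pb_hessian h \<phi> \<phi>' y (axis 1 1) (axis 2 1)"
    and ?e = "\<lambda>y. pb_hessian h \<phi> \<phi>' y (axis 2 1) (axis 2 1)"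
  have "\<forall>y\<in>cball 0 1 \<inter> W. form_at y (?a y) (?b y) (?e y)"
    using form_atI[OF local_chart_move[OF lc]] by simp
  then have "open W \<and> z \<in> W \<and> continuous_on W ?a \<and> continuous_on W ?b \<and> continuous_on W ?e \<and>
      (\<forall>y\<in>cball 0 1 \<inter> W. form_at y (?a y) (?b y) (?e y))"
    by (intro conjI local_chartD(6,7)[OF lc] cont)
  then show "\<exists>W a b e. open W \<and> z \<in> W \<and> continuous_on W a \<and> continuous_on W b \<and>
      continuous_on W e \<and> (\<forall>y\<in>cball 0 1 \<inter> W. form_at y (a y) (b y) (e y))"
    by (rule exI[of _ W, OF exI[of _ ?a, OF exI[of _ ?b, OF exI[of _ ?e]]]])
next
  fix y a b e a' b' e'
  assume ab: "form_at y a b e" "form_at y a' b' e'"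
  obtain c U I h W \<phi> \<phi>' where lc: "local_chart A S X y c U I h W \<phi> \<phi>'"
    and 1: "a = pb_hessian h \<phi> \<phi>' y (axis 1 1) (axis 1 1)"
     "b = pb_hessian h \<phi> \<phi>' y (axis 1 1) (axis 2 1)"
     "e = pb_hessian h \<phi> \<phi>' y (axis 2 1) (axis 2 1)"
    by (rule form_atE[OF ab(1)])
  obtain d U' I' k W' \<psi> \<psi>' where ld: "local_chart A S X y d U' I' k W' \<psi> \<psi>'"
    and 2: "a' = pb_hessian k \<psi> \<psi>' y (axis 1 1) (axis 1 1)"
     "b' = pb_hessian k \<psi> \<psi>' y (axis 1 1) (axis 2 1)"
     "e' = pb_hessian k \<psi> \<psi>' y (axis 2 1) (axis 2 1)"
    by (rule form_atE[OF ab(2)])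
  obtain l where l: "l \<noteq> 0"
    "\<And>u. pb_hessian k \<psi> \<psi>' y u u = l * pb_hessian h \<phi> \<phi>' y u u"
    using hessian_proportional[OF ld lc] by blast
  \<comment> \<open>Proportionality of values passes to the coefficients by inserting the vectors
    (1, 0), (0, 1) and (1, 1).\<close>
  have *: "a' * (u $ 1)\<^sup>2 + 2 * b' * u $ 1 * u $ 2 + e' * (u $ 2)\<^sup>2
      = l * (a * (u $ 1)\<^sup>2 + 2 * b * u $ 1 * u $ 2 + e * (u $ 2)\<^sup>2)" for u :: plane
    using l(2)[of u] unfolding chart_form_expand[OF lc, of u] chart_form_expand[OF ld, of u] 1 2 .
  have "a' = l * a" "e' = l * e" using *[of "vector [1, 0]"] *[of "vector [0, 1]"] by simp_all
  moreover from this have "b' = l * b" using *[of "vector [1, 1]"] by (simp add: algebra_simps)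
  ultimately show "\<exists>l. l \<noteq> 0 \<and> a' = l * a \<and> b' = l * b \<and> e' = l * e" using l(1) by blast
next
  fix y a b e
  assume y: "y \<in> cball 0 1" and ab: "form_at y a b e"
  obtain c U I h W \<phi> \<phi>' where
    lc: "local_chart A S X y c U I h W \<phi> \<phi>'"
    and 1: "a = pb_hessian h \<phi> \<phi>' y (axis 1 1) (axis 1 1)"
     "b = pb_hessian h \<phi> \<phi>' y (axis 1 1) (axis 2 1)"
     "e = pb_hessian h \<phi> \<phi>' y (axis 2 1) (axis 2 1)"
    by (rule form_atE[OF ab])
  note yW = local_chartD(7)[OF lc]
  note s = hessian_chart_sym[OF lc local_chartD(10)[OF lc yW]]
  have "(a, b, e) \<noteq> (0, 0, 0)"
  proof
    assume "(a, b, e) = (0, 0, 0)"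
    then have "pb_hessian h \<phi> \<phi>' y u u = 0" for u
      using 1 by (subst chart_form_expand[OF lc]) simp
    then have "bil (hessian h (\<phi> y)) w w = 0" for w using chart_surj[OF lc] by (metis surjD)
    then have "hessian h (\<phi> y) = 0" by (rule symmetric_matrix_eq_0[OF s])
    then show False using hessian_chart_nz[OF lc local_chartD(10)[OF lc yW]] by simp
  qed
  \<comment> \<open>By \<open>bil_lagrange\<close> the difference of the two sides is the Hessian
    determinant times a square.\<close>
  moreover have "a * e \<le> b\<^sup>2"
    unfolding 1 bil_lagrange[OF s] using det_closed_disc[OF lc y]
    by (simp add: mult_nonpos_nonneg)
  ultimately show "(a, b, e) \<noteq> (0, 0, 0) \<and> a * e \<le> b\<^sup>2" ..
next
  fix \<theta>
  assume \<theta>: "continuous_on (cball 0 1) \<theta>"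
    "\<And>y a b e. y \<in> cball 0 1 \<Longrightarrow> form_at y a b e \<Longrightarrow>
       a * (cos (\<theta> y))\<^sup>2 + 2 * b * cos (\<theta> y) * sin (\<theta> y) + e * (sin (\<theta> y))\<^sup>2 = 0"
  have "asymptotic_angle \<theta>"
    unfolding asymptotic_angle_def
  proof (intro conjI \<theta>(1) allI impI)
    fix z c U I h W \<phi> \<phi>' assume z: "z \<in> cball 0 1" and lc: "local_chart A S X z c U I h W \<phi> \<phi>'"
    from \<theta>(2)[OF z form_atI[OF lc]]
    show "pb_hessian h \<phi> \<phi>' z (circ (\<theta> z)) (circ (\<theta> z)) = 0"
      unfolding chart_form_expand[OF lc, of "circ (\<theta> z)"] by simp
  qed
  then show thesis by (rule that)
qed

text \<open>
  Relative to the frame \<open>(circ s, tang s)\<close> the asymptotic direction field extended over the disc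
  makes one full negative turn along the boundary; hence \<open>f\<close>, which measures its angle from
  \<open>tang s\<close> in units of \<open>- pi\<close>, increases by \<open>2\<close>.
\<close>

lemma sum_godron_index:
  shows "finite (godrons A S \<inter> X ` sphere 0 1)"
    and "p \<in> godrons A S \<inter> X ` sphere 0 1 \<Longrightarrow> godron_index A S p = 1 \<or> godron_index A S p = - 1"
    and "(\<Sum>p \<in> godrons A S \<inter> X ` sphere 0 1. godron_index A S p) = 2"
proof -
  obtain \<theta> where \<theta>: "asymptotic_angle \<theta>" by (rule asymptotic_angle_exists)
  \<comment> \<open>\<open>\<theta> (circ s) - s\<close> is the angle of the asymptotic direction
    with respect to \<open>circ s\<close>, and \<open>tang s\<close> stands at
    \<open>pi / 2\<close>.\<close>
  define f where "f s = (pi / 2 - (\<theta> (circ s) - s)) / pi" for s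
  have "continuous_on UNIV (\<lambda>s. \<theta> (circ s))"
    by (rule continuous_on_compose2[OF asymptotic_angleD(1)[OF \<theta>] continuous_on_circ]) auto
  then have "continuous_on UNIV f" unfolding f_def[abs_def] by (intro continuous_intros) auto
  then have f_cont: "isCont f s" for s by (simp add: continuous_on_eq_continuous_at)
  \<comment> \<open>The angle \<open>\<theta>\<close> returns to its value after one turn, so the
    increment comes from the term \<open>s / pi\<close> alone.\<close>
  have f_shift: "f (s + 2 * pi) = f s + of_int 2" for s
    unfolding f_def circ_periodic by (simp add: field_simps)
  have frame: "sin (pi * f s) *\<^sub>R circ s + cos (pi * f s) *\<^sub>R tang s = circ (\<theta> (circ s))" for s
  proof -
    have "pi * f s = pi / 2 - (\<theta> (circ s) - s)" by (simp add: f_def)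
    then have "sin (pi * f s) = cos (\<theta> (circ s) - s)" "cos (pi * f s) = sin (\<theta> (circ s) - s)"
      by (simp_all only: sin_diff cos_diff sin_pi_half cos_pi_half) simp_all
    then show ?thesis using circ_rotate[of s "\<theta> (circ s) - s"] by simp
  qed
  have bc: "boundary_chart h U \<phi> \<phi>' W f" if lc: "local_chart A S X (circ s) c U I h W \<phi> \<phi>'"
    for s c U I h W \<phi> \<phi>'
  proof
    show "det (hessian h (\<phi> y)) < 0" if "y \<in> W" "norm y < 1" for y
      using det_inside[OF local_chart_move[OF lc that(1)] that(2)] .
    show "det (hessian h (\<phi> y)) = 0" if "y \<in> W" "norm y = 1" for y
      using det_boundary[OF local_chart_move[OF lc that(1)] that(2)] .
    show "let w = \<phi>' (circ s) (sin (pi * f s) *\<^sub>R circ s + cos (pi * f s) *\<^sub>R tang s) in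
       bil (hessian h (\<phi> (circ s))) w w = 0" if "circ s \<in> W" for s
      unfolding frame Let_def by (rule asymptotic_angleD(2)[OF \<theta> _ local_chart_move[OF lc that]]) simp
  qed (fact local_chartD[OF lc] generic_chart[OF lc] f_cont)+
  have dom: "s \<in> boundary_chart.dom W" if lc: "local_chart A S X (circ s) c U I h W \<phi> \<phi>'"
    for s c U I h W \<phi> \<phi>'
    using local_chartD(7)[OF lc] boundary_chart.dom_def[OF bc[OF lc]] by blast
  have \<gamma>: "boundary_chart.\<gamma> \<phi> s = \<phi> (circ s)" if lc: "local_chart A S X (circ s) c U I h W \<phi> \<phi>'"
    for s c U I h W \<phi> \<phi>'
    by (rule boundary_chart.\<gamma>_def[OF bc[OF lc]])
  \<comment> \<open>If a predicate has the same truth value \<open>Q\<close> in every chart, the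
    existential choice of a Monge form in \<open>points_where\<close> is harmless.\<close>
  have points: "X (circ s) \<in> points_where A S P \<longleftrightarrow> Q"
    if "\<And>c U I h W \<phi> \<phi>'. local_chart A S X (circ s) c U I h W \<phi> \<phi>' \<Longrightarrow> P h (\<phi> (circ s)) \<longleftrightarrow> Q" for s P Q
  proof
    assume "X (circ s) \<in> points_where A S P"
    moreover have "circ s \<in> cball 0 1" by simp
    ultimately obtain d U I k W \<psi> \<psi>' where "local_chart A S X (circ s) d U I k W \<psi> \<psi>'" "P k (\<psi> (circ s))"
      using chart_at_point by metis
    then show Q using that by simp
  next
    assume Q: Q
    have "circ s \<in> V" using V by auto
    obtain c U I h W \<phi> \<phi>' where lc: "local_chart A S X (circ s) c U I h W \<phi> \<phi>'"
      by (rule smooth_parametrization_chart[OF X \<open>circ s \<in> V\<close>])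
    have "P h (\<phi> (circ s))" using that[OF lc] Q by simp
    then have "X (circ s) = c (\<phi> (circ s), h (\<phi> (circ s))) \<and>
        monge A S c U I h \<and> \<phi> (circ s) \<in> U \<and> P h (\<phi> (circ s))"
      using local_chartD(1,7,10,11)[OF lc] by simp
    then show "X (circ s) \<in> points_where A S P"
      unfolding points_where_def mem_Collect_eq
      by (rule exI[of _ c, OF exI[of _ U, OF exI[of _ I, OF exI[of _ h, OF exI[of _ "\<phi> (circ s)"]]]]])
  qed
  have godron: "X (circ s) \<in> godrons A S \<longleftrightarrow> f s \<in> \<int>" for s
    unfolding godrons_def
  proof (rule points)
    fix c U I h W \<phi> \<phi>' assume lc: "local_chart A S X (circ s) c U I h W \<phi> \<phi>'"
    show "godron_at h (\<phi> (circ s)) \<longleftrightarrow> f s \<in> \<int>"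
      using boundary_chart.godron_iff[OF bc[OF lc] dom[OF lc]] unfolding \<gamma>[OF lc] .
  qed
  have index: "godron_index A S (X (circ s)) = crossing_sign f s" if fs: "f s \<in> \<int>" for s
  proof -
    have "X (circ s) \<in> points_where A S positive_godron_at \<longleftrightarrow> upcrossing f s"
    proof (rule points)
      fix c U I h W \<phi> \<phi>' assume lc: "local_chart A S X (circ s) c U I h W \<phi> \<phi>'"
      show "positive_godron_at h (\<phi> (circ s)) \<longleftrightarrow> upcrossing f s"
        using boundary_chart.positive_iff[OF bc[OF lc] dom[OF lc] fs] unfolding \<gamma>[OF lc] .
    qed
    moreover have "X (circ s) \<in> points_where A S negative_godron_at \<longleftrightarrow> \<not> upcrossing f s"
    proof (rule points)
      fix c U I h W \<phi> \<phi>' assume lc: "local_chart A S X (circ s) c U I h W \<phi> \<phi>'"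
      show "negative_godron_at h (\<phi> (circ s)) \<longleftrightarrow> \<not> upcrossing f s"
        using boundary_chart.negative_iff[OF bc[OF lc] dom[OF lc] fs] unfolding \<gamma>[OF lc] .
    qed
    ultimately show ?thesis by (simp add: godron_index_def crossing_sign_def)
  qed
  have cross: "upcrossing f s \<or> downcrossing f s" if fs: "f s \<in> \<int>" for s
  proof -
    have "circ s \<in> V" using V by auto
    obtain c U I h W \<phi> \<phi>' where lc: "local_chart A S X (circ s) c U I h W \<phi> \<phi>'"
      by (rule smooth_parametrization_chart[OF X \<open>circ s \<in> V\<close>])
    show ?thesis by (rule boundary_chart.crossing_dichotomy[OF bc[OF lc] dom[OF lc] fs])
  qed
  \<comment> \<open>The half-open interval meets every point of the circle exactly once, so that
    counting crossings counts godrons.\<close>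
  define Z where "Z = {t \<in> {0..<2 * pi}. f t \<in> \<int>}"
  have sphere: "sphere 0 1 = circ ` {0..<2 * pi}"
  proof
    show "sphere 0 1 \<subseteq> circ ` {0..<2 * pi}"
    proof
      fix y :: plane assume "y \<in> sphere 0 1"
      then have "norm y = 1" by simp
      then obtain s where "0 \<le> s" "s < 2 * pi" "y = circ s" by (rule norm_1_imp_circ)
      then show "y \<in> circ ` {0..<2 * pi}" by simp
    qed
  qed auto
  have G: "godrons A S \<inter> X ` sphere 0 1 = (\<lambda>s. X (circ s)) ` Z"
    unfolding sphere Z_def using godron by auto
  have inj: "inj_on (\<lambda>s. X (circ s)) Z"
  proof (rule inj_onI)
    fix s t assume st: "s \<in> Z" "t \<in> Z" "X (circ s) = X (circ t)"
    have "inj_on X V" using X by (simp add: smooth_parametrization_def)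
    moreover have "circ s \<in> V" "circ t \<in> V" using V by auto
    ultimately have "circ s = circ t" using st(3) by (auto dest: inj_onD)
    then show "s = t" using circ_inj_on st(1,2) by (auto simp: Z_def dest: inj_onD)
  qed
  have fin: "finite Z" and sum: "sum (crossing_sign f) Z = left_floor f (2 * pi) - left_floor f 0"
    unfolding Z_def by (rule sum_crossing_signs[OF _ f_cont cross]; simp)+
  show "finite (godrons A S \<inter> X ` sphere 0 1)" unfolding G using fin by simp
  show "godron_index A S p = 1 \<or> godron_index A S p = - 1" if p: "p \<in> godrons A S \<inter> X ` sphere 0 1"
  proof -
    obtain s where "s \<in> Z" "p = X (circ s)" using p unfolding G by blast
    then show ?thesis using index by (auto simp: Z_def crossing_sign_def)
  qed
  have "(\<Sum>p \<in> godrons A S \<inter> X ` sphere 0 1. godron_index A S p) = (\<Sum>s\<in>Z. godron_index A S (X (circ s)))"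
    unfolding G sum.reindex[OF inj] by simp
  also have "\<dots> = sum (crossing_sign f) Z"
    by (rule sum.cong) (auto simp: Z_def index)
  also have "\<dots> = 2"
    using sum left_floor_shift[of f "2 * pi" 2 0, OF f_shift] by simp
  finally show "(\<Sum>p \<in> godrons A S \<inter> X ` sphere 0 1. godron_index A S p) = 2" .
qed

end

lemma hyperbolic_disc_godrons:
  fixes S H :: "'a::topological_space set"
  assumes A: "projective_coords A" and S: "generic_surface A S" and H: "hyperbolic_disc A S H"
  shows "(\<Sum>p \<in> godrons A S \<inter> boundary_in S H. godron_index A S p) = 2 \<and>
    card (godrons A S \<inter> boundary_in S H) > 0 \<and> even (card (godrons A S \<inter> boundary_in S H))"
proof -
  interpret projective_coords A by (rule A)
  obtain V X where par: "smooth_parametrization A S V X" "cball 0 1 \<subseteq> V" "X ` ball 0 1 = H"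
    "X ` sphere 0 1 = boundary_in S H"
    using H unfolding hyperbolic_disc_def by blast
  have "H \<subseteq> hyperbolic_domain A S" "boundary_in S H \<subseteq> parabolic_curve A S"
    using H in_components_subset unfolding hyperbolic_disc_def by blast+
  then interpret disc_parametrization A S V X
    by unfold_locales (use S par in simp_all)
  let ?G = "godrons A S \<inter> boundary_in S H"
  have fin: "finite ?G" and sign: "\<And>p. p \<in> ?G \<Longrightarrow> godron_index A S p = 1 \<or> godron_index A S p = - 1"
    and sum: "(\<Sum>p \<in> ?G. godron_index A S p) = 2"
    using sum_godron_index unfolding par(4) by blast+
  have "?G \<noteq> {}" using sum by auto
  then have "card ?G > 0" using fin by (simp add: card_gt_0_iff)
  moreover have "even (card ?G)" using parity_of_sum_of_signs[of ?G "godron_index A S", OF fin sign] sum by simp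
  ultimately show ?thesis using sum by blast
qed

theorem proposition5:
  shows
    "(\<forall>S H :: (real^3) set.
        generic_surface R3_coords S \<and> hyperbolic_disc R3_coords S H \<longrightarrow>
          (\<Sum>p \<in> godrons R3_coords S \<inter> boundary_in S H. godron_index R3_coords S p) = 2 \<and>
          card (godrons R3_coords S \<inter> boundary_in S H) > 0 \<and>
          even (card (godrons R3_coords S \<inter> boundary_in S H)))
     \<and>
     (\<forall>S H :: rp3 set.
        generic_surface RP3_coords S \<and> hyperbolic_disc RP3_coords S H \<longrightarrow>
          (\<Sum>p \<in> godrons RP3_coords S \<inter> boundary_in S H. godron_index RP3_coords S p) = 2 \<and>
          card (godrons RP3_coords S \<inter> boundary_in S H) > 0 \<and>
          even (card (godrons RP3_coords S \<inter> boundary_in S H)))"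
  using hyperbolic_disc_godrons[OF R3.projective_coords_axioms]
    hyperbolic_disc_godrons[OF RP3.projective_coords_axioms] by blast

end
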